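(* Let $\Omega\subset\mathbb{R}^3$ be a Lipschitz domain, let $\Omega_1,\dots,\Omega_M\subset\Omega$ be pairwise disjoint open sets (slip patches) covering $\Omega$ up to a null set, let $u\in H^1(\Omega;\mathbb{R}^3)$, and let $\beta$ be smooth on $\Omega$ with $\beta=s\otimes m_j$, $s\in m_j^\perp$, on $\Omega_j$ for each $j$, where $\mathrm{supp}\, s|_{\overline{\Omega}_j}$ is Lipschitz and compactly contained in $\Omega_j\cup(\partial\Omega\cap\partial\Omega_j)$. Then there exists a sequence $(u_n,\beta_n)$ such that $u_n\in H^1(\Omega;\mathbb{R}^3)$, $u_n=u$ on $\partial\Omega$, $\beta_n\in L^\infty(\Omega;\mathbb{R}^{3\times3})$ satisfies the single-slip condition (SSC), and $$E(u_n,\beta_n)\to E_{\mathrm{rel}}(u,\beta)\quad\text{as }n\to\infty.$$ Moreover, the relaxed energy is convex on each $\Omega_j$ as a function of $s$; that is, for each $j$ and fixed $u$, with $\Omega$ replaced by $\Omega_j$ and the normal fixed to be $m_j$, the map $s\mapsto E_{\mathrm{rel}}(u,s\otimes m_j)$ on functions $s:\Omega_j\to m_j^\perp$ is convex.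
   Context: Slip systems. $\mathcal{M}=\{m_1,\dots,m_M\}$ is a finite set of pairwise non-parallel unit vectors in $\mathbb{R}^3$ (slip normals). For each $i$ two linearly independent unit vectors (Burgers vectors) $b_{1,i},b_{2,i}\in m_i^\perp$ are given. Plastic distortions are matrix fields $\beta=s\otimes m:\Omega\to\mathbb{R}^{3\times3}$. (SSC): for a.e. $x\in\Omega$, $m(x)=m_{i(x)}\in\mathcal{M}$ and $s(x)$ is a real multiple of $b_{1,i(x)}$ or a real multiple of $b_{2,i(x)}$. (RSC): for a.e. $x\in\Omega$, $m(x)=m_{i(x)}\in\mathcal{M}$ and $s(x)\in m_{i(x)}^\perp$. Planar curl. Given $\beta=s\otimes m$ satisfying (RSC), let $A_j=\{x\in\Omega: m(x)=m_j\}$. For each $j$ use Cartesian coordinates $(x^1,y,z)$ with the $x^1$-axis in direction $m_j$, and put $\Omega_t=\Omega\cap\{x^1=t\}$. For a scalar or vector function $f$ on $\Omega_t$, $|D_{y,z}f|(\Omega_t)$ is its total variation on the planar open set $\Omega_t$ (supremum of $\sum_i\iint_{\Omega_t} f_i(\mathrm{div}\,\phi)_i\,dy\,dz$ over $\phi\in C^1_c$ with $|\phi|\le1$, the divergence being taken row-wise and $|\cdot|$ being the Euclidean/Frobenius norm; $+\infty$ if $f\notin BV$). Set $$\|\mathrm{curl}_{m_j}\beta\|_\Omega=\int_{\mathbb{R}}|D_{y,z}(\chi_{A_j}s)|(\Omega_t)\,dt,\qquad \|\mathrm{curl}_{\mathcal{M}}\beta\|_\Omega=\sum_{j=1}^M\|\mathrm{curl}_{m_j}\beta\|_\Omega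 .$$ Laminated quantities. On $A_j$ write $s=c_1b_{1,j}+c_2b_{2,j}$ (this defines scalar functions $c_1,c_2$ on $\Omega$). Set $$\|\mathrm{curl}_{m_j}\beta\|_{\mathrm{lam}}=\sum_{i=1}^2\int_{\mathbb{R}}|D_{y,z}(\chi_{A_j}c_i)|(\Omega_t)\,dt,\quad \|\mathrm{curl}_{\mathcal{M}}\beta\|_{\mathrm{lam}}=\sum_{j=1}^M\|\mathrm{curl}_{m_j}\beta\|_{\mathrm{lam}},\quad \|\beta\|_{1-\mathrm{lam}}=\sum_{i=1}^2\int_\Omega|c_i|\,dx .$$ Energies. Fix $\sigma,\tau\ge0$. With $A_{\mathrm{sym}}=\tfrac12(A+A^T)$, $$E(u,\beta)=\int_\Omega|(\nabla u-\beta)_{\mathrm{sym}}|^2dx+\sigma\|\mathrm{curl}_{\mathcal{M}}\beta\|_\Omega+\tau\int_\Omega|\beta|\,dx$$ if (SSC) holds, and $E(u,\beta)=+\infty$ otherwise; $$E_{\mathrm{rel}}(u,\beta)=\int_\Omega|(\nabla u-\beta)_{\mathrm{sym}}|^2dx+\sigma\|\mathrm{curl}_{\mathcal{M}}\beta\|_{\mathrm{lam}}+\tau\|\beta\|_{1-\mathrm{lam}}$$ if (RSC) holds, and $E_{\mathrm{rel}}(u,\beta)=+\infty$ otherwise. *)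

theory Defs
  imports "HOL-Analysis.Analysis"
begin

section \<open>Function spaces\<close>

fun Ck_on :: "nat \<Rightarrow> 'a::euclidean_space set \<Rightarrow> ('a \<Rightarrow> 'b::real_normed_vector) \<Rightarrow> bool" where
  "Ck_on 0 U f \<longleftrightarrow> continuous_on U f"
| "Ck_on (Suc k) U f \<longleftrightarrow> (\<forall>x\<in>U. f differentiable (at x)) \<and>
     (\<forall>v. Ck_on k U (\<lambda>x. frechet_derivative f (at x) v))"

definition smooth_on :: "'a::euclidean_space set \<Rightarrow> ('a \<Rightarrow> 'b::real_normed_vector) \<Rightarrow> bool" where
  "smooth_on U f \<longleftrightarrow> (\<forall>k. Ck_on k U f)"

definition supp :: "('a::topological_space \<Rightarrow> 'b::zero) \<Rightarrow> 'a set" where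
  "supp f = closure {x. f x \<noteq> 0}"

text \<open>Compactly supported test functions are total functions, extended by zero outside the
  open set they live on.\<close>

definition C1c :: "'a::euclidean_space set \<Rightarrow> ('a \<Rightarrow> 'b::real_normed_vector) set" where
  "C1c U = {\<phi>. Ck_on 1 UNIV \<phi> \<and> compact (supp \<phi>) \<and> supp \<phi> \<subseteq> U}"

definition Cinfc :: "'a::euclidean_space set \<Rightarrow> ('a \<Rightarrow> 'b::real_normed_vector) set" where
  "Cinfc U = {\<phi>. smooth_on UNIV \<phi> \<and> compact (supp \<phi>) \<and> supp \<phi> \<subseteq> U}"

definition L2 :: "'a::euclidean_space set \<Rightarrow> ('a \<Rightarrow> 'b::euclidean_space) set" where
  "L2 \<Omega> = {f. f \<in> borel_measurable (lebesgue_on \<Omega>) \<and>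
             (\<integral>\<^sup>+x. ennreal ((norm (f x))\<^sup>2) \<partial>lebesgue_on \<Omega>) < \<infinity>}"

definition Linf :: "'a::euclidean_space set \<Rightarrow> ('a \<Rightarrow> 'b::euclidean_space) set" where
  "Linf \<Omega> = {f. f \<in> borel_measurable (lebesgue_on \<Omega>) \<and>
               (\<exists>C. AE x in lebesgue_on \<Omega>. norm (f x) \<le> C)}"

text \<open>Row \<open>i\<close>, column \<open>k\<close> of the gradient is the \<open>k\<close>-th partial derivative of the \<open>i\<close>-th
  component.\<close>

definition is_weak_gradient :: "(real^3) set \<Rightarrow> (real^3 \<Rightarrow> real^3) \<Rightarrow> (real^3 \<Rightarrow> real^3^3) \<Rightarrow> bool" where
  "is_weak_gradient \<Omega> u G \<longleftrightarrow> G \<in> L2 \<Omega> \<and>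
     (\<forall>\<phi> :: real^3 \<Rightarrow> real. \<phi> \<in> Cinfc \<Omega> \<longrightarrow> (\<forall>i k.
        (LINT x|lebesgue_on \<Omega>. u x $ i * frechet_derivative \<phi> (at x) (axis k 1)) =
        - (LINT x|lebesgue_on \<Omega>. G x $ i $ k * \<phi> x)))"

definition H1 :: "(real^3) set \<Rightarrow> (real^3 \<Rightarrow> real^3) set" where
  "H1 \<Omega> = {u. u \<in> L2 \<Omega> \<and> (\<exists>G. is_weak_gradient \<Omega> u G)}"

text \<open>The weak gradient of an \<open>H1\<close> function is unique up to a null set; \<open>wgrad\<close> is a representative.\<close>

definition wgrad :: "(real^3) set \<Rightarrow> (real^3 \<Rightarrow> real^3) \<Rightarrow> real^3 \<Rightarrow> real^3^3" where
  "wgrad \<Omega> u = (SOME G. is_weak_gradient \<Omega> u G)"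

definition H1_norm_sq :: "(real^3) set \<Rightarrow> (real^3 \<Rightarrow> real^3) \<Rightarrow> ennreal" where
  "H1_norm_sq \<Omega> u =
     (\<integral>\<^sup>+x. ennreal ((norm (u x))\<^sup>2 + (norm (wgrad \<Omega> u x))\<^sup>2) \<partial>lebesgue_on \<Omega>)"

definition H10 :: "(real^3) set \<Rightarrow> (real^3 \<Rightarrow> real^3) set" where
  "H10 \<Omega> = {u \<in> H1 \<Omega>. \<exists>\<phi>. (\<forall>k::nat. \<phi> k \<in> Cinfc \<Omega>) \<and>
              (\<lambda>k. H1_norm_sq \<Omega> (\<lambda>x. u x - \<phi> k x)) \<longlonglongrightarrow> 0}"

text \<open>Boundary values are compared in the sense of traces: on a Lipschitz domain, \<open>H10\<close> consists of
  the \<open>H1\<close> functions with zero trace.\<close>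

definition same_boundary_values :: "(real^3) set \<Rightarrow> (real^3 \<Rightarrow> real^3) \<Rightarrow> (real^3 \<Rightarrow> real^3) \<Rightarrow> bool" where
  "same_boundary_values \<Omega> u v \<longleftrightarrow> (\<lambda>x. u x - v x) \<in> H10 \<Omega>"


section \<open>Lipschitz sets\<close>

text \<open>Near every boundary point the set is the part below the graph of a Lipschitz function
  over a hyperplane, with normal direction \<open>\<nu>\<close>. Phrased through the interior and the frontier,
  so that it applies to open sets and to closed sets (such as supports) alike.\<close>

definition lipschitz_boundary :: "'a::euclidean_space set \<Rightarrow> bool" where
  "lipschitz_boundary S \<longleftrightarrow> (\<forall>p\<in>frontier S. \<exists>\<nu> U L (g :: 'a \<Rightarrow> real).
     norm \<nu> = 1 \<and> open U \<and> p \<in> U \<and> L-lipschitz_on {y. y \<bullet> \<nu> = 0} g \<and>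
     (\<forall>x\<in>U. (x \<in> interior S \<longleftrightarrow> x \<bullet> \<nu> < g (x - (x \<bullet> \<nu>) *\<^sub>R \<nu>)) \<and>
            (x \<in> frontier S \<longleftrightarrow> x \<bullet> \<nu> = g (x - (x \<bullet> \<nu>) *\<^sub>R \<nu>))))"

definition lipschitz_domain :: "'a::euclidean_space set \<Rightarrow> bool" where
  "lipschitz_domain S \<longleftrightarrow> open S \<and> connected S \<and> S \<noteq> {} \<and> lipschitz_boundary S"


section \<open>Total variation of functions on planar open sets\<close>

text \<open>A test field \<open>\<phi>\<close> takes values in pairs of elements of \<open>'b\<close>: \<open>\<phi> w $ k\<close> is the \<open>k\<close>-th column
  of the matrix \<open>\<phi> w\<close>, so the sum below is the row-wise divergence, and the norm of \<open>'b^2\<close>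
  is the Frobenius norm.\<close>

definition div2 :: "(real^2 \<Rightarrow> 'b::euclidean_space^2) \<Rightarrow> real^2 \<Rightarrow> 'b" where
  "div2 \<phi> w = (\<Sum>k\<in>UNIV. frechet_derivative \<phi> (at w) (axis k 1) $ k)"

text \<open>The coercion \<open>ennreal\<close> maps negative numbers to 0; this does not change the supremum, since
  \<open>\<phi> = 0\<close> is admissible.\<close>

definition tv :: "(real^2) set \<Rightarrow> (real^2 \<Rightarrow> 'b::euclidean_space) \<Rightarrow> ennreal" where
  "tv U f = (if integrable (lebesgue_on U) f
     then (SUP \<phi> \<in> {\<phi> \<in> C1c U. \<forall>w. norm (\<phi> w) \<le> 1}.
             ennreal (LINT w|lebesgue_on U. f w \<bullet> div2 \<phi> w))
     else \<infinity>)"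


section \<open>Slip systems\<close>

text \<open>\<open>burgers S i j\<close> is \<open>b_{i,j}\<close>. The record also carries, for every slip normal, the two
  remaining axes \<open>dir_y\<close>, \<open>dir_z\<close> of a Cartesian coordinate system whose first axis has the
  direction of that normal. Slip systems are indexed by \<open>{1..num_slips S}\<close>.\<close>

record slip_system =
  num_slips :: nat
  normal :: "nat \<Rightarrow> real^3"
  burgers :: "2 \<Rightarrow> nat \<Rightarrow> real^3"
  dir_y :: "nat \<Rightarrow> real^3"
  dir_z :: "nat \<Rightarrow> real^3"

definition valid_slip_system :: "slip_system \<Rightarrow> bool" where
  "valid_slip_system S \<longleftrightarrow>
     (\<forall>j\<in>{1..num_slips S}. norm (normal S j) = 1) \<and>
     (\<forall>j\<in>{1..num_slips S}. \<forall>k\<in>{1..num_slips S}. j \<noteq> k \<longrightarrow> \<not> collinear {0, normal S j, normal S k}) \<and>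
     (\<forall>j\<in>{1..num_slips S}.
        (\<forall>i. norm (burgers S i j) = 1 \<and> burgers S i j \<bullet> normal S j = 0) \<and>
        burgers S 1 j \<noteq> burgers S 2 j \<and> independent {burgers S 1 j, burgers S 2 j}) \<and>
     (\<forall>j\<in>{1..num_slips S}.
        norm (dir_y S j) = 1 \<and> norm (dir_z S j) = 1 \<and> dir_y S j \<bullet> dir_z S j = 0 \<and>
        dir_y S j \<bullet> normal S j = 0 \<and> dir_z S j \<bullet> normal S j = 0)"

definition tensor :: "real^3 \<Rightarrow> real^3 \<Rightarrow> real^3^3" (infixl \<open>\<otimes>\<^sub>v\<close> 72) where
  "s \<otimes>\<^sub>v m = (\<chi> i k. s $ i * m $ k)"

definition SSC :: "slip_system \<Rightarrow> (real^3) set \<Rightarrow> (real^3 \<Rightarrow> real^3^3) \<Rightarrow> bool" where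
  "SSC S \<Omega> \<beta> \<longleftrightarrow> (AE x in lebesgue_on \<Omega>. \<exists>j\<in>{1..num_slips S}. \<exists>i c.
     \<beta> x = (c *\<^sub>R burgers S i j) \<otimes>\<^sub>v normal S j)"

definition RSC :: "slip_system \<Rightarrow> (real^3) set \<Rightarrow> (real^3 \<Rightarrow> real^3^3) \<Rightarrow> bool" where
  "RSC S \<Omega> \<beta> \<longleftrightarrow> (AE x in lebesgue_on \<Omega>. \<exists>j\<in>{1..num_slips S}. \<exists>s.
     s \<bullet> normal S j = 0 \<and> \<beta> x = s \<otimes>\<^sub>v normal S j)"

text \<open>Decomposition \<open>B = s \<otimes> m_j\<close> of a value of a field satisfying \<open>RSC\<close>. Since the normals are
  pairwise non-parallel, the index \<open>j\<close> is unique unless \<open>B = 0\<close>, in which case \<open>s = 0\<close> and the choice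
  of \<open>j\<close> has no influence on the quantities below. As \<open>m_j\<close> is a unit vector, \<open>s = B m_j\<close>.\<close>

definition slip_index :: "slip_system \<Rightarrow> real^3^3 \<Rightarrow> nat" where
  "slip_index S B = (SOME j. j \<in> {1..num_slips S} \<and>
     (\<exists>s. s \<bullet> normal S j = 0 \<and> B = s \<otimes>\<^sub>v normal S j))"

definition slip_vec :: "slip_system \<Rightarrow> real^3^3 \<Rightarrow> real^3" where
  "slip_vec S B = B *v normal S (slip_index S B)"

definition slip_coeff :: "slip_system \<Rightarrow> real^3^3 \<Rightarrow> real^2" where
  "slip_coeff S B = (THE c. slip_vec S B = (\<Sum>i\<in>UNIV. c $ i *\<^sub>R burgers S i (slip_index S B)))"

text \<open>\<open>slip_region S \<Omega> \<beta> j\<close> is \<open>A_j\<close>, the set where the slip normal of \<open>\<beta>\<close> is \<open>m_j\<close>.\<close>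

definition slip_region :: "slip_system \<Rightarrow> (real^3) set \<Rightarrow> (real^3 \<Rightarrow> real^3^3) \<Rightarrow> nat \<Rightarrow> (real^3) set" where
  "slip_region S \<Omega> \<beta> j = {x \<in> \<Omega>. slip_index S (\<beta> x) = j}"


section \<open>Planar curl and energies\<close>

definition plane_point :: "slip_system \<Rightarrow> nat \<Rightarrow> real \<Rightarrow> real^2 \<Rightarrow> real^3" where
  "plane_point S j t w = t *\<^sub>R normal S j + (w $ 1) *\<^sub>R dir_y S j + (w $ 2) *\<^sub>R dir_z S j"

definition planar_slice :: "slip_system \<Rightarrow> nat \<Rightarrow> (real^3) set \<Rightarrow> real \<Rightarrow> (real^2) set" where
  "planar_slice S j \<Omega> t = {w. plane_point S j t w \<in> \<Omega>}"

definition sliced_tv :: "slip_system \<Rightarrow> nat \<Rightarrow> (real^3) set \<Rightarrow> (real^3 \<Rightarrow> 'b::euclidean_space) \<Rightarrow> ennreal" where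
  "sliced_tv S j \<Omega> f =
     (\<integral>\<^sup>+t. tv (planar_slice S j \<Omega> t) (\<lambda>w. f (plane_point S j t w)) \<partial>lborel)"

definition curl_norm :: "slip_system \<Rightarrow> (real^3) set \<Rightarrow> (real^3 \<Rightarrow> real^3^3) \<Rightarrow> ennreal" where
  "curl_norm S \<Omega> \<beta> = (\<Sum>j\<in>{1..num_slips S}.
     sliced_tv S j \<Omega> (\<lambda>x. indicator (slip_region S \<Omega> \<beta> j) x *\<^sub>R slip_vec S (\<beta> x)))"

definition curl_norm_lam :: "slip_system \<Rightarrow> (real^3) set \<Rightarrow> (real^3 \<Rightarrow> real^3^3) \<Rightarrow> ennreal" where
  "curl_norm_lam S \<Omega> \<beta> = (\<Sum>j\<in>{1..num_slips S}. \<Sum>i\<in>UNIV.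
     sliced_tv S j \<Omega> (\<lambda>x. indicat_real (slip_region S \<Omega> \<beta> j) x * slip_coeff S (\<beta> x) $ i))"

definition norm_1_lam :: "slip_system \<Rightarrow> (real^3) set \<Rightarrow> (real^3 \<Rightarrow> real^3^3) \<Rightarrow> ennreal" where
  "norm_1_lam S \<Omega> \<beta> = (\<Sum>i\<in>UNIV. \<integral>\<^sup>+x. ennreal \<bar>slip_coeff S (\<beta> x) $ i\<bar> \<partial>lebesgue_on \<Omega>)"

definition sym_part :: "real^3^3 \<Rightarrow> real^3^3" where
  "sym_part A = (1/2) *\<^sub>R (A + transpose A)"

definition elastic_energy :: "(real^3) set \<Rightarrow> (real^3 \<Rightarrow> real^3) \<Rightarrow> (real^3 \<Rightarrow> real^3^3) \<Rightarrow> ennreal" where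
  "elastic_energy \<Omega> u \<beta> =
     (\<integral>\<^sup>+x. ennreal ((norm (sym_part (wgrad \<Omega> u x - \<beta> x)))\<^sup>2) \<partial>lebesgue_on \<Omega>)"

text \<open>The energies take values in \<open>[0,\<infinity>]\<close>, with the usual convention \<open>0 \<cdot> \<infinity> = 0\<close> for
  vanishing parameters \<open>\<sigma>\<close>, \<open>\<tau>\<close>.\<close>

definition energy :: "slip_system \<Rightarrow> real \<Rightarrow> real \<Rightarrow> (real^3) set \<Rightarrow>
    (real^3 \<Rightarrow> real^3) \<Rightarrow> (real^3 \<Rightarrow> real^3^3) \<Rightarrow> ennreal" where
  "energy S \<sigma> \<tau> \<Omega> u \<beta> = (if SSC S \<Omega> \<beta>
     then elastic_energy \<Omega> u \<beta> + ennreal \<sigma> * curl_norm S \<Omega> \<beta>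
          + ennreal \<tau> * (\<integral>\<^sup>+x. ennreal (norm (\<beta> x)) \<partial>lebesgue_on \<Omega>)
     else \<infinity>)"

definition energy_rel :: "slip_system \<Rightarrow> real \<Rightarrow> real \<Rightarrow> (real^3) set \<Rightarrow>
    (real^3 \<Rightarrow> real^3) \<Rightarrow> (real^3 \<Rightarrow> real^3^3) \<Rightarrow> ennreal" where
  "energy_rel S \<sigma> \<tau> \<Omega> u \<beta> = (if RSC S \<Omega> \<beta>
     then elastic_energy \<Omega> u \<beta> + ennreal \<sigma> * curl_norm_lam S \<Omega> \<beta>
          + ennreal \<tau> * norm_1_lam S \<Omega> \<beta>
     else \<infinity>)"

end

theory Submission
  imports Defs
begin

text \<open>
  The relaxed energy is approached by fine laminates. Where \<open>\<beta> = s \<otimes> m\<close> with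
  \<open>s = c\<^sub>1 b\<^sub>1 + c\<^sub>2 b\<^sub>2\<close>, the competitor alternates between \<open>2 c\<^sub>1 b\<^sub>1\<close> and \<open>2 c\<^sub>2 b\<^sub>2\<close> in thin layers
  perpendicular to \<open>m\<close>. The planar curl only sees derivatives along the planes perpendicular to \<open>m\<close>,
  and each of these planes lies in a single layer, so that the jumps between layers cost nothing and,
  since Burgers vectors have length one, a plane in a layer of the first kind contributes twice the
  total variation of \<open>c\<^sub>1\<close>. Exchanging the two kinds of layers gives a second laminate, and the costs of
  both add up to at most twice the relaxed cost; hence one of them is as cheap as required
  (\<open>laminate_cost\<close>). In the elastic energy the oscillation of the laminate is compensated by a
  displacement \<open>H (x \<bullet> m) (c\<^sub>1 b\<^sub>1 - c\<^sub>2 b\<^sub>2)\<close>, where \<open>H\<close> is a triangle wave of small amplitude with slopes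
  \<open>\<plusminus>1\<close>: its gradient equals the oscillating part of the laminate up to a term of the size of \<open>H\<close>.

  Two difficulties come from the boundary of \<open>\<Omega>\<close>, since \<open>\<beta>\<close> is smooth only in the interior and may be
  unbounded. The displacement has to vanish at the boundary, which a smooth cutoff achieves, and
  the laminate has to be bounded, for which the coefficients are replaced by \<open>sin (e c\<^sub>i) / e\<close>; this
  truncation does not increase the total variation (\<open>tv_sin_truncation\<close>). Both errors are small
  in \<open>L2\<close> because \<open>\<beta>\<close> is square integrable once its elastic energy is finite: for \<open>s\<close> orthogonal
  to \<open>m\<close> the symmetric part of \<open>s \<otimes> m\<close> controls \<open>s\<close> (\<open>norm_sym_tensor\<close>). The weak gradient of the
  modified displacement is computed with the uniqueness of weak gradients
  (\<open>weak_gradient_unique\<close>), which rests on smooth cutoffs of arbitrary open sets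
  (\<open>smooth_cutoffs\<close>).

  All this yields pairs whose energy exceeds the relaxed energy by at most a given \<open>\<epsilon> > 0\<close>
  (\<open>laminate_approximation\<close>). If the energy is too small, it can be raised to the prescribed value:
  along a line \<open>u + t \<phi>\<close> it is a quadratic polynomial in \<open>t\<close> plus a constant
  (\<open>energy_attains_larger_values\<close>). The same device settles the case of infinite relaxed energy, in which
  the energies have to diverge.

  For the convexity, the elastic energy is a convex function of \<open>s\<close>, and the other terms are seminorms
  of the coordinates \<open>c\<^sub>1, c\<^sub>2\<close>, which depend linearly on \<open>s\<close>. The subtle point is the subadditivity of
  the integral over the slices. The integral of a nonmeasurable function is a lower integral
  and need not be additive, so that the total variation has to be shown to depend measurably on the slice
  (\<open>slice_tv_ae_borel\<close>); this follows by reducing the supremum over all test fields, whose domains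
  vary with the slice, to a countable family (\<open>countable_test_fields\<close>).
\<close>

section \<open>Calculus of smooth functions\<close>

lemma Ck_on_cong:
  assumes "open U" "\<And>x. x \<in> U \<Longrightarrow> f x = g x" "Ck_on k U f"
  shows "Ck_on k U g"
  using assms
proof (induction k arbitrary: f g)
  case 0
  then show ?case
    using continuous_on_cong[of U U f g] by simp
next
  case (Suc k)
  have d: "(g has_derivative frechet_derivative f (at x)) (at x)" if "x \<in> U" for x
    using Suc.prems that
    by (auto intro!: has_derivative_transform_within_open[of f _ x UNIV U g]
        simp: frechet_derivative_works)
  have e: "frechet_derivative f (at x) = frechet_derivative g (at x)" if "x \<in> U" for x
    using frechet_derivative_at[OF d[OF that]] by simp
  have "Ck_on k U (\<lambda>x. frechet_derivative g (at x) v)" for v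
    by (rule Suc.IH[of "\<lambda>x. frechet_derivative f (at x) v"])
       (use Suc.prems in \<open>auto simp: e\<close>)
  then show ?case
    using d by (auto simp: differentiable_def)
qed

lemma Ck_on_SucI:
  assumes "open U" "\<And>x. x \<in> U \<Longrightarrow> (f has_derivative f' x) (at x)"
    "\<And>v. Ck_on k U (\<lambda>x. f' x v)"
  shows "Ck_on (Suc k) U f"
proof -
  have "Ck_on k U (\<lambda>x. frechet_derivative f (at x) v)" for v
    by (rule Ck_on_cong[of U "\<lambda>x. f' x v"])
       (use assms frechet_derivative_at[OF assms(2)] in auto)
  then show ?thesis
    using assms(2) by (auto simp: differentiable_def)
qed

lemma Ck_on_has_derivative:
  assumes "Ck_on (Suc k) U f" "x \<in> U"
  shows "(f has_derivative frechet_derivative f (at x)) (at x)"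
  using assms by (auto simp: frechet_derivative_works[symmetric])

lemma Ck_on_deriv: "Ck_on (Suc k) U f \<Longrightarrow> Ck_on k U (\<lambda>x. frechet_derivative f (at x) v)"
  by simp

lemma Ck_on_SucD:
  assumes "Ck_on (Suc k) U f" shows "Ck_on k U f"
  using assms
proof (induction k arbitrary: f)
  case 0
  then show ?case
    by (auto intro!: continuous_at_imp_continuous_on differentiable_imp_continuous_within)
next
  case (Suc k)
  have "Ck_on k U (\<lambda>x. frechet_derivative f (at x) v)" for v
    by (rule Suc.IH) (use Suc.prems in simp)
  moreover have "\<forall>x\<in>U. f differentiable at x"
    using Suc.prems unfolding Ck_on.simps(2)[of "Suc k"] by blast
  ultimately show ?case by simp
qed

lemma Ck_on_mono: "Ck_on m U f \<Longrightarrow> k \<le> m \<Longrightarrow> Ck_on k U f"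
  by (induction m) (auto simp: le_Suc_eq simp del: Ck_on.simps dest: Ck_on_SucD)

lemma Ck_on_continuous: "Ck_on k U f \<Longrightarrow> continuous_on U f"
  using Ck_on_mono[of k U f 0] by simp

lemma Ck_on_subset: "Ck_on k U f \<Longrightarrow> V \<subseteq> U \<Longrightarrow> Ck_on k V f"
  by (induction k arbitrary: f) (auto intro: continuous_on_subset)

lemma Ck_on_Un: "open U \<Longrightarrow> open V \<Longrightarrow> Ck_on k U f \<Longrightarrow> Ck_on k V f \<Longrightarrow> Ck_on k (U \<union> V) f"
  by (induction k arbitrary: f) (auto intro: continuous_on_open_Un)

lemma Ck_on_const: "Ck_on k U (\<lambda>x. c)"
  by (induction k arbitrary: c) auto

lemma Ck_on_linear:
  assumes "open U" "bounded_linear f" shows "Ck_on k U f"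
proof (cases k)
  case 0
  then show ?thesis using assms by (simp add: linear_continuous_on)
next
  case (Suc m)
  show ?thesis unfolding Suc
    by (rule Ck_on_SucI[where f' = "\<lambda>x. f"])
       (use assms in \<open>auto intro: bounded_linear_imp_has_derivative Ck_on_const\<close>)
qed

lemma Ck_on_add:
  assumes "open U" "Ck_on k U f" "Ck_on k U g"
  shows "Ck_on k U (\<lambda>x. f x + g x)"
  using assms(2,3)
proof (induction k arbitrary: f g)
  case 0
  then show ?case by (auto intro: continuous_intros)
next
  case (Suc k)
  show ?case
    by (rule Ck_on_SucI[OF assms(1)
          has_derivative_add[OF Ck_on_has_derivative[OF Suc.prems(1)] Ck_on_has_derivative[OF Suc.prems(2)]]])
       (use Suc.prems in \<open>auto intro!: Suc.IH\<close>)
qed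

lemma Ck_on_sum:
  assumes "open U" "\<And>i. i \<in> I \<Longrightarrow> Ck_on k U (f i)"
  shows "Ck_on k U (\<lambda>x. \<Sum>i\<in>I. f i x)"
  using assms(2)
  by (induction I rule: infinite_finite_induct) (auto intro!: Ck_on_const Ck_on_add[OF assms(1)])

lemma Ck_on_bilinear:
  assumes "open U" "bounded_bilinear B" "Ck_on k U f" "Ck_on k U g"
  shows "Ck_on k U (\<lambda>x. B (f x) (g x))"
  using assms(3,4)
proof (induction k arbitrary: f g)
  case 0
  then show ?case using bounded_bilinear.continuous_on[OF assms(2)] by auto
next
  case (Suc k)
  show ?case
    by (rule Ck_on_SucI[OF assms(1) bounded_bilinear.FDERIV[OF assms(2)
          Ck_on_has_derivative[OF Suc.prems(1)] Ck_on_has_derivative[OF Suc.prems(2)]]])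
       (assumption | intro Ck_on_add[OF assms(1)] Suc.IH Ck_on_deriv Suc.prems
          Ck_on_SucD[OF Suc.prems(1)] Ck_on_SucD[OF Suc.prems(2)])+
qed

lemmas Ck_on_mult = Ck_on_bilinear[OF _ bounded_bilinear_mult]
lemmas Ck_on_scaleR = Ck_on_bilinear[OF _ bounded_bilinear_scaleR]
lemmas Ck_on_inner = Ck_on_bilinear[OF _ bounded_bilinear_inner]

lemma Ck_on_linear_compose:
  assumes "open U" "bounded_linear L" "Ck_on k U f"
  shows "Ck_on k U (\<lambda>x. L (f x))"
  using assms(3)
proof (induction k arbitrary: f)
  case 0
  then show ?case using bounded_linear.continuous_on[OF assms(2)] by auto
next
  case (Suc k)
  show ?case
    by (rule Ck_on_SucI[OF assms(1)
          bounded_linear.has_derivative[OF assms(2) Ck_on_has_derivative[OF Suc.prems]]])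
       (use Suc.prems in \<open>auto intro!: Suc.IH\<close>)
qed

lemma Ck_on_affine_compose:
  fixes L :: "'a::euclidean_space \<Rightarrow> 'c::euclidean_space"
  assumes "open U" "bounded_linear L" "Ck_on k U f"
  shows "Ck_on k {w. a + L w \<in> U} (\<lambda>w. f (a + L w))"
  using assms(3)
proof (induction k arbitrary: f)
  case 0
  then have "continuous_on {w. a + L w \<in> U} (f \<circ> (\<lambda>w. a + L w))"
    by (intro continuous_on_compose continuous_on_add continuous_on_const
        linear_continuous_on[OF assms(2)]) (auto intro: continuous_on_subset)
  then show ?case by (simp add: o_def)
next
  case (Suc k)
  have op: "open {w. a + L w \<in> U}"
    using open_vimage[OF assms(1), of "\<lambda>w. a + L w"]
      continuous_on_add[OF continuous_on_const linear_continuous_on[OF assms(2)]]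
    by (simp add: vimage_def)
  show ?case
  proof (rule Ck_on_SucI[OF op, where f' = "\<lambda>w v. frechet_derivative f (at (a + L w)) (L v)"])
    show "((\<lambda>w. f (a + L w)) has_derivative (\<lambda>v. frechet_derivative f (at (a + L w)) (L v))) (at w)"
      if "w \<in> {w. a + L w \<in> U}" for w
    proof (rule has_derivative_compose[of "\<lambda>w. a + L w" L w UNIV f])
      show "((\<lambda>w. a + L w) has_derivative L) (at w)"
        using has_derivative_add[OF has_derivative_const bounded_linear_imp_has_derivative[OF assms(2)], of a]
        by simp
      show "(f has_derivative frechet_derivative f (at (a + L w))) (at (a + L w))"
        using that Ck_on_has_derivative[OF Suc.prems] by simp
    qed
  qed (use Suc.prems in \<open>auto intro!: Suc.IH\<close>)
qed

lemma Ck_on_real_SucI: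
  fixes f :: "real \<Rightarrow> real"
  assumes "open U" "\<And>x. x \<in> U \<Longrightarrow> (f has_real_derivative f' x) (at x)" "Ck_on k U f'"
  shows "Ck_on (Suc k) U f"
  by (rule Ck_on_SucI[where f' = "\<lambda>x h. f' x * h"])
     (use assms in \<open>auto simp: has_field_derivative_def intro!: Ck_on_mult Ck_on_const\<close>)

lemma Ck_on_real_compose:
  fixes F :: "real \<Rightarrow> real"
  assumes "open U" "open V" "Ck_on k V F" "Ck_on k U f" "\<And>x. x \<in> U \<Longrightarrow> f x \<in> V"
  shows "Ck_on k U (\<lambda>x. F (f x))"
  using assms(3,4)
proof (induction k arbitrary: F)
  case 0
  then have "continuous_on U (F \<circ> f)"
    using assms(5) by (intro continuous_on_compose) (auto intro: continuous_on_subset)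
  then show ?case by (simp add: o_def)
next
  case (Suc k)
  let ?F' = "\<lambda>y. frechet_derivative F (at y) 1"
  show ?case
  proof (rule Ck_on_SucI[OF assms(1), where f' = "\<lambda>x v. frechet_derivative f (at x) v * ?F' (f x)"])
    fix x assume x: "x \<in> U"
    have F: "(F has_derivative frechet_derivative F (at (f x))) (at (f x))"
      using Ck_on_has_derivative[OF Suc.prems(1)] assms(5)[OF x] by blast
    have lin: "frechet_derivative F (at (f x)) = (\<lambda>h. h * ?F' (f x))"
    proof
      fix h :: real
      have "frechet_derivative F (at (f x)) (h *\<^sub>R 1) = h *\<^sub>R ?F' (f x)"
        by (rule linear_scale[OF has_derivative_linear[OF F]])
      then show "frechet_derivative F (at (f x)) h = h * ?F' (f x)"
        by (simp only: real_scaleR_def mult_1_right)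
    qed
    show "((\<lambda>x. F (f x)) has_derivative (\<lambda>v. frechet_derivative f (at x) v * ?F' (f x))) (at x)"
      by (rule has_derivative_eq_rhs[OF has_derivative_compose[OF Ck_on_has_derivative[OF Suc.prems(2) x] F]])
         (rule ext, rule fun_cong[OF lin])
  next
    fix v
    have "Ck_on k U (\<lambda>x. ?F' (f x))"
      by (rule Suc.IH[OF Ck_on_deriv[OF Suc.prems(1)] Ck_on_SucD[OF Suc.prems(2)]])
    then show "Ck_on k U (\<lambda>x. frechet_derivative f (at x) v * ?F' (f x))"
      by (intro Ck_on_mult assms(1)) (use Suc.prems in auto)
  qed
qed

lemma Ck_on_sin_cos:
  fixes U :: "real set" assumes "open U"
  shows "Ck_on k U sin \<and> Ck_on k U cos"
proof (induction k)
  case 0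
  then show ?case by (auto intro: continuous_intros)
next
  case (Suc k)
  have "Ck_on k U (\<lambda>x. (-1) * sin x)"
    by (intro Ck_on_mult assms Ck_on_const) (use Suc in simp)
  then have "Ck_on k U (\<lambda>x::real. - sin x)" by simp
  then have "Ck_on (Suc k) U cos"
    by (intro Ck_on_real_SucI[OF assms, where f' = "\<lambda>x. - sin x"]) (auto intro!: derivative_eq_intros)
  moreover have "Ck_on (Suc k) U sin"
    using Suc by (intro Ck_on_real_SucI[OF assms, where f' = cos]) (auto intro!: derivative_eq_intros)
  ultimately show ?case by blast
qed

lemma Ck_on_powr: "Ck_on k {0<..} (\<lambda>x::real. x powr a)"
proof (induction k arbitrary: a)
  case 0
  then show ?case by (auto intro!: continuous_intros)
next
  case (Suc k)
  show ?case
    by (rule Ck_on_real_SucI[where f' = "\<lambda>x. a * x powr (a - 1)"])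
       (auto intro!: Suc.IH Ck_on_mult Ck_on_const has_real_derivative_powr)
qed

lemma Ck_on_arcsin: "Ck_on k {-1<..<1} arcsin"
proof (cases k)
  case 0
  then show ?thesis by (auto intro!: continuous_intros)
next
  case (Suc m)
  have pos: "1 - x * x > 0" if "x \<in> {-1<..<1}" for x :: real
    using that abs_square_less_1[of x] by (auto simp: power2_eq_square)
  have p: "Ck_on m {-1<..<1} (\<lambda>x::real. 1 + (-1) * (x * x))"
    by (intro Ck_on_add Ck_on_mult Ck_on_const Ck_on_linear bounded_linear_ident) auto
  have "Ck_on m {-1<..<1} (\<lambda>x::real. (1 + (-1) * (x * x)) powr (-1/2))"
    by (rule Ck_on_real_compose[OF _ _ Ck_on_powr p]) (use pos in auto)
  moreover have "((\<lambda>x. arcsin x) has_real_derivative (1 + (-1) * (x * x)) powr (-1/2)) (at x)"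
    if "x \<in> {-1<..<1}" for x :: real
  proof -
    have "(1 + (-1) * (x * x)) powr (-1/2) = inverse (sqrt (1 - x\<^sup>2))"
      using pos[OF that] by (simp add: powr_minus powr_half_sqrt power2_eq_square)
    then show ?thesis using that DERIV_arcsin[of x] by simp
  qed
  ultimately show ?thesis unfolding Suc
    by (intro Ck_on_real_SucI) auto
qed

text \<open>The derivative of a member of this family is a combination of two other members, so that one
  induction proves that all of them are smooth.\<close>

definition flat_exp :: "nat \<Rightarrow> real \<Rightarrow> real" where
  "flat_exp m t = (if t \<le> 0 then 0 else exp (- 1 / t) / t ^ m)"

text \<open>The exponential series bounds \<open>exp y\<close> below by \<open>y\<^sup>m\<^sup>+\<^sup>2 / (m + 2)!\<close> at \<open>y = 1/t\<close>. The quadratic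
  decay makes the derivative at \<open>0\<close> vanish.\<close>

lemma flat_exp_quadratic: "\<bar>flat_exp m t\<bar> \<le> fact (m + 2) * t\<^sup>2"
proof (cases "t > 0")
  case True
  define y where "y = 1 / t"
  have y: "y > 0" using True by (simp add: y_def)
  have "y ^ (m + 2) / fact (m + 2) \<le> exp y"
  proof -
    have "(\<Sum>n\<in>{m+2}. y ^ n /\<^sub>R fact n) \<le> (\<Sum>n. y ^ n /\<^sub>R fact n)"
      by (rule sum_le_suminf) (use y summable_exp_generic[of y] in auto)
    then show ?thesis by (simp add: exp_def field_simps)
  qed
  then have "y ^ (m + 2) \<le> exp y * fact (m + 2)"
    by (simp only: pos_divide_le_eq fact_gt_zero)
  then have "exp (- y) * y ^ (m + 2) \<le> exp (- y) * (exp y * fact (m + 2))"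
    by (intro mult_left_mono) auto
  also have "\<dots> = fact (m + 2)"
    by (simp only: mult.assoc[symmetric] exp_minus_inverse[of y] mult.commute[of "exp (-y)"] mult_1_left)
  finally have "(exp (- y) * y ^ m) * y\<^sup>2 \<le> fact (m + 2)"
    by (simp only: power_add mult.assoc)
  then have "(exp (- y) * y ^ m) * y\<^sup>2 * t\<^sup>2 \<le> fact (m + 2) * t\<^sup>2"
    by (intro mult_right_mono) auto
  moreover have "y\<^sup>2 * t\<^sup>2 = 1" using True by (simp add: y_def power_divide)
  moreover have "flat_exp m t = exp (- y) * y ^ m"
    using True by (simp add: flat_exp_def y_def power_divide)
  moreover have "flat_exp m t \<ge> 0" by (simp add: flat_exp_def)
  ultimately show ?thesis by (simp only: mult.assoc abs_of_nonneg mult_1_right)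
qed (simp add: flat_exp_def)

lemma flat_exp_deriv:
  "(flat_exp m has_real_derivative (- real m * flat_exp (Suc m) t + flat_exp (m + 2) t)) (at t)"
proof -
  consider "t < 0" | "t > 0" | "t = 0" by linarith
  then show ?thesis
  proof cases
    case 1
    have "(flat_exp m has_real_derivative 0) (at t)"
      by (rule has_field_derivative_transform_within_open[of "\<lambda>_. 0" _ _ "{..<0}"])
         (use 1 in \<open>auto simp: flat_exp_def\<close>)
    then show ?thesis using 1 by (simp add: flat_exp_def)
  next
    case 2
    have "((\<lambda>t. exp (- inverse t) * inverse t ^ m) has_real_derivative
        exp (- inverse t) * inverse t ^ 2 * inverse t ^ m
        - real m * inverse t ^ (m - Suc 0) * inverse t * inverse t * exp (- inverse t)) (at t)"
      using 2 by (auto intro!: derivative_eq_intros simp: power2_eq_square algebra_simps)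
    moreover have "real m * inverse t ^ (m - Suc 0) * inverse t = real m * inverse t ^ m"
      by (cases m) auto
    ultimately have "((\<lambda>t. exp (- inverse t) * inverse t ^ m) has_real_derivative
        exp (- inverse t) * inverse t ^ 2 * inverse t ^ m
        - real m * inverse t ^ m * inverse t * exp (- inverse t)) (at t)"
      by (simp only:)
    moreover have "exp (- inverse t) * inverse t ^ 2 * inverse t ^ m
        - real m * inverse t ^ m * inverse t * exp (- inverse t)
        = - real m * flat_exp (Suc m) t + flat_exp (m + 2) t"
      using 2 by (simp add: flat_exp_def divide_inverse power_inverse power2_eq_square)
    ultimately have "((\<lambda>t. exp (- inverse t) * inverse t ^ m) has_real_derivative
        (- real m * flat_exp (Suc m) t + flat_exp (m + 2) t)) (at t)"
      by (simp only:)
    then show ?thesis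
      by (rule has_field_derivative_transform_within_open[of _ _ _ "{0<..}"])
         (use 2 in \<open>auto simp: flat_exp_def divide_inverse power_inverse\<close>)
  next
    case 3
    obtain C :: real where C: "\<And>h. \<bar>flat_exp m h\<bar> \<le> C * h\<^sup>2"
      using flat_exp_quadratic by blast
    have "((\<lambda>h. flat_exp m h / h) \<longlongrightarrow> 0) (at 0)"
    proof (rule Lim_null_comparison)
      show "\<forall>\<^sub>F h in at 0. norm (flat_exp m h / h) \<le> C * \<bar>h\<bar>"
        unfolding eventually_at_filter
      proof (intro always_eventually allI impI)
        fix h :: real assume h: "h \<noteq> 0"
        have "\<bar>flat_exp m h\<bar> / \<bar>h\<bar> \<le> C * h\<^sup>2 / \<bar>h\<bar>"
          by (intro divide_right_mono C) auto
        also have "\<dots> = C * \<bar>h\<bar>" using h by (simp add: power2_eq_square field_simps flip: abs_mult)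
        finally show "norm (flat_exp m h / h) \<le> C * \<bar>h\<bar>" by simp
      qed
      show "((\<lambda>h. C * \<bar>h\<bar>) \<longlongrightarrow> 0) (at 0)"
        by (auto intro!: tendsto_eq_intros)
    qed
    then show ?thesis
      using 3 by (simp add: DERIV_def flat_exp_def)
  qed
qed

lemma Ck_on_flat_exp:
  assumes "open U" shows "Ck_on k U (flat_exp m)"
proof (induction k arbitrary: m)
  case 0
  show ?case
    using DERIV_isCont[OF flat_exp_deriv] by (auto intro: continuous_at_imp_continuous_on)
next
  case (Suc k)
  show ?case
    by (rule Ck_on_real_SucI[OF assms flat_exp_deriv])
       (intro Ck_on_add Ck_on_mult Ck_on_const Suc.IH assms)
qed

lemma flat_exp_0_bounds: "0 \<le> flat_exp 0 t" "flat_exp 0 t \<le> 1" "flat_exp 0 t > 0 \<longleftrightarrow> t > 0"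
  by (auto simp: flat_exp_def)

lemma Ck_on_flat_exp_bump:
  fixes p :: "'a::euclidean_space"
  shows "Ck_on k UNIV (\<lambda>x. flat_exp m (r + (-1) * ((x - p) \<bullet> (x - p))))"
proof (rule Ck_on_real_compose[OF open_UNIV open_UNIV Ck_on_flat_exp[OF open_UNIV]])
  have "Ck_on k UNIV (\<lambda>x. x + (- p))"
    by (intro Ck_on_add Ck_on_linear bounded_linear_ident Ck_on_const open_UNIV)
  then have "Ck_on k UNIV (\<lambda>x. x - p)" by simp
  then show "Ck_on k UNIV (\<lambda>x. r + (-1) * ((x - p) \<bullet> (x - p)))"
    by (intro Ck_on_add Ck_on_mult Ck_on_const Ck_on_inner open_UNIV)
qed auto

lemma supp_subset:
  assumes "closed K" "\<And>x. f x \<noteq> 0 \<Longrightarrow> x \<in> K"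
  shows "supp f \<subseteq> K"
  unfolding supp_def by (rule closure_minimal) (use assms in auto)

lemma supp_zero: "x \<notin> supp f \<Longrightarrow> f x = 0"
  using closure_subset[of "{x. f x \<noteq> 0}"] by (auto simp: supp_def)

lemma closed_supp [simp]: "closed (supp f)"
  by (simp add: supp_def)

lemma compact_supp_subset:
  fixes f :: "'a::t2_space \<Rightarrow> 'b::zero"
  assumes "compact K" "\<And>x. f x \<noteq> 0 \<Longrightarrow> x \<in> K"
  shows "compact (supp f)" "supp f \<subseteq> K"
proof -
  show s: "supp f \<subseteq> K" by (rule supp_subset[OF compact_imp_closed[OF assms(1)] assms(2)])
  show "compact (supp f)" using compact_Int_closed[OF assms(1) closed_supp[of f]] s
    by (simp add: Int_absorb1)
qed

section \<open>Smooth cutoff functions\<close>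

text \<open>An open set is a countable union of balls whose closures it contains. With a smooth bump
  \<open>\<eta>\<^sub>k\<close> on each ball, the cutoffs \<open>g (n (\<eta>\<^sub>0 + \<dots> + \<eta>\<^sub>n\<^sub>-\<^sub>1))\<close> work, because \<open>g = flat_exp 0\<close> vanishes
  at \<open>0\<close> and tends to \<open>1\<close> at infinity.\<close>

lemma smooth_cutoffs:
  fixes V :: "'a::euclidean_space set"
  assumes "open V"
  obtains \<psi> :: "nat \<Rightarrow> 'a \<Rightarrow> real" where
    "\<And>n. \<psi> n \<in> Cinfc V" "\<And>n x. 0 \<le> \<psi> n x" "\<And>n x. \<psi> n x \<le> 1"
    "\<And>x. (\<lambda>n. \<psi> n x) \<longlonglongrightarrow> indicator V x"
proof (cases "V = {}")
  case True
  then show thesis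
    by (intro that[of "\<lambda>n x. 0"]) (auto simp: Cinfc_def smooth_on_def Ck_on_const supp_def)
next
  case False
  define \<B> where "\<B> = {cball p r |p r. r > 0 \<and> cball p r \<subseteq> V}"
  define \<O> where "\<O> = interior ` \<B>"
  have cover: "\<Union>\<O> = V"
  proof
    show "\<Union>\<O> \<subseteq> V" using interior_subset by (fastforce simp: \<O>_def \<B>_def)
    show "V \<subseteq> \<Union>\<O>"
    proof
      fix x assume "x \<in> V"
      then obtain r where "r > 0" "cball x r \<subseteq> V" using assms open_contains_cball by blast
      then have "cball x r \<in> \<B>" "x \<in> interior (cball x r)" by (auto simp: \<B>_def)
      then show "x \<in> \<Union>\<O>" unfolding \<O>_def by blast
    qed
  qed
  obtain \<O>' where O': "\<O>' \<subseteq> \<O>" "countable \<O>'" "\<Union>\<O>' = \<Union>\<O>"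
    by (rule Lindelof[of \<O>]) (auto simp: \<O>_def)
  have "\<O>' \<noteq> {}" using O' cover False by auto
  define B where "B = from_nat_into \<O>'"
  have B_in: "B k \<in> \<O>" for k using from_nat_into[OF \<open>\<O>' \<noteq> {}\<close>] O'(1) by (auto simp: B_def)
  have "\<exists>p r. r > 0 \<and> cball p r \<subseteq> V \<and> B k = ball p r" for k
    using B_in[of k] by (auto simp: \<O>_def \<B>_def) blast
  then obtain p r where pr: "\<And>k. r k > 0" "\<And>k. cball (p k) (r k) \<subseteq> V" "\<And>k. B k = ball (p k) (r k)"
    by metis
  have V: "V = (\<Union>k. B k)"
    using O' cover from_nat_into_surj[OF O'(2)] B_def \<open>\<O>' \<noteq> {}\<close>
    by (metis range_from_nat_into)
  define \<eta> where "\<eta> k x = flat_exp 0 ((r k)\<^sup>2 + (-1) * ((x - p k) \<bullet> (x - p k)))" for k x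
  have \<eta>0: "\<eta> k x \<ge> 0" for k x by (simp add: \<eta>_def flat_exp_0_bounds)
  have \<eta>pos: "\<eta> k x > 0 \<longleftrightarrow> x \<in> B k" for k x
  proof -
    have "\<eta> k x > 0 \<longleftrightarrow> (norm (x - p k))\<^sup>2 < (r k)\<^sup>2"
      by (simp add: \<eta>_def flat_exp_0_bounds power2_norm_eq_inner)
    also have "\<dots> \<longleftrightarrow> norm (x - p k) < r k"
      using pr(1)[of k] by (auto intro: power2_less_imp_less power_strict_mono)
    finally show ?thesis by (simp add: pr(3) dist_norm norm_minus_commute)
  qed
  have \<eta>smooth: "Ck_on m UNIV (\<eta> k)" for m k
    unfolding \<eta>_def by (rule Ck_on_flat_exp_bump)
  define \<psi> where "\<psi> n x = flat_exp 0 (real n * (\<Sum>k<n. \<eta> k x))" for n x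
  have smooth: "Ck_on m UNIV (\<psi> n)" for m n
    unfolding \<psi>_def
    by (rule Ck_on_real_compose[OF _ open_UNIV Ck_on_flat_exp])
       (auto intro!: Ck_on_mult Ck_on_const Ck_on_sum \<eta>smooth)
  have K: "compact (\<Union>k<n. cball (p k) (r k))" for n by auto
  have nz: "x \<in> (\<Union>k<n. cball (p k) (r k))" if "\<psi> n x \<noteq> 0" for n x
  proof -
    have "real n * (\<Sum>k<n. \<eta> k x) > 0"
      using that by (simp add: \<psi>_def flat_exp_def split: if_splits)
    then have "(\<Sum>k<n. \<eta> k x) \<noteq> 0" by auto
    then obtain k where "k < n" "\<eta> k x \<noteq> 0" by (meson lessThan_iff sum.neutral)
    then have "x \<in> B k" using \<eta>pos[of k x] \<eta>0[of k x] by force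
    then show ?thesis using \<open>k < n\<close> pr(3) by (auto intro!: bexI[of _ k])
  qed
  have lim: "(\<lambda>n. \<psi> n x) \<longlonglongrightarrow> indicator V x" for x
  proof (cases "x \<in> V")
    case True
    then obtain k where k: "\<eta> k x > 0" using V \<eta>pos by blast
    have "filterlim (\<lambda>n. real n * (\<Sum>k<n. \<eta> k x)) at_top sequentially"
    proof (rule filterlim_at_top_mono)
      show "filterlim (\<lambda>n. real n * \<eta> k x) at_top sequentially"
        using k filterlim_real_sequentially
        by (rule filterlim_tendsto_pos_mult_at_top[OF tendsto_const, THEN filterlim_cong[THEN iffD1, rotated -1]])
           (auto simp: mult.commute)
      show "\<forall>\<^sub>F n in sequentially. real n * \<eta> k x \<le> real n * (\<Sum>k<n. \<eta> k x)"
        using eventually_gt_at_top[of k]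
        by eventually_elim (auto intro!: mult_left_mono member_le_sum \<eta>0)
    qed
    then have "(\<lambda>n. exp (- 1 / (real n * (\<Sum>k<n. \<eta> k x)))) \<longlonglongrightarrow> exp 0"
      by (intro tendsto_exp tendsto_divide_0[OF tendsto_const] filterlim_at_top_imp_at_infinity)
    moreover have "\<forall>\<^sub>F n in sequentially. exp (- 1 / (real n * (\<Sum>k<n. \<eta> k x))) = \<psi> n x"
      using eventually_gt_at_top[of k]
    proof eventually_elim
      case (elim n)
      have "0 < \<eta> k x" by (rule k)
      also have "\<dots> \<le> (\<Sum>k<n. \<eta> k x)" using elim by (intro member_le_sum \<eta>0) auto
      finally show ?case using elim by (simp add: \<psi>_def flat_exp_def mult_le_0_iff)
    qed
    ultimately show ?thesis using True by (simp add: tendsto_cong)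
  next
    case False
    then have "\<psi> n x = 0" for n using nz[of n x] pr(2) by blast
    then show ?thesis using False by simp
  qed
  show thesis
  proof (rule that[of \<psi>])
    show "\<psi> n \<in> Cinfc V" for n
      using compact_supp_subset[OF K[of n], of "\<psi> n"] nz[of n] pr(2) smooth
      unfolding Cinfc_def smooth_on_def by blast
  qed (auto simp: \<psi>_def flat_exp_0_bounds lim[unfolded \<psi>_def])
qed

section \<open>Integration by parts\<close>

lemma continuous_supp_integrable:
  fixes f :: "'a::euclidean_space \<Rightarrow> 'b::euclidean_space"
  assumes "continuous_on UNIV f" "compact (supp f)"
  shows "integrable lborel f"
proof -
  have "integrable lborel (\<lambda>x. indicator (supp f) x *\<^sub>R f x)"
    by (rule borel_integrable_compact[OF assms(2) continuous_on_subset[OF assms(1)]]) simp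
  moreover have "(\<lambda>x. indicator (supp f) x *\<^sub>R f x) = f"
    using supp_zero[of _ f] by (auto simp: fun_eq_iff indicator_def)
  ultimately show ?thesis by simp
qed

lemma continuous_supp_bounded:
  fixes f :: "'a::euclidean_space \<Rightarrow> 'b::euclidean_space"
  assumes "continuous_on UNIV f" "compact (supp f)"
  obtains C where "C \<ge> 0" "\<And>x. norm (f x) \<le> C"
proof -
  have "compact (f ` supp f)"
    by (rule compact_continuous_image[OF continuous_on_subset[OF assms(1)] assms(2)]) simp
  then obtain C where C: "\<And>y. y \<in> f ` supp f \<Longrightarrow> norm y \<le> C"
    using compact_imp_bounded bounded_iff by metis
  have "norm (f x) \<le> max C 0" for x
    using C[of "f x"] supp_zero[of x f] by (cases "x \<in> supp f") auto
  then show thesis by (intro that[of "max C 0"]) auto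
qed

lemma deriv_zero_off_supp:
  assumes "x \<notin> supp f" shows "frechet_derivative f (at x) v = 0"
proof -
  have "((\<lambda>_. 0) has_derivative (\<lambda>_. 0)) (at x)" by simp
  then have "(f has_derivative (\<lambda>_. 0)) (at x)"
    by (rule has_derivative_transform_within_open[of _ _ _ UNIV "- supp f"])
       (use assms supp_zero[of _ f] in auto)
  then show ?thesis by (simp add: frechet_derivative_at[symmetric])
qed

lemma supp_deriv_subset: "supp (\<lambda>x. frechet_derivative f (at x) v) \<subseteq> supp f"
  by (rule supp_subset) (use deriv_zero_off_supp[of _ f v] in auto)

lemma compact_supp_mono:
  fixes f :: "'a::t2_space \<Rightarrow> 'b::zero"
  assumes "compact (supp f)" "supp g \<subseteq> supp f" shows "compact (supp g)"
  using compact_Int_closed[OF assms(1) closed_supp[of g]] assms(2) by (simp add: Int_absorb1)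

text \<open>The difference quotients of \<open>f\<close> in direction \<open>v\<close> have integral zero because Lebesgue
  measure is translation invariant, and they converge boundedly to the derivative.\<close>

lemma integral_deriv_zero:
  fixes f :: "'a::euclidean_space \<Rightarrow> real"
  assumes f: "Ck_on 1 UNIV f" and supp: "compact (supp f)"
  shows "(LINT x|lborel. frechet_derivative f (at x) v) = 0"
proof -
  define D where "D x = frechet_derivative f (at x) v" for x
  define h where "h n = 1 / real (Suc n)" for n
  define q where "q n x = (f (x + h n *\<^sub>R v) - f x) / h n" for n x
  have h: "0 < h n" "h n \<le> 1" for n by (auto simp: h_def)
  have cont: "continuous_on UNIV f" using Ck_on_continuous[OF f] .
  have D_cont: "continuous_on UNIV D" using f unfolding D_def One_nat_def by simp
  have D_supp: "compact (supp D)"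
    using compact_supp_mono[OF supp supp_deriv_subset] by (simp add: D_def[abs_def])
  obtain C where C: "C \<ge> 0" "\<And>x. norm (D x) \<le> C"
    using continuous_supp_bounded[OF D_cont D_supp] by blast
  have dline: "((\<lambda>t. f (x + t *\<^sub>R v)) has_real_derivative D (x + t *\<^sub>R v)) (at t)" for x t
  proof -
    have F: "(f has_derivative frechet_derivative f (at (x + t *\<^sub>R v))) (at (x + t *\<^sub>R v))"
      using Ck_on_has_derivative[of 0 UNIV f] f by simp
    have "((\<lambda>t. x + t *\<^sub>R v) has_derivative (\<lambda>s. s *\<^sub>R v)) (at t)"
      by (auto intro!: derivative_eq_intros)
    from has_derivative_compose[OF this F]
    have "((\<lambda>t. f (x + t *\<^sub>R v)) has_derivative
        (\<lambda>s. frechet_derivative f (at (x + t *\<^sub>R v)) (s *\<^sub>R v))) (at t)" .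
    moreover have "frechet_derivative f (at (x + t *\<^sub>R v)) (s *\<^sub>R v) = D (x + t *\<^sub>R v) * s" for s
      using linear_scale[OF has_derivative_linear[OF F], of s v] by (simp add: D_def)
    ultimately show ?thesis by (simp add: has_field_derivative_def)
  qed
  have lim: "(\<lambda>n. q n x) \<longlonglongrightarrow> D x" for x
  proof -
    have "((\<lambda>s. (f (x + (0 + s) *\<^sub>R v) - f (x + 0 *\<^sub>R v)) / s) \<longlongrightarrow> D (x + 0 *\<^sub>R v)) (at 0)"
      using dline[of x 0] unfolding DERIV_def .
    moreover have "filterlim h (at 0) sequentially"
      unfolding filterlim_at h_def[abs_def]
      using LIMSEQ_inverse_real_of_nat by (auto simp: inverse_eq_divide)
    ultimately show ?thesis
      unfolding q_def by (auto dest: filterlim_compose)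
  qed
  have bound: "norm (q n x) \<le> C" for n x
  proof -
    obtain z where "f (x + h n *\<^sub>R v) - f (x + 0 *\<^sub>R v) = (h n - 0) * D (x + z *\<^sub>R v)"
      using MVT2[of 0 "h n" "\<lambda>t. f (x + t *\<^sub>R v)" "\<lambda>t. D (x + t *\<^sub>R v)"] h dline by blast
    then have "q n x = D (x + z *\<^sub>R v)" using h[of n] by (simp add: q_def)
    then show ?thesis using C by simp
  qed
  obtain R where R: "\<And>x. x \<in> supp f \<Longrightarrow> norm x \<le> R"
    using compact_imp_bounded[OF supp] bounded_iff by metis
  have q0: "q n x = 0" if "x \<notin> cball 0 (R + norm v)" for n x
  proof -
    have far: "norm x > R + norm v" using that by (simp add: dist_norm)
    have hv: "norm (h n *\<^sub>R v) \<le> norm v" using h[of n] by (simp add: mult_left_le_one_le)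
    have "norm x \<le> norm (x + h n *\<^sub>R v) + norm (h n *\<^sub>R v)"
      using norm_triangle_ineq4[of "x + h n *\<^sub>R v" "h n *\<^sub>R v"] by simp
    then have "norm (x + h n *\<^sub>R v) > R" using far hv by linarith
    then have "x + h n *\<^sub>R v \<notin> supp f" using R[of "x + h n *\<^sub>R v"] by auto
    moreover have "x \<notin> supp f" using R[of x] far norm_ge_zero[of v] by auto
    ultimately show ?thesis by (simp add: q_def supp_zero)
  qed
  have f_int: "integrable lborel f" by (rule continuous_supp_integrable[OF cont supp])
  have shift: "integrable lborel (\<lambda>x. f (x + c))" "(LINT x|lborel. f (x + c)) = (LINT x|lborel. f x)" for c
  proof -
    have meas: "(\<lambda>x. c + x) \<in> lborel \<rightarrow>\<^sub>M borel" by measurable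
    have fm: "f \<in> borel_measurable borel" using cont by (rule borel_measurable_continuous_onI)
    show "integrable lborel (\<lambda>x. f (x + c))"
      using integrable_distr_eq[OF meas fm] f_int lborel_distr_plus[of c] by (simp add: add.commute[of _ c])
    show "(LINT x|lborel. f (x + c)) = (LINT x|lborel. f x)"
      using integral_distr[OF meas fm] lborel_distr_plus[of c] by (simp add: add.commute[of _ c])
  qed
  have q_int: "(LINT x|lborel. q n x) = 0" for n
    unfolding q_def using shift f_int by simp
  have "(\<lambda>n. LINT x|lborel. q n x) \<longlonglongrightarrow> (LINT x|lborel. D x)"
  proof (rule integral_dominated_convergence)
    show "integrable lborel (\<lambda>x. indicator (cball 0 (R + norm v)) x *\<^sub>R C :: real)"
      by (rule borel_integrable_compact) auto
    show "D \<in> borel_measurable lborel"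
      using borel_measurable_continuous_onI[OF D_cont] by simp
    show "q n \<in> borel_measurable lborel" for n
    proof -
      have "continuous_on UNIV (q n)"
        unfolding q_def using h(1)[of n]
        by (intro continuous_intros continuous_on_compose2[OF cont]) auto
      from borel_measurable_continuous_onI[OF this] show ?thesis by simp
    qed
    show "AE x in lborel. (\<lambda>n. q n x) \<longlonglongrightarrow> D x" using lim by simp
    show "AE x in lborel. norm (q n x) \<le> indicator (cball 0 (R + norm v)) x *\<^sub>R C" for n
      using bound q0 by (auto simp: indicator_def intro!: AE_I2)
  qed
  then show ?thesis using q_int LIMSEQ_unique[of "\<lambda>n. 0" "LINT x|lborel. D x" 0]
    by (simp add: D_def)
qed

lemma Ck_on_Cinfc: "\<phi> \<in> Cinfc \<Omega> \<Longrightarrow> Ck_on k UNIV \<phi>"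
  by (simp add: Cinfc_def smooth_on_def)

lemma Cinfc_supp: "\<phi> \<in> Cinfc \<Omega> \<Longrightarrow> compact (supp \<phi>)" "\<phi> \<in> Cinfc \<Omega> \<Longrightarrow> supp \<phi> \<subseteq> \<Omega>"
  by (simp_all add: Cinfc_def)

lemma Cinfc_mono: "\<phi> \<in> Cinfc U \<Longrightarrow> U \<subseteq> V \<Longrightarrow> \<phi> \<in> Cinfc V"
  by (auto simp: Cinfc_def)

lemma Cinfc_zero_off: "\<phi> \<in> Cinfc \<Omega> \<Longrightarrow> x \<notin> \<Omega> \<Longrightarrow> \<phi> x = 0"
  using Cinfc_supp(2) supp_zero by blast

lemma integral_by_parts:
  fixes f g :: "'a::euclidean_space \<Rightarrow> real"
  assumes "Ck_on 1 UNIV f" "Ck_on 1 UNIV g" "compact (supp f)"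
  shows "(LINT x|lborel. f x * frechet_derivative g (at x) v)
       = - (LINT x|lborel. frechet_derivative f (at x) v * g x)"
proof -
  have f': "(f has_derivative frechet_derivative f (at x)) (at x)"
    and g': "(g has_derivative frechet_derivative g (at x)) (at x)" for x
    using Ck_on_has_derivative[of 0 UNIV f] Ck_on_has_derivative[of 0 UNIV g] assms by auto
  have prod: "Ck_on 1 UNIV (\<lambda>x. f x * g x)" by (intro Ck_on_mult assms open_UNIV)
  have s: "supp (\<lambda>x. f x * g x) \<subseteq> supp f"
    by (rule supp_subset) (use supp_zero[of _ f] in auto)
  have zero: "(LINT x|lborel. frechet_derivative (\<lambda>x. f x * g x) (at x) v) = 0"
    by (rule integral_deriv_zero[OF prod compact_supp_mono[OF assms(3) s]])
  have pr: "frechet_derivative (\<lambda>x. f x * g x) (at x) v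
      = f x * frechet_derivative g (at x) v + frechet_derivative f (at x) v * g x" for x
    using frechet_derivative_at[OF has_derivative_mult[OF f'[of x] g'[of x]]] by metis
  have cg: "continuous_on UNIV g" and cf: "continuous_on UNIV f"
    by (auto intro: Ck_on_continuous[OF assms(1)] Ck_on_continuous[OF assms(2)])
  have cD: "continuous_on UNIV (\<lambda>x. frechet_derivative f (at x) v)"
    "continuous_on UNIV (\<lambda>x. frechet_derivative g (at x) v)"
    using assms by simp_all
  have i1: "integrable lborel (\<lambda>x. f x * frechet_derivative g (at x) v)"
    by (rule continuous_supp_integrable[OF continuous_on_mult[OF cf cD(2)]],
        rule compact_supp_mono[OF assms(3)], rule supp_subset) (use supp_zero[of _ f] in auto)
  have i2: "integrable lborel (\<lambda>x. frechet_derivative f (at x) v * g x)"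
    by (rule continuous_supp_integrable[OF continuous_on_mult[OF cD(1) cg]],
        rule compact_supp_mono[OF assms(3)], rule supp_subset)
       (use deriv_zero_off_supp[of _ f v] in auto)
  show ?thesis using zero i1 i2 by (simp add: pr)
qed

lemma lebesgue_on_integral_eq:
  fixes f :: "'a::euclidean_space \<Rightarrow> 'b::euclidean_space"
  assumes "open \<Omega>" "f \<in> borel_measurable borel" "\<And>x. x \<notin> \<Omega> \<Longrightarrow> f x = 0"
  shows "integral\<^sup>L (lebesgue_on \<Omega>) f = integral\<^sup>L lborel f"
    "integrable (lebesgue_on \<Omega>) f \<longleftrightarrow> integrable lborel f"
proof -
  have e: "(\<lambda>x. indicator \<Omega> x *\<^sub>R f x) = f"
    using assms(3) by (auto simp: fun_eq_iff indicator_def)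
  have "integral\<^sup>L (lebesgue_on \<Omega>) f = integral\<^sup>L lebesgue (\<lambda>x. indicator \<Omega> x *\<^sub>R f x)"
    by (rule integral_restrict_space) (use assms(1) in auto)
  also have "\<dots> = integral\<^sup>L lborel f"
    unfolding e by (rule integral_completion) (use assms(2) in simp)
  finally show "integral\<^sup>L (lebesgue_on \<Omega>) f = integral\<^sup>L lborel f" .
  have "integrable (lebesgue_on \<Omega>) f \<longleftrightarrow> integrable lebesgue (\<lambda>x. indicator \<Omega> x *\<^sub>R f x)"
    by (rule integrable_restrict_space) (use assms(1) in auto)
  also have "\<dots> \<longleftrightarrow> integrable lborel f"
    unfolding e by (rule integrable_completion) (use assms(2) in simp)
  finally show "integrable (lebesgue_on \<Omega>) f \<longleftrightarrow> integrable lborel f" .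
qed

section \<open>Square-integrable functions\<close>

lemma L2_iff: "f \<in> L2 \<Omega> \<longleftrightarrow> f \<in> borel_measurable (lebesgue_on \<Omega>) \<and>
    integrable (lebesgue_on \<Omega>) (\<lambda>x. (norm (f x))\<^sup>2)"
  unfolding L2_def by (auto simp: integrable_iff_bounded)

lemma L2_measurable: "f \<in> L2 \<Omega> \<Longrightarrow> f \<in> borel_measurable (lebesgue_on \<Omega>)"
  by (simp add: L2_def)

lemma norm_add_square_le: "(norm (a + b))\<^sup>2 \<le> 2 * (norm a)\<^sup>2 + 2 * (norm (b::'a::real_normed_vector))\<^sup>2"
proof -
  have "(norm (a + b))\<^sup>2 \<le> (norm a + norm b)\<^sup>2"
    by (intro power_mono norm_triangle_ineq) auto
  also have "\<dots> \<le> 2 * (norm a)\<^sup>2 + 2 * (norm b)\<^sup>2"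
    using zero_le_power2[of "norm a - norm b"] by (simp add: power2_sum power2_diff)
  finally show ?thesis .
qed

lemma L2_I:
  assumes "f \<in> borel_measurable (lebesgue_on \<Omega>)" "integrable (lebesgue_on \<Omega>) g"
    "\<And>x. x \<in> \<Omega> \<Longrightarrow> (norm (f x))\<^sup>2 \<le> g x"
  shows "f \<in> L2 \<Omega>"
  unfolding L2_iff
proof (intro conjI Bochner_Integration.integrable_bound[OF assms(2)] AE_I2)
  show "(\<lambda>x. (norm (f x))\<^sup>2) \<in> borel_measurable (lebesgue_on \<Omega>)"
    using assms(1) by measurable
  show "norm ((norm (f x))\<^sup>2) \<le> norm (g x)" if "x \<in> space (lebesgue_on \<Omega>)" for x
    using assms(3)[of x] that by simp
qed (rule assms(1))

lemma L2_add:
  assumes "f \<in> L2 \<Omega>" "g \<in> L2 \<Omega>" shows "(\<lambda>x. f x + g x) \<in> L2 \<Omega>"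
proof (rule L2_I)
  show "(\<lambda>x. f x + g x) \<in> borel_measurable (lebesgue_on \<Omega>)"
    by (intro borel_measurable_add L2_measurable assms)
  show "integrable (lebesgue_on \<Omega>) (\<lambda>x. 2 * (norm (f x))\<^sup>2 + 2 * (norm (g x))\<^sup>2)"
    by (intro Bochner_Integration.integrable_add integrable_mult_right) (use assms in \<open>simp_all add: L2_iff\<close>)
qed (rule norm_add_square_le)

lemma L2_bound:
  assumes "f \<in> L2 \<Omega>" "g \<in> borel_measurable (lebesgue_on \<Omega>)"
    "\<And>x. x \<in> \<Omega> \<Longrightarrow> norm (g x) \<le> C * norm (f x)"
  shows "g \<in> L2 \<Omega>"
proof (rule L2_I[OF assms(2)])
  show "integrable (lebesgue_on \<Omega>) (\<lambda>x. C\<^sup>2 * (norm (f x))\<^sup>2)"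
    by (intro integrable_mult_right) (use assms in \<open>simp add: L2_iff\<close>)
  show "(norm (g x))\<^sup>2 \<le> C\<^sup>2 * (norm (f x))\<^sup>2" if "x \<in> \<Omega>" for x
    using power_mono[OF assms(3)[OF that], of 2] by (simp add: power_mult_distrib)
qed

lemma L2_scaleR: "f \<in> L2 \<Omega> \<Longrightarrow> (\<lambda>x. c *\<^sub>R f x) \<in> L2 \<Omega>"
  by (rule L2_bound[of f \<Omega> _ "\<bar>c\<bar>"]) (auto simp: L2_iff)

lemma L2_minus: "f \<in> L2 \<Omega> \<Longrightarrow> g \<in> L2 \<Omega> \<Longrightarrow> (\<lambda>x. f x - g x) \<in> L2 \<Omega>"
  using L2_add[of f \<Omega> "\<lambda>x. (-1) *\<^sub>R g x"] L2_scaleR[of g \<Omega> "-1"] by simp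

lemma L2_linear:
  fixes L :: "'b::euclidean_space \<Rightarrow> 'c::euclidean_space"
  assumes "f \<in> L2 \<Omega>" "bounded_linear L" shows "(\<lambda>x. L (f x)) \<in> L2 \<Omega>"
proof -
  obtain C where C: "\<And>x. norm (L x) \<le> norm x * C" using bounded_linear.bounded[OF assms(2)] by blast
  have "(\<lambda>x. L (f x)) \<in> borel_measurable (lebesgue_on \<Omega>)"
    using borel_measurable_continuous_onI[OF linear_continuous_on[OF assms(2)]] L2_measurable[OF assms(1)]
    by (rule measurable_compose_rev)
  then show ?thesis
    by (rule L2_bound[OF assms(1)]) (use C in \<open>auto simp: mult.commute\<close>)
qed

lemma L2_mult_integrable:
  fixes f g :: "'a::euclidean_space \<Rightarrow> real"
  assumes "f \<in> L2 \<Omega>" "g \<in> L2 \<Omega>" shows "integrable (lebesgue_on \<Omega>) (\<lambda>x. f x * g x)"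
proof (rule Bochner_Integration.integrable_bound)
  show "integrable (lebesgue_on \<Omega>) (\<lambda>x. (norm (f x))\<^sup>2 + (norm (g x))\<^sup>2)"
    using assms by (auto simp: L2_iff)
  show "(\<lambda>x. f x * g x) \<in> borel_measurable (lebesgue_on \<Omega>)"
    using assms by (auto simp: L2_iff)
  have "\<bar>a * b\<bar> \<le> a\<^sup>2 + b\<^sup>2" for a b :: real
  proof -
    have "2 * \<bar>a * b\<bar> \<le> a\<^sup>2 + b\<^sup>2"
      using zero_le_power2[of "\<bar>a\<bar> - \<bar>b\<bar>"] unfolding power2_diff power2_abs by (simp add: abs_mult)
    moreover have "0 \<le> a\<^sup>2 + b\<^sup>2" by simp
    ultimately show ?thesis by linarith
  qed
  then show "AE x in lebesgue_on \<Omega>. norm (f x * g x) \<le> norm ((norm (f x))\<^sup>2 + (norm (g x))\<^sup>2)"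
    by (auto intro!: AE_I2)
qed

lemma L2_continuous:
  fixes f :: "'a::euclidean_space \<Rightarrow> 'b::euclidean_space"
  assumes "open \<Omega>" "continuous_on UNIV f" "compact (supp f)"
  shows "f \<in> L2 \<Omega>"
proof (rule L2_I)
  have fm: "f \<in> borel_measurable borel" using borel_measurable_continuous_onI[OF assms(2)] .
  show "f \<in> borel_measurable (lebesgue_on \<Omega>)"
    using fm by (intro measurable_restrict_space1 measurable_completion) simp
  have "supp (\<lambda>x. (norm (f x))\<^sup>2) \<subseteq> supp f"
    by (rule supp_subset) (use supp_zero[of _ f] in auto)
  then have i: "integrable lborel (\<lambda>x. (norm (f x))\<^sup>2)"
    by (intro continuous_supp_integrable continuous_intros assms compact_supp_mono[OF assms(3)])
  then have "integrable lborel (\<lambda>x. indicator \<Omega> x *\<^sub>R (norm (f x))\<^sup>2)"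
    by (intro integrable_mult_indicator) (use assms(1) in auto)
  then have "integrable lebesgue (\<lambda>x. indicator \<Omega> x *\<^sub>R (norm (f x))\<^sup>2)"
    by (subst integrable_completion) auto
  then show "integrable (lebesgue_on \<Omega>) (\<lambda>x. (norm (f x))\<^sup>2)"
    by (subst integrable_restrict_space) (use assms(1) in auto)
qed simp

section \<open>Weak gradients\<close>

definition grad_mat :: "(real^3 \<Rightarrow> real^3) \<Rightarrow> real^3 \<Rightarrow> real^3^3" where
  "grad_mat v x = (\<chi> i k. frechet_derivative v (at x) (axis k 1) $ i)"

lemma Ck_on_component:
  fixes v :: "'a::euclidean_space \<Rightarrow> real^'n"
  assumes "open U" "Ck_on k U v" shows "Ck_on k U (\<lambda>x. v x $ i)"
  by (rule Ck_on_linear_compose[OF assms(1) bounded_linear_vec_nth assms(2)])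

lemma grad_mat_nth:
  assumes "v differentiable at x"
  shows "grad_mat v x $ i $ k = frechet_derivative (\<lambda>x. v x $ i) (at x) (axis k 1)"
proof -
  have "(v has_derivative frechet_derivative v (at x)) (at x)"
    using assms by (simp add: frechet_derivative_works)
  from frechet_derivative_at[OF bounded_linear.has_derivative[OF bounded_linear_vec_nth this]]
  show ?thesis unfolding grad_mat_def by (simp add: fun_eq_iff)
qed

lemma grad_mat_continuous:
  assumes "Ck_on 1 UNIV v" shows "continuous_on UNIV (grad_mat v)"
proof -
  have "continuous_on UNIV (\<lambda>x. frechet_derivative v (at x) w)" for w
    using assms by simp
  then have c: "continuous_on UNIV (\<lambda>x. frechet_derivative v (at x) w $ i)" for w i
    by (rule bounded_linear.continuous_on[OF bounded_linear_vec_nth])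
  show ?thesis
    unfolding grad_mat_def[abs_def] by (intro continuous_on_vec_lambda c)
qed

lemma supp_grad_mat: "supp (grad_mat v) \<subseteq> supp v"
  by (rule supp_subset) (use deriv_zero_off_supp[of _ v] in \<open>auto simp: grad_mat_def vec_eq_iff\<close>)

lemma is_weak_gradient_Cinfc:
  assumes "open \<Omega>" "v \<in> Cinfc U"
  shows "is_weak_gradient \<Omega> v (grad_mat v)"
  unfolding is_weak_gradient_def
proof (intro conjI allI impI)
  note C1 = Ck_on_Cinfc[OF assms(2), of 1]
  have diff: "v differentiable at x" for x using C1 by simp
  have supp: "compact (supp v)" using Cinfc_supp(1)[OF assms(2)] .
  show "grad_mat v \<in> L2 \<Omega>"
    by (intro L2_continuous assms(1) grad_mat_continuous C1 compact_supp_mono[OF supp supp_grad_mat])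
  fix \<phi> :: "real^3 \<Rightarrow> real" and i k :: 3
  assume phi: "\<phi> \<in> Cinfc \<Omega>"
  have phi1: "Ck_on 1 UNIV \<phi>" by (rule Ck_on_Cinfc[OF phi])
  have vi1: "Ck_on 1 UNIV (\<lambda>x. v x $ i)" by (rule Ck_on_component[OF open_UNIV C1])
  have vis: "compact (supp (\<lambda>x. v x $ i))"
    by (rule compact_supp_mono[OF supp], rule supp_subset) (use supp_zero[of _ v] in force)+
  have m: "(\<lambda>x. v x $ i) \<in> borel_measurable borel" "\<phi> \<in> borel_measurable borel"
    "(\<lambda>x. frechet_derivative \<phi> (at x) (axis k 1)) \<in> borel_measurable borel"
    "(\<lambda>x. grad_mat v x $ i $ k) \<in> borel_measurable borel"
    using Ck_on_continuous[OF vi1] Ck_on_continuous[OF phi1] phi1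
    by (auto intro!: borel_measurable_continuous_onI continuous_intros grad_mat_continuous C1)
  have "(LINT x|lebesgue_on \<Omega>. v x $ i * frechet_derivative \<phi> (at x) (axis k 1)) =
      (LINT x|lborel. v x $ i * frechet_derivative \<phi> (at x) (axis k 1))"
  proof (rule lebesgue_on_integral_eq(1)[OF assms(1)])
    show "(\<lambda>x. v x $ i * frechet_derivative \<phi> (at x) (axis k 1)) \<in> borel_measurable borel"
      using m by measurable
    show "v x $ i * frechet_derivative \<phi> (at x) (axis k 1) = 0" if "x \<notin> \<Omega>" for x
      using deriv_zero_off_supp[of x \<phi>] Cinfc_supp(2)[OF phi] that by auto
  qed
  also have "\<dots> = - (LINT x|lborel. frechet_derivative (\<lambda>x. v x $ i) (at x) (axis k 1) * \<phi> x)"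
    by (rule integral_by_parts[OF vi1 phi1 vis])
  also have "\<dots> = - (LINT x|lborel. grad_mat v x $ i $ k * \<phi> x)"
    by (simp add: grad_mat_nth[OF diff])
  also have "(LINT x|lborel. grad_mat v x $ i $ k * \<phi> x) = (LINT x|lebesgue_on \<Omega>. grad_mat v x $ i $ k * \<phi> x)"
  proof (rule lebesgue_on_integral_eq(1)[OF assms(1), symmetric])
    show "(\<lambda>x. grad_mat v x $ i $ k * \<phi> x) \<in> borel_measurable borel" using m by measurable
    show "grad_mat v x $ i $ k * \<phi> x = 0" if "x \<notin> \<Omega>" for x
      using Cinfc_zero_off[OF phi that] by simp
  qed
  finally show "(LINT x|lebesgue_on \<Omega>. v x $ i * frechet_derivative \<phi> (at x) (axis k 1)) =
      - (LINT x|lebesgue_on \<Omega>. grad_mat v x $ i $ k * \<phi> x)" .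
qed

lemma bounded_linear_entry: "bounded_linear (\<lambda>A::real^'n^'m. A $ i $ k)"
  by (rule bounded_linear_compose[OF bounded_linear_vec_nth bounded_linear_vec_nth])

lemma is_weak_gradient_lincomb:
  assumes "open \<Omega>" "u \<in> L2 \<Omega>" "w \<in> L2 \<Omega>" "is_weak_gradient \<Omega> u G" "is_weak_gradient \<Omega> w H"
  shows "is_weak_gradient \<Omega> (\<lambda>x. u x + c *\<^sub>R w x) (\<lambda>x. G x + c *\<^sub>R H x)"
  unfolding is_weak_gradient_def
proof (intro conjI allI impI)
  have G: "G \<in> L2 \<Omega>" and H: "H \<in> L2 \<Omega>" using assms(4,5) by (auto simp: is_weak_gradient_def)
  then show "(\<lambda>x. G x + c *\<^sub>R H x) \<in> L2 \<Omega>" by (intro L2_add L2_scaleR)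
  fix \<phi> :: "real^3 \<Rightarrow> real" and i k :: 3
  assume phi: "\<phi> \<in> Cinfc \<Omega>"
  have phi1: "Ck_on 1 UNIV \<phi>" by (rule Ck_on_Cinfc[OF phi])
  have phiL: "\<phi> \<in> L2 \<Omega>"
    by (rule L2_continuous[OF assms(1) Ck_on_continuous[OF phi1] Cinfc_supp(1)[OF phi]])
  have DL: "(\<lambda>x. frechet_derivative \<phi> (at x) (axis k 1)) \<in> L2 \<Omega>"
    by (rule L2_continuous[OF assms(1) _ compact_supp_mono[OF Cinfc_supp(1)[OF phi] supp_deriv_subset]])
       (use phi1 in simp)
  have i: "integrable (lebesgue_on \<Omega>) (\<lambda>x. u x $ i * frechet_derivative \<phi> (at x) (axis k 1))"
    "integrable (lebesgue_on \<Omega>) (\<lambda>x. w x $ i * frechet_derivative \<phi> (at x) (axis k 1))"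
    "integrable (lebesgue_on \<Omega>) (\<lambda>x. G x $ i $ k * \<phi> x)"
    "integrable (lebesgue_on \<Omega>) (\<lambda>x. H x $ i $ k * \<phi> x)"
    using L2_linear[OF assms(2) bounded_linear_vec_nth] L2_linear[OF assms(3) bounded_linear_vec_nth]
      L2_linear[OF G bounded_linear_entry] L2_linear[OF H bounded_linear_entry] phiL DL
    by (auto intro: L2_mult_integrable)
  have e: "(LINT x|lebesgue_on \<Omega>. u x $ i * frechet_derivative \<phi> (at x) (axis k 1))
      = - (LINT x|lebesgue_on \<Omega>. G x $ i $ k * \<phi> x)"
    "(LINT x|lebesgue_on \<Omega>. w x $ i * frechet_derivative \<phi> (at x) (axis k 1))
      = - (LINT x|lebesgue_on \<Omega>. H x $ i $ k * \<phi> x)"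
    using assms(4,5) phi by (auto simp: is_weak_gradient_def)
  have "(LINT x|lebesgue_on \<Omega>. (u x + c *\<^sub>R w x) $ i * frechet_derivative \<phi> (at x) (axis k 1)) =
    (LINT x|lebesgue_on \<Omega>. u x $ i * frechet_derivative \<phi> (at x) (axis k 1)
        + c * (w x $ i * frechet_derivative \<phi> (at x) (axis k 1)))"
    by (simp add: algebra_simps)
  also have "\<dots> = - (LINT x|lebesgue_on \<Omega>. G x $ i $ k * \<phi> x + c * (H x $ i $ k * \<phi> x))"
    using i e by (simp add: Bochner_Integration.integral_add integrable_mult_right)
  also have "\<dots> = - (LINT x|lebesgue_on \<Omega>. (G x + c *\<^sub>R H x) $ i $ k * \<phi> x)"
    by (simp add: algebra_simps)
  finally show "(LINT x|lebesgue_on \<Omega>. (u x + c *\<^sub>R w x) $ i * frechet_derivative \<phi> (at x) (axis k 1)) =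
    - (LINT x|lebesgue_on \<Omega>. (G x + c *\<^sub>R H x) $ i $ k * \<phi> x)" .
qed

lemma sigma_finite_lebesgue: "sigma_finite_measure (lebesgue :: 'a::euclidean_space measure)"
proof
  obtain A :: "'a set set" where A: "countable A" "A \<subseteq> sets lborel" "\<Union>A = space lborel"
    "\<forall>a\<in>A. emeasure lborel a \<noteq> \<infinity>"
    using lborel.sigma_finite_countable by blast
  then show "\<exists>A. countable A \<and> A \<subseteq> sets lebesgue \<and> \<Union>A = space (lebesgue::'a measure) \<and>
      (\<forall>a\<in>A. emeasure lebesgue a \<noteq> \<infinity>)"
    by (intro exI[of _ A]) (auto intro: sets_completionI_sets)
qed

text \<open>By outer regularity a Lebesgue set is a decreasing intersection of open sets up to a null set,
  so that the integral of \<open>f\<close> over it is a limit of integrals over open sets.\<close>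

lemma AE_zero_if_open_integrals_zero:
  fixes f :: "'a::euclidean_space \<Rightarrow> real"
  assumes f: "integrable lebesgue f"
    and zero: "\<And>W. open W \<Longrightarrow> (LINT x|lebesgue. indicator W x * f x) = 0"
  shows "AE x in lebesgue. f x = 0"
proof (rule sigma_finite_measure.density_zero[OF sigma_finite_lebesgue f])
  fix A :: "'a set" assume A: "A \<in> sets lebesgue"
  have "\<exists>T. open T \<and> A \<subseteq> T \<and> emeasure lebesgue (T - A) < ennreal (1 / real (Suc n))" for n
    using sets_lebesgue_outer_open[OF A, of "1 / real (Suc n)"] by (metis of_nat_0_less_iff zero_less_Suc zero_less_divide_1_iff)
  then obtain T where T: "\<And>n. open (T n)" "\<And>n. A \<subseteq> T n"
    "\<And>n. emeasure lebesgue (T n - A) < ennreal (1 / real (Suc n))" by metis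
  define W where "W n = (\<Inter>k\<le>n. T k)" for n
  define G where "G = (\<Inter>n. T n)"
  have W_open: "open (W n)" for n unfolding W_def using T(1) by auto
  have G_sets: "G \<in> sets lebesgue" unfolding G_def using T(1) by (intro sets.countable_INT) auto
  have "emeasure lebesgue (G - A) \<le> ennreal (1 / real (Suc n))" for n
  proof -
    have "emeasure lebesgue (G - A) \<le> emeasure lebesgue (T n - A)"
      by (rule emeasure_mono) (use T(1)[of n] A in \<open>auto simp: G_def\<close>)
    then show ?thesis using T(3)[of n] by auto
  qed
  moreover have "(\<lambda>n. ennreal (1 / real (Suc n))) \<longlonglongrightarrow> ennreal 0"
    using LIMSEQ_inverse_real_of_nat by (intro tendsto_ennrealI) (simp add: inverse_eq_divide)
  ultimately have "emeasure lebesgue (G - A) \<le> ennreal 0"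
    by (intro LIMSEQ_le_const) auto
  then have null: "G - A \<in> null_sets lebesgue"
    using G_sets A by (intro null_setsI) auto
  have "(\<lambda>n. LINT x|lebesgue. indicator (W n) x * f x) \<longlonglongrightarrow> (LINT x|lebesgue. indicator G x * f x)"
  proof (rule integral_dominated_convergence)
    show "integrable lebesgue (\<lambda>x. norm (f x))" using f by simp
    show "(\<lambda>x. indicator G x * f x) \<in> borel_measurable lebesgue" using f G_sets by measurable
    show "(\<lambda>x. indicator (W n) x * f x) \<in> borel_measurable lebesgue" for n
    proof -
      have [measurable]: "W n \<in> sets lebesgue" using W_open by auto
      show ?thesis using f by measurable
    qed
    show "AE x in lebesgue. (\<lambda>n. indicator (W n) x * f x) \<longlonglongrightarrow> indicator G x * f x"
    proof (intro AE_I2 tendsto_mult tendsto_const)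
      fix x
      show "(\<lambda>n. indicator (W n) x :: real) \<longlonglongrightarrow> indicator G x"
      proof (cases "x \<in> G")
        case True then show ?thesis by (simp add: W_def G_def)
      next
        case False
        then obtain m where m: "x \<notin> T m" by (auto simp: G_def)
        have "\<forall>\<^sub>F n in sequentially. indicator (W n) x = (0::real)"
          using eventually_ge_at_top[of m] by eventually_elim (use m in \<open>auto simp: W_def indicator_def\<close>)
        then show ?thesis using False by (simp add: tendsto_eventually)
      qed
    qed
    show "AE x in lebesgue. norm (indicator (W n) x * f x) \<le> norm (f x)" for n
      by (intro AE_I2) (auto simp: indicator_def)
  qed
  then have "(LINT x|lebesgue. indicator G x * f x) = 0"
    using zero[OF W_open] by (simp add: LIMSEQ_const_iff)
  moreover have "(LINT x|lebesgue. indicator G x * f x) = (LINT x|lebesgue. indicator A x * f x)"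
  proof (rule integral_cong_AE)
    show "(\<lambda>x. indicator G x * f x) \<in> borel_measurable lebesgue" using f G_sets by measurable
    show "(\<lambda>x. indicator A x * f x) \<in> borel_measurable lebesgue" using f A by measurable
    show "AE x in lebesgue. indicator G x * f x = indicator A x * f x"
      using AE_not_in[OF null] by eventually_elim (use T(2) in \<open>auto simp: G_def indicator_def\<close>)
  qed
  ultimately show "set_lebesgue_integral lebesgue A f = 0"
    by (simp add: set_lebesgue_integral_def)
qed

text \<open>The smooth cutoffs of a bounded open subset of \<open>\<Omega>\<close> converge boundedly to its indicator function,
  hence the integral of \<open>g\<close> over this subset vanishes.\<close>

lemma AE_zero_if_orthogonal_to_Cinfc:
  fixes g :: "'a::euclidean_space \<Rightarrow> real"
  assumes "open \<Omega>" "g \<in> L2 \<Omega>" "\<And>\<phi>. \<phi> \<in> Cinfc \<Omega> \<Longrightarrow> (LINT x|lebesgue_on \<Omega>. g x * \<phi> x) = 0"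
  shows "AE x in lebesgue_on \<Omega>. g x = 0"
proof -
  have \<Omega>: "\<Omega> \<in> sets lebesgue" using assms(1) by auto
  define V where "V N = \<Omega> \<inter> ball 0 (real N)" for N
  have V: "open (V N)" "V N \<subseteq> \<Omega>" for N using assms(1) by (auto simp: V_def)
  have int: "integrable (lebesgue_on \<Omega>) (\<lambda>x. indicator W x * g x)" if "open W" "W \<subseteq> V N" for W N
  proof -
    have "(indicator W :: 'a \<Rightarrow> real) \<in> L2 \<Omega>"
      unfolding L2_iff
    proof
      show m: "indicator W \<in> borel_measurable (lebesgue_on \<Omega>)"
        using that(1) by (intro measurable_restrict_space1 borel_measurable_indicator) auto
      have "emeasure lborel W \<le> emeasure lborel (ball (0::'a) (real N))"
        by (rule emeasure_mono) (use that in \<open>auto simp: V_def\<close>)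
      then have fin: "emeasure lborel W < \<infinity>"
        using emeasure_lborel_ball_finite[of "0::'a" "real N"] by (simp add: order_le_less_trans)
      have "integrable lborel (indicator W :: 'a \<Rightarrow> real)"
        by (rule integrable_real_indicator) (use fin that in auto)
      then have "integrable (lebesgue_on \<Omega>) (indicator W :: 'a \<Rightarrow> real)"
        by (subst lebesgue_on_integral_eq(2)[OF assms(1)])
           (use that V(2)[of N] in \<open>auto simp: indicator_def\<close>)
      moreover have "(\<lambda>x. (norm (indicator W x :: real))\<^sup>2) = indicator W"
        by (auto simp: fun_eq_iff indicator_def)
      ultimately show "integrable (lebesgue_on \<Omega>) (\<lambda>x. (norm (indicator W x :: real))\<^sup>2)" by simp
    qed
    then show ?thesis using L2_mult_integrable assms(2) by blast
  qed
  have open_zero: "(LINT x|lebesgue_on \<Omega>. indicator W x * g x) = 0" if W: "open W" "W \<subseteq> V N" for W N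
  proof -
    obtain \<psi> :: "nat \<Rightarrow> 'a \<Rightarrow> real" where \<psi>: "\<And>n. \<psi> n \<in> Cinfc W" "\<And>n x. 0 \<le> \<psi> n x" "\<And>n x. \<psi> n x \<le> 1"
      "\<And>x. (\<lambda>n. \<psi> n x) \<longlonglongrightarrow> indicator W x" using smooth_cutoffs[OF W(1)] by blast
    have "(\<lambda>n. LINT x|lebesgue_on \<Omega>. \<psi> n x * g x) \<longlonglongrightarrow> (LINT x|lebesgue_on \<Omega>. indicator W x * g x)"
    proof (rule integral_dominated_convergence)
      show "integrable (lebesgue_on \<Omega>) (\<lambda>x. norm (indicator W x * g x))"
        using int[OF W] by simp
      show "(\<lambda>x. indicator W x * g x) \<in> borel_measurable (lebesgue_on \<Omega>)" using int[OF W] by simp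
      show "(\<lambda>x. \<psi> n x * g x) \<in> borel_measurable (lebesgue_on \<Omega>)" for n
      proof -
        have "\<psi> n \<in> borel_measurable (lebesgue_on \<Omega>)"
          using L2_continuous[OF assms(1) Ck_on_continuous[OF Ck_on_Cinfc[OF \<psi>(1)]] Cinfc_supp(1)[OF \<psi>(1)]]
          by (rule L2_measurable)
        then show ?thesis using L2_measurable[OF assms(2)] by simp
      qed
      show "AE x in lebesgue_on \<Omega>. (\<lambda>n. \<psi> n x * g x) \<longlonglongrightarrow> indicator W x * g x"
        by (intro AE_I2 tendsto_mult tendsto_const \<psi>)
      have "norm (\<psi> n x * g x) \<le> norm (indicator W x * g x)" for n x
      proof (cases "x \<in> W")
        case True
        then show ?thesis using \<psi>(2,3)[of n x] by (simp add: abs_mult mult_left_le_one_le)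
      qed (use Cinfc_zero_off[OF \<psi>(1)] in simp)
      then show "AE x in lebesgue_on \<Omega>. norm (\<psi> n x * g x) \<le> norm (indicator W x * g x)" for n
        by simp
    qed
    moreover have "(LINT x|lebesgue_on \<Omega>. \<psi> n x * g x) = 0" for n
      using assms(3)[OF Cinfc_mono[OF \<psi>(1)]] W V(2) by (simp add: mult.commute) blast
    ultimately show ?thesis by (simp add: LIMSEQ_const_iff)
  qed
  have "AE x in lebesgue. indicator (V N) x * (indicator \<Omega> x * g x) = 0" for N
  proof (rule AE_zero_if_open_integrals_zero)
    have "integrable lebesgue (\<lambda>x. indicator \<Omega> x *\<^sub>R (indicator (V N) x * g x))"
      using int[OF V(1) order_refl, of N] by (subst (asm) integrable_restrict_space) (use \<Omega> in auto)
    then show "integrable lebesgue (\<lambda>x. indicator (V N) x * (indicator \<Omega> x * g x))"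
      by (simp add: mult_ac)
    fix W :: "'a set" assume W: "open W"
    have "(LINT x|lebesgue_on \<Omega>. indicator (W \<inter> V N) x * g x) = 0"
      by (rule open_zero[of _ N]) (use W V in auto)
    then have "(LINT x|lebesgue. indicator \<Omega> x *\<^sub>R (indicator (W \<inter> V N) x * g x)) = 0"
      by (subst (asm) integral_restrict_space) (use \<Omega> in auto)
    then show "(LINT x|lebesgue. indicator W x * (indicator (V N) x * (indicator \<Omega> x * g x))) = 0"
      by (simp add: indicator_inter_arith mult_ac)
  qed
  then have "AE x in lebesgue. \<forall>N. indicator (V N) x * (indicator \<Omega> x * g x) = 0"
    unfolding AE_all_countable by blast
  then have "AE x in lebesgue. x \<in> \<Omega> \<longrightarrow> g x = 0"
  proof eventually_elim
    case (elim x)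
    obtain N where "norm x < real N" using reals_Archimedean2 by blast
    then show ?case using elim[rule_format, of N] by (auto simp: V_def)
  qed
  then show ?thesis by (subst AE_restrict_space_iff) (use \<Omega> in auto)
qed

lemma weak_gradient_unique:
  assumes "open \<Omega>" "is_weak_gradient \<Omega> u G" "is_weak_gradient \<Omega> u H"
  shows "AE x in lebesgue_on \<Omega>. G x = H x"
proof -
  have G: "G \<in> L2 \<Omega>" and H: "H \<in> L2 \<Omega>" using assms(2,3) by (auto simp: is_weak_gradient_def)
  have "AE x in lebesgue_on \<Omega>. G x $ i $ k - H x $ i $ k = 0" for i k
  proof (rule AE_zero_if_orthogonal_to_Cinfc[OF assms(1)])
    note LG = L2_linear[OF G bounded_linear_entry, of i k] and LH = L2_linear[OF H bounded_linear_entry, of i k]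
    show "(\<lambda>x. G x $ i $ k - H x $ i $ k) \<in> L2 \<Omega>" by (intro L2_minus LG LH)
    fix \<phi> :: "real^3 \<Rightarrow> real" assume phi: "\<phi> \<in> Cinfc \<Omega>"
    have phiL: "\<phi> \<in> L2 \<Omega>"
      by (rule L2_continuous[OF assms(1) Ck_on_continuous[OF Ck_on_Cinfc[OF phi]] Cinfc_supp(1)[OF phi]])
    have "(LINT x|lebesgue_on \<Omega>. G x $ i $ k * \<phi> x) = (LINT x|lebesgue_on \<Omega>. H x $ i $ k * \<phi> x)"
    proof -
      have "- (LINT x|lebesgue_on \<Omega>. G x $ i $ k * \<phi> x) = - (LINT x|lebesgue_on \<Omega>. H x $ i $ k * \<phi> x)"
        using assms(2,3) phi unfolding is_weak_gradient_def by simp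
      then show ?thesis by simp
    qed
    then show "(LINT x|lebesgue_on \<Omega>. (G x $ i $ k - H x $ i $ k) * \<phi> x) = 0"
      using L2_mult_integrable[OF LG phiL] L2_mult_integrable[OF LH phiL] by (simp add: left_diff_distrib)
  qed
  then have "AE x in lebesgue_on \<Omega>. \<forall>i k. G x $ i $ k - H x $ i $ k = 0"
    by (simp add: AE_all_countable)
  then show ?thesis by eventually_elim (simp add: vec_eq_iff)
qed

lemma wgrad_is_weak_gradient: "u \<in> H1 \<Omega> \<Longrightarrow> is_weak_gradient \<Omega> u (wgrad \<Omega> u)"
  unfolding H1_def wgrad_def using someI_ex[of "is_weak_gradient \<Omega> u"] by blast

lemma wgrad_L2: "u \<in> H1 \<Omega> \<Longrightarrow> wgrad \<Omega> u \<in> L2 \<Omega>"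
  using wgrad_is_weak_gradient by (auto simp: is_weak_gradient_def)

lemma Cinfc_L2: "open \<Omega> \<Longrightarrow> v \<in> Cinfc U \<Longrightarrow> v \<in> L2 \<Omega>"
  using L2_continuous[OF _ Ck_on_continuous[OF Ck_on_Cinfc] Cinfc_supp(1)] by blast

lemma H1_add_Cinfc:
  assumes "open \<Omega>" "u \<in> H1 \<Omega>" "v \<in> Cinfc U"
  shows "(\<lambda>x. u x + c *\<^sub>R v x) \<in> H1 \<Omega>"
    "AE x in lebesgue_on \<Omega>. wgrad \<Omega> (\<lambda>x. u x + c *\<^sub>R v x) x = wgrad \<Omega> u x + c *\<^sub>R grad_mat v x"
proof -
  have uL: "u \<in> L2 \<Omega>" using assms(2) by (simp add: H1_def)
  have w: "is_weak_gradient \<Omega> (\<lambda>x. u x + c *\<^sub>R v x) (\<lambda>x. wgrad \<Omega> u x + c *\<^sub>R grad_mat v x)"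
    by (rule is_weak_gradient_lincomb[OF assms(1) uL Cinfc_L2[OF assms(1,3)]
          wgrad_is_weak_gradient[OF assms(2)] is_weak_gradient_Cinfc[OF assms(1,3)]])
  show H: "(\<lambda>x. u x + c *\<^sub>R v x) \<in> H1 \<Omega>"
    unfolding H1_def using w L2_add[OF uL L2_scaleR[OF Cinfc_L2[OF assms(1,3)]]] by blast
  show "AE x in lebesgue_on \<Omega>. wgrad \<Omega> (\<lambda>x. u x + c *\<^sub>R v x) x = wgrad \<Omega> u x + c *\<^sub>R grad_mat v x"
    by (rule weak_gradient_unique[OF assms(1) wgrad_is_weak_gradient[OF H] w])
qed

text \<open>The constant sequence \<open>v\<close> is admissible, because the representative chosen for the weak
  gradient of the zero function vanishes almost everywhere.\<close>

lemma Cinfc_H10: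
  assumes "open \<Omega>" "v \<in> Cinfc \<Omega>" shows "v \<in> H10 \<Omega>"
proof -
  have H: "v \<in> H1 \<Omega>"
    unfolding H1_def using Cinfc_L2[OF assms] is_weak_gradient_Cinfc[OF assms] by blast
  have z: "(\<lambda>x. 0) \<in> Cinfc \<Omega>" for \<Omega> :: "(real^3) set"
    by (auto simp: Cinfc_def smooth_on_def Ck_on_const supp_def)
  have "grad_mat (\<lambda>x. 0) = (\<lambda>x. 0)" by (simp add: grad_mat_def vec_eq_iff fun_eq_iff)
  then have w0: "is_weak_gradient \<Omega> (\<lambda>x. 0) (\<lambda>x. 0)"
    using is_weak_gradient_Cinfc[OF assms(1) z[of \<Omega>]] by simp
  then have "(\<lambda>x. 0) \<in> H1 \<Omega>"
    unfolding H1_def using Cinfc_L2[OF assms(1) z[of \<Omega>]] by blast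
  from weak_gradient_unique[OF assms(1) wgrad_is_weak_gradient[OF this] w0]
  have "AE x in lebesgue_on \<Omega>. wgrad \<Omega> (\<lambda>x. 0) x = 0" .
  then have "H1_norm_sq \<Omega> (\<lambda>x. 0) = (\<integral>\<^sup>+x. 0 \<partial>lebesgue_on \<Omega>)"
    unfolding H1_norm_sq_def by (intro nn_integral_cong_AE) (auto elim: eventually_mono)
  then have "(\<lambda>k. H1_norm_sq \<Omega> (\<lambda>x. v x - v x)) \<longlonglongrightarrow> 0" by simp
  then show ?thesis
    unfolding H10_def using H assms(2) by (auto intro!: exI[of _ "\<lambda>k. v"])
qed

section \<open>Total variation in the plane\<close>

lemma C1c_D:
  assumes "\<phi> \<in> C1c U"
  shows "Ck_on 1 UNIV \<phi>" "compact (supp \<phi>)" "supp \<phi> \<subseteq> U"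
  using assms unfolding C1c_def by blast+

lemma div2_continuous:
  fixes \<phi> :: "real^2 \<Rightarrow> ('b::euclidean_space)^2"
  assumes "Ck_on 1 UNIV \<phi>"
  shows "continuous_on UNIV (div2 \<phi>)"
proof -
  have "continuous_on UNIV (\<lambda>w. frechet_derivative \<phi> (at w) v)" for v
    using assms by simp
  then have c: "continuous_on UNIV (\<lambda>w. frechet_derivative \<phi> (at w) v $ k)" for v k
    by (rule bounded_linear.continuous_on[OF bounded_linear_vec_nth])
  show ?thesis unfolding div2_def[abs_def] by (intro continuous_on_sum c)
qed

lemma div2_zero_off_supp: "w \<notin> supp \<phi> \<Longrightarrow> div2 \<phi> w = 0"
  by (simp add: div2_def deriv_zero_off_supp)

lemma supp_div2: "supp (div2 \<phi>) \<subseteq> supp \<phi>"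
  by (rule supp_subset) (use div2_zero_off_supp[of _ \<phi>] in auto)

lemma div2_measurable:
  fixes \<phi> :: "real^2 \<Rightarrow> ('b::euclidean_space)^2"
  assumes "\<phi> \<in> C1c U" shows "div2 \<phi> \<in> borel_measurable borel"
  by (rule borel_measurable_continuous_onI[OF div2_continuous[OF C1c_D(1)[OF assms]]])

lemma div2_bounded:
  fixes \<phi> :: "real^2 \<Rightarrow> ('b::euclidean_space)^2"
  assumes "\<phi> \<in> C1c U" obtains C where "C \<ge> 0" "\<And>w. norm (div2 \<phi> w) \<le> C"
  by (rule continuous_supp_bounded[OF div2_continuous[OF C1c_D(1)[OF assms]]
        compact_supp_mono[OF C1c_D(2)[OF assms] supp_div2]]) blast

lemma integrable_inner_div2:
  fixes f :: "real^2 \<Rightarrow> 'b::euclidean_space"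
  assumes "integrable (lebesgue_on U) f" "\<phi> \<in> C1c V"
  shows "integrable (lebesgue_on U) (\<lambda>w. f w \<bullet> div2 \<phi> w)"
proof -
  obtain C where C: "C \<ge> 0" "\<And>w. norm (div2 \<phi> w) \<le> C" using div2_bounded[OF assms(2)] by blast
  have m: "div2 \<phi> \<in> borel_measurable (lebesgue_on U)"
    using div2_measurable[OF assms(2)] by (intro measurable_restrict_space1 measurable_completion) simp
  show ?thesis
  proof (rule Bochner_Integration.integrable_bound)
    show "integrable (lebesgue_on U) (\<lambda>w. C * norm (f w))" using assms(1) by simp
    show "(\<lambda>w. f w \<bullet> div2 \<phi> w) \<in> borel_measurable (lebesgue_on U)"
      using m assms(1) by (intro borel_measurable_inner) auto
    show "AE w in lebesgue_on U. norm (f w \<bullet> div2 \<phi> w) \<le> norm (C * norm (f w))"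
    proof (intro AE_I2)
      fix w
      have "\<bar>f w \<bullet> div2 \<phi> w\<bar> \<le> norm (f w) * norm (div2 \<phi> w)" by (rule Cauchy_Schwarz_ineq2)
      also have "\<dots> \<le> norm (f w) * C" by (intro mult_left_mono C) auto
      finally show "norm (f w \<bullet> div2 \<phi> w) \<le> norm (C * norm (f w))"
        using C(1) by (simp add: mult.commute)
    qed
  qed
qed

lemma tv_upper:
  assumes "integrable (lebesgue_on U) f" "\<phi> \<in> C1c U" "\<And>w. norm (\<phi> w) \<le> 1"
  shows "ennreal (LINT w|lebesgue_on U. f w \<bullet> div2 \<phi> w) \<le> tv U f"
  unfolding tv_def using assms by (auto intro!: SUP_upper)

lemma tv_least:
  assumes "integrable (lebesgue_on U) f"
    "\<And>\<phi>. \<phi> \<in> C1c U \<Longrightarrow> (\<And>w. norm (\<phi> w) \<le> 1) \<Longrightarrow> ennreal (LINT w|lebesgue_on U. f w \<bullet> div2 \<phi> w) \<le> B"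
  shows "tv U f \<le> B"
  unfolding tv_def using assms by (auto intro!: SUP_least)

lemma tv_not_integrable: "\<not> integrable (lebesgue_on U) f \<Longrightarrow> tv U f = \<infinity>"
  by (simp add: tv_def)

lemma tv_zero [simp]: "tv U (\<lambda>w. 0) = 0"
proof -
  have "tv U (\<lambda>w. 0) \<le> 0" by (rule tv_least) auto
  then show ?thesis by simp
qed

lemma tv_cong:
  assumes "\<And>w. w \<in> U \<Longrightarrow> f w = g w" shows "tv U f = tv U g"
proof -
  have i: "integrable (lebesgue_on U) f = integrable (lebesgue_on U) g"
    by (rule Bochner_Integration.integrable_cong) (use assms in auto)
  have "(LINT w|lebesgue_on U. f w \<bullet> div2 \<phi> w) = (LINT w|lebesgue_on U. g w \<bullet> div2 \<phi> w)" for \<phi>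
    by (rule Bochner_Integration.integral_cong) (use assms in auto)
  with i show ?thesis unfolding tv_def by simp
qed

lemma tv_cong_AE:
  assumes "f \<in> borel_measurable (lebesgue_on U)" "g \<in> borel_measurable (lebesgue_on U)"
    "AE w in lebesgue_on U. f w = g w"
  shows "tv U f = tv U g"
proof -
  have i: "integrable (lebesgue_on U) f = integrable (lebesgue_on U) g"
    by (rule integrable_cong_AE[OF assms])
  have "(LINT w|lebesgue_on U. f w \<bullet> div2 \<phi> w) = (LINT w|lebesgue_on U. g w \<bullet> div2 \<phi> w)"
    if "\<phi> \<in> C1c U" for \<phi>
  proof (rule integral_cong_AE)
    have m: "div2 \<phi> \<in> borel_measurable (lebesgue_on U)"
      using div2_measurable[OF that] by (intro measurable_restrict_space1 measurable_completion) simp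
    show "(\<lambda>w. f w \<bullet> div2 \<phi> w) \<in> borel_measurable (lebesgue_on U)"
      "(\<lambda>w. g w \<bullet> div2 \<phi> w) \<in> borel_measurable (lebesgue_on U)"
      using m assms by (auto intro: borel_measurable_inner)
    show "AE w in lebesgue_on U. f w \<bullet> div2 \<phi> w = g w \<bullet> div2 \<phi> w"
      using assms(3) by eventually_elim simp
  qed
  with i show ?thesis unfolding tv_def by (auto intro!: SUP_cong)
qed

lemma ennreal_add_le: "ennreal (a + b) \<le> ennreal a + ennreal b"
proof -
  have "ennreal (a + b) \<le> ennreal (max 0 a + max 0 b)" by (intro ennreal_leI) auto
  also have "\<dots> = ennreal a + ennreal b" by (simp add: max_def ennreal_neg)
  finally show ?thesis .
qed

lemma tv_add: "tv U (\<lambda>w. f w + g w) \<le> tv U f + tv U g"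
proof (cases "integrable (lebesgue_on U) f \<and> integrable (lebesgue_on U) g")
  case True
  show ?thesis
  proof (rule tv_least)
    show "integrable (lebesgue_on U) (\<lambda>w. f w + g w)" using True by simp
    fix \<phi> :: "real^2 \<Rightarrow> 'a^2" assume \<phi>: "\<phi> \<in> C1c U" "\<And>w. norm (\<phi> w) \<le> 1"
    have "(LINT w|lebesgue_on U. (f w + g w) \<bullet> div2 \<phi> w)
      = (LINT w|lebesgue_on U. f w \<bullet> div2 \<phi> w) + (LINT w|lebesgue_on U. g w \<bullet> div2 \<phi> w)"
      using True by (simp add: inner_add_left integrable_inner_div2[OF _ \<phi>(1)])
    then have "ennreal (LINT w|lebesgue_on U. (f w + g w) \<bullet> div2 \<phi> w)
      \<le> ennreal (LINT w|lebesgue_on U. f w \<bullet> div2 \<phi> w) + ennreal (LINT w|lebesgue_on U. g w \<bullet> div2 \<phi> w)"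
      by (simp add: ennreal_add_le)
    also have "\<dots> \<le> tv U f + tv U g"
      using True by (intro add_mono tv_upper \<phi>) auto
    finally show "ennreal (LINT w|lebesgue_on U. (f w + g w) \<bullet> div2 \<phi> w) \<le> tv U f + tv U g" .
  qed
qed (auto simp: tv_not_integrable)

text \<open>A linear map acting on the values acts by its adjoint on the test fields.\<close>

lemma tv_linear:
  fixes L :: "'b::euclidean_space \<Rightarrow> 'c::euclidean_space" and L' :: "'c \<Rightarrow> 'b"
  assumes L: "bounded_linear L" "bounded_linear L'" "\<And>x y. L x \<bullet> y = x \<bullet> L' y"
    and K: "K > 0" "\<And>y. norm (L' y) \<le> K * norm y"
  shows "tv U (\<lambda>w. L (f w)) \<le> ennreal K * tv U f"
proof (cases "integrable (lebesgue_on U) f")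
  case True
  show ?thesis
  proof (rule tv_least)
    show "integrable (lebesgue_on U) (\<lambda>w. L (f w))"
      by (rule integrable_bounded_linear[OF L(1) True])
    fix \<phi> :: "real^2 \<Rightarrow> 'c^2" assume \<phi>: "\<phi> \<in> C1c U" "\<And>w. norm (\<phi> w) \<le> 1"
    define \<Lambda> where "\<Lambda> y = (\<chi> k. (1/K) *\<^sub>R L' (y $ k))" for y :: "'c^2"
    define \<psi> where "\<psi> w = \<Lambda> (\<phi> w)" for w
    have lin: "bounded_linear \<Lambda>"
    proof (rule bounded_linear_intro[where K=1])
      show "\<Lambda> (x + y) = \<Lambda> x + \<Lambda> y" for x y
        by (simp add: \<Lambda>_def vec_eq_iff linear_add[OF bounded_linear.linear[OF L(2)]] scaleR_add_right)
      show "\<Lambda> (r *\<^sub>R x) = r *\<^sub>R \<Lambda> x" for r x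
        by (simp add: \<Lambda>_def vec_eq_iff linear_scale[OF bounded_linear.linear[OF L(2)]])
      show "norm (\<Lambda> x) \<le> norm x * 1" for x
        unfolding norm_vec_def \<Lambda>_def mult_1_right
        using K by (intro L2_set_mono) (auto simp: field_simps)
    qed
    have nrm: "norm (\<Lambda> x) \<le> norm x" for x
      unfolding norm_vec_def \<Lambda>_def using K by (intro L2_set_mono) (auto simp: field_simps)
    have z: "\<Lambda> 0 = 0" using linear_0[OF bounded_linear.linear[OF lin]] .
    have s: "supp \<psi> \<subseteq> supp \<phi>"
    proof (rule supp_subset)
      show "w \<in> supp \<phi>" if "\<psi> w \<noteq> 0" for w
        using that z supp_zero[of w \<phi>] by (cases "w \<in> supp \<phi>") (auto simp: \<psi>_def)
    qed simp
    have C1: "Ck_on 1 UNIV \<psi>"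
      unfolding \<psi>_def by (rule Ck_on_linear_compose[OF open_UNIV lin C1c_D(1)[OF \<phi>(1)]])
    have \<psi>: "\<psi> \<in> C1c U"
      using C1 compact_supp_mono[OF C1c_D(2)[OF \<phi>(1)] s] s C1c_D(3)[OF \<phi>(1)] unfolding C1c_def by blast
    have "norm (\<psi> w) \<le> 1" for w using nrm[of "\<phi> w"] \<phi>(2)[of w] by (simp add: \<psi>_def)
    note up = tv_upper[OF True \<psi> this]
    have d: "div2 \<psi> w = (1/K) *\<^sub>R L' (div2 \<phi> w)" for w
    proof -
      have "(\<phi> has_derivative frechet_derivative \<phi> (at w)) (at w)"
        using Ck_on_has_derivative[of 0 UNIV \<phi>] C1c_D(1)[OF \<phi>(1)] by simp
      from frechet_derivative_at[OF bounded_linear.has_derivative[OF lin this]]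
      have "frechet_derivative \<psi> (at w) v = \<Lambda> (frechet_derivative \<phi> (at w) v)" for v
        by (simp add: \<psi>_def[abs_def] fun_eq_iff)
      then show ?thesis
        by (simp add: div2_def \<Lambda>_def linear_sum[OF bounded_linear.linear[OF L(2)]] scaleR_sum_right)
    qed
    have "(LINT w|lebesgue_on U. L (f w) \<bullet> div2 \<phi> w) = K * (LINT w|lebesgue_on U. f w \<bullet> div2 \<psi> w)"
      using K(1) by (simp add: d L(3))
    then have "ennreal (LINT w|lebesgue_on U. L (f w) \<bullet> div2 \<phi> w)
      = ennreal K * ennreal (LINT w|lebesgue_on U. f w \<bullet> div2 \<psi> w)"
      using K(1) by (simp add: ennreal_mult')
    also have "\<dots> \<le> ennreal K * tv U f" by (intro mult_left_mono up) auto
    finally show "ennreal (LINT w|lebesgue_on U. L (f w) \<bullet> div2 \<phi> w) \<le> ennreal K * tv U f" .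
  qed
next
  case False
  then show ?thesis using K(1) by (simp add: tv_not_integrable ennreal_mult_top)
qed

lemma tv_scaleR: "tv U (\<lambda>w. c *\<^sub>R f w) \<le> ennreal \<bar>c\<bar> * tv U f"
proof (cases "c = 0")
  case False
  show ?thesis
    by (rule tv_linear[of "\<lambda>x. c *\<^sub>R x" "\<lambda>x. c *\<^sub>R x"])
       (use False in \<open>auto intro: bounded_linear_scaleR_right\<close>)
qed simp

lemma tv_scaleR_vector:
  fixes f :: "real^2 \<Rightarrow> real" and b :: "'b::euclidean_space"
  shows "tv U (\<lambda>w. f w *\<^sub>R b) \<le> ennreal (norm b) * tv U f"
proof (cases "b = 0")
  case False
  show ?thesis
    by (rule tv_linear[of "\<lambda>x. x *\<^sub>R b" "\<lambda>y. b \<bullet> y"])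
       (use False in \<open>auto intro: bounded_linear_scaleR_left bounded_linear_inner_right
          simp: Cauchy_Schwarz_ineq2\<close>)
qed simp

lemma integral_div2_zero:
  fixes \<phi> :: "real^2 \<Rightarrow> real^2"
  assumes "\<phi> \<in> C1c U" shows "(LINT w|lborel. div2 \<phi> w) = 0"
proof -
  have c1: "Ck_on 1 UNIV (\<lambda>w. \<phi> w $ k)" for k
    by (rule Ck_on_component[OF open_UNIV C1c_D(1)[OF assms]])
  have s: "supp (\<lambda>w. \<phi> w $ k) \<subseteq> supp \<phi>" for k
    by (rule supp_subset) (use supp_zero[of _ \<phi>] in force)+
  have cs: "compact (supp (\<lambda>w. \<phi> w $ k))" for k
    by (rule compact_supp_mono[OF C1c_D(2)[OF assms] s])
  have e: "frechet_derivative \<phi> (at w) v $ k = frechet_derivative (\<lambda>w. \<phi> w $ k) (at w) v" for w v k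
  proof -
    have "(\<phi> has_derivative frechet_derivative \<phi> (at w)) (at w)"
      using Ck_on_has_derivative[of 0 UNIV \<phi>] C1c_D(1)[OF assms] by simp
    from frechet_derivative_at[OF bounded_linear.has_derivative[OF bounded_linear_vec_nth this]]
    show ?thesis by (simp add: fun_eq_iff)
  qed
  have "integrable lborel (\<lambda>w. frechet_derivative (\<lambda>w. \<phi> w $ k) (at w) v)" for k v
    by (rule continuous_supp_integrable[OF _ compact_supp_mono[OF cs supp_deriv_subset]])
       (use c1[of k] in simp)
  then show ?thesis
    using integral_deriv_zero[OF c1 cs] unfolding div2_def[abs_def] e by simp
qed

lemma C1c_scaleR:
  fixes a :: "real^2 \<Rightarrow> real" and \<phi> :: "real^2 \<Rightarrow> real^2"
  assumes "open U" "Ck_on 1 U a" "\<phi> \<in> C1c U"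
  shows "(\<lambda>w. a w *\<^sub>R \<phi> w) \<in> C1c U"
    "w \<in> U \<Longrightarrow> div2 (\<lambda>w. a w *\<^sub>R \<phi> w) w =
      a w * div2 \<phi> w + (\<Sum>k\<in>UNIV. frechet_derivative a (at w) (axis k 1) * \<phi> w $ k)"
proof -
  let ?\<psi> = "\<lambda>w. a w *\<^sub>R \<phi> w"
  have "Ck_on 1 U ?\<psi>"
    by (intro Ck_on_scaleR assms(1,2) Ck_on_subset[OF C1c_D(1)[OF assms(3)]]) simp
  moreover have "Ck_on 1 (- supp \<phi>) ?\<psi>"
    by (rule Ck_on_cong[of _ "\<lambda>w. 0"]) (auto simp: supp_zero intro: Ck_on_const)
  ultimately have "Ck_on 1 (U \<union> - supp \<phi>) ?\<psi>"
    by (intro Ck_on_Un assms(1)) auto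
  moreover have "U \<union> - supp \<phi> = UNIV" using C1c_D(3)[OF assms(3)] by auto
  ultimately have c: "Ck_on 1 UNIV ?\<psi>" by simp
  have s: "supp ?\<psi> \<subseteq> supp \<phi>" by (rule supp_subset) (use supp_zero[of _ \<phi>] in auto)
  show "?\<psi> \<in> C1c U"
    using c compact_supp_mono[OF C1c_D(2)[OF assms(3)] s] s C1c_D(3)[OF assms(3)]
    unfolding C1c_def by blast
  assume w: "w \<in> U"
  have a': "(a has_derivative frechet_derivative a (at w)) (at w)"
    using Ck_on_has_derivative[of 0 U a] assms(2) w by simp
  have \<phi>': "(\<phi> has_derivative frechet_derivative \<phi> (at w)) (at w)"
    using Ck_on_has_derivative[of 0 UNIV \<phi>] C1c_D(1)[OF assms(3)] by simp
  have "frechet_derivative ?\<psi> (at w) v = a w *\<^sub>R frechet_derivative \<phi> (at w) v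
      + frechet_derivative a (at w) v *\<^sub>R \<phi> w" for v
    using fun_cong[OF frechet_derivative_at[OF has_derivative_scaleR[OF a' \<phi>']], of v] by (rule sym)
  then show "div2 ?\<psi> w = a w * div2 \<phi> w + (\<Sum>k\<in>UNIV. frechet_derivative a (at w) (axis k 1) * \<phi> w $ k)"
    by (simp add: div2_def sum.distrib sum_distrib_left)
qed

text \<open>With \<open>T y = sin (e y) / e\<close> and \<open>\<psi> = T' (c) \<phi>\<close>, the functions \<open>T (c) div \<phi>\<close> and \<open>c div \<psi>\<close>
  differ by the divergence of \<open>(T (c) - c T' (c)) \<phi>\<close>, which has integral zero, and \<open>\<psi>\<close> is an admissible
  test field because \<open>\<bar>T'\<bar> \<le> 1\<close>.\<close>

lemma tv_sin_truncation:
  fixes c :: "real^2 \<Rightarrow> real"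
  assumes U: "open U" and c: "Ck_on 1 U c" and e: "e > 0"
  shows "tv U (\<lambda>w. sin (e * c w) / e) \<le> tv U c"
proof (cases "integrable (lebesgue_on U) c")
  case True
  have cm: "c \<in> borel_measurable (lebesgue_on U)" using True by simp
  have T_int: "integrable (lebesgue_on U) (\<lambda>w. sin (e * c w) / e)"
  proof (rule Bochner_Integration.integrable_bound[OF True])
    have "(\<lambda>x. sin (e * x) / e) \<in> borel_measurable borel"
      by (intro borel_measurable_continuous_onI continuous_intros) (use e in auto)
    then show "(\<lambda>w. sin (e * c w) / e) \<in> borel_measurable (lebesgue_on U)"
      using cm by (rule measurable_compose_rev)
    have "\<bar>sin (e * c w)\<bar> \<le> \<bar>e * c w\<bar>" for w by (rule abs_sin_x_le_abs_x)
    then show "AE w in lebesgue_on U. norm (sin (e * c w) / e) \<le> norm (c w)"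
      using e by (intro AE_I2) (auto simp: field_simps abs_mult)
  qed
  have sc: "Ck_on 1 U (\<lambda>w. sin (e * c w))" "Ck_on 1 U (\<lambda>w. cos (e * c w))"
  proof -
    have "Ck_on 1 U (\<lambda>w. e * c w)" by (rule Ck_on_mult[OF U Ck_on_const c])
    note cmp = Ck_on_real_compose[OF U open_UNIV _ this UNIV_I]
    show "Ck_on 1 U (\<lambda>w. sin (e * c w))" "Ck_on 1 U (\<lambda>w. cos (e * c w))"
      using cmp[of sin] cmp[of cos] Ck_on_sin_cos[OF open_UNIV, of 1] by blast+
  qed
  show ?thesis
  proof (rule tv_least[OF T_int])
    fix \<phi> :: "real^2 \<Rightarrow> real^2" assume \<phi>: "\<phi> \<in> C1c U" "\<And>w. norm (\<phi> w) \<le> 1"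
    define \<psi> where "\<psi> w = cos (e * c w) *\<^sub>R \<phi> w" for w
    define a where "a w = (1/e) * sin (e * c w) + (-1) * (c w * cos (e * c w))" for w
    define \<zeta> where "\<zeta> w = a w *\<^sub>R \<phi> w" for w
    have a1: "Ck_on 1 U a"
      unfolding a_def by (intro Ck_on_add Ck_on_mult Ck_on_const c sc U)
    have \<psi>: "\<psi> \<in> C1c U" unfolding \<psi>_def[abs_def] by (rule C1c_scaleR(1)[OF U sc(2) \<phi>(1)])
    have \<zeta>: "\<zeta> \<in> C1c U" unfolding \<zeta>_def[abs_def] by (rule C1c_scaleR(1)[OF U a1 \<phi>(1)])
    have n: "norm (\<psi> w) \<le> 1" for w
      using mult_mono[OF abs_cos_le_one[of "e * c w"] \<phi>(2)[of w]] by (simp add: \<psi>_def)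
    have key: "sin (e * c w) / e * div2 \<phi> w = c w * div2 \<psi> w + div2 \<zeta> w" if w: "w \<in> U" for w
    proof -
      have c': "(c has_derivative frechet_derivative c (at w)) (at w)"
        using Ck_on_has_derivative[of 0 U c] c w by simp
      have "((\<lambda>w. cos (e * c w)) has_derivative
          (\<lambda>v. - (e * sin (e * c w)) * frechet_derivative c (at w) v)) (at w)"
        by (auto intro!: derivative_eq_intros c')
      from fun_cong[OF frechet_derivative_at[OF this], symmetric]
      have dcos: "frechet_derivative (\<lambda>w. cos (e * c w)) (at w) v
          = - (e * sin (e * c w)) * frechet_derivative c (at w) v" for v .
      have "(a has_derivative (\<lambda>v. c w * (e * sin (e * c w)) * frechet_derivative c (at w) v)) (at w)"
        unfolding a_def using e
        by (auto intro!: derivative_eq_intros c' simp: fun_eq_iff algebra_simps)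
      from fun_cong[OF frechet_derivative_at[OF this], symmetric]
      have da: "frechet_derivative a (at w) v
          = c w * (e * sin (e * c w)) * frechet_derivative c (at w) v" for v .
      have s: "(\<Sum>k\<in>UNIV. x * frechet_derivative c (at w) (axis k 1) * \<phi> w $ k)
          = x * (\<Sum>k\<in>UNIV. frechet_derivative c (at w) (axis k 1) * \<phi> w $ k)" for x
        by (simp add: sum_distrib_left mult.assoc)
      show ?thesis
        unfolding \<psi>_def[abs_def] \<zeta>_def[abs_def] C1c_scaleR(2)[OF U sc(2) \<phi>(1) w]
          C1c_scaleR(2)[OF U a1 \<phi>(1) w] dcos da s
        by (simp add: a_def algebra_simps)
    qed
    have "(LINT w|lebesgue_on U. div2 \<zeta> w) = 0"
      using lebesgue_on_integral_eq(1)[OF U div2_measurable[OF \<zeta>]] div2_zero_off_supp[of _ \<zeta>]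
        C1c_D(3)[OF \<zeta>] integral_div2_zero[OF \<zeta>] by fastforce
    moreover have "integrable (lebesgue_on U) (div2 \<zeta>)"
    proof -
      have "integrable lborel (div2 \<zeta>)"
        by (rule continuous_supp_integrable[OF div2_continuous[OF C1c_D(1)[OF \<zeta>]]
              compact_supp_mono[OF C1c_D(2)[OF \<zeta>] supp_div2]])
      then show ?thesis
        using lebesgue_on_integral_eq(2)[OF U div2_measurable[OF \<zeta>]] div2_zero_off_supp[of _ \<zeta>]
          C1c_D(3)[OF \<zeta>] by blast
    qed
    moreover have "integrable (lebesgue_on U) (\<lambda>w. c w * div2 \<psi> w)"
      using integrable_inner_div2[OF True \<psi>] by simp
    moreover have "(LINT w|lebesgue_on U. sin (e * c w) / e * div2 \<phi> w)
        = (LINT w|lebesgue_on U. c w * div2 \<psi> w + div2 \<zeta> w)"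
      by (rule Bochner_Integration.integral_cong) (use key in auto)
    ultimately have "(LINT w|lebesgue_on U. sin (e * c w) / e * div2 \<phi> w)
        = (LINT w|lebesgue_on U. c w * div2 \<psi> w)" by simp
    then show "ennreal (LINT w|lebesgue_on U. (sin (e * c w) / e) \<bullet> div2 \<phi> w) \<le> tv U c"
      using tv_upper[OF True \<psi> n] by simp
  qed
qed (simp add: tv_not_integrable)

section \<open>Measurable dependence of the sliced total variation\<close>

text \<open>The first set in the list that contains the point determines the value. Taking the sets from a
  countable base and the values from a countable dense set leaves only countably many functions.\<close>

definition step_fun :: "('a set \<times> 'b::zero) list \<Rightarrow> 'a \<Rightarrow> 'b" where
  "step_fun l w = (case find (\<lambda>(B, y). w \<in> B) l of None \<Rightarrow> 0 | Some (B, y) \<Rightarrow> y)"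

text \<open>The support of \<open>g\<close> is covered by finitely many base sets on which \<open>g\<close> is almost constant.\<close>

lemma countable_uniform_approximants:
  obtains P :: "('a::second_countable_topology \<Rightarrow> 'b::euclidean_space) set" where
    "countable P"
    "\<And>g \<epsilon>. continuous_on UNIV g \<Longrightarrow> compact (supp g) \<Longrightarrow> \<epsilon> > 0 \<Longrightarrow> \<exists>p\<in>P. \<forall>w. norm (g w - p w) < \<epsilon>"
proof -
  obtain \<B> :: "'a set set" where \<B>: "countable \<B>" "topological_basis \<B>"
    using ex_countable_basis by blast
  obtain D :: "'b set" where D: "countable D" "\<And>X. open X \<Longrightarrow> X \<noteq> {} \<Longrightarrow> \<exists>d\<in>D. d \<in> X"
    using countable_dense_setE by blast
  show thesis
  proof (rule that[of "step_fun ` lists (\<B> \<times> D)"])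
    show "countable (step_fun ` lists (\<B> \<times> D))"
      using \<B>(1) D(1) by (intro countable_image countable_lists countable_SIGMA)
  next
    fix g :: "'a \<Rightarrow> 'b" and \<epsilon> :: real
    assume g: "continuous_on UNIV g" "compact (supp g)" and \<epsilon>: "\<epsilon> > 0"
    define Q where "Q = {(B, y) \<in> \<B> \<times> D. \<forall>w\<in>B. norm (g w - y) < \<epsilon>}"
    have cover: "supp g \<subseteq> (\<Union>q\<in>Q. fst q)"
    proof
      fix x assume "x \<in> supp g"
      have "open (g -` ball (g x) (\<epsilon>/2))"
        by (rule open_vimage[OF open_ball g(1)])
      moreover have "x \<in> g -` ball (g x) (\<epsilon>/2)" using \<epsilon> by simp
      ultimately obtain B where B: "B \<in> \<B>" "x \<in> B" "B \<subseteq> g -` ball (g x) (\<epsilon>/2)"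
        using topological_basisE[OF \<B>(2)] by metis
      obtain y where y: "y \<in> D" "y \<in> ball (g x) (\<epsilon>/2)"
        using D(2)[of "ball (g x) (\<epsilon>/2)"] \<epsilon> by auto
      have "norm (g w - y) < \<epsilon>" if "w \<in> B" for w
      proof -
        have "dist (g x) (g w) < \<epsilon>/2" using B(3) that by auto
        moreover have "dist (g x) y < \<epsilon>/2" using y(2) by simp
        ultimately have "dist (g w) y < \<epsilon>" using dist_triangle_half_r by blast
        then show ?thesis by (simp add: dist_norm)
      qed
      then have "(B, y) \<in> Q" using B y by (auto simp: Q_def)
      then show "x \<in> (\<Union>q\<in>Q. fst q)" using B(2) by force
    qed
    have "\<And>q. q \<in> Q \<Longrightarrow> open (fst q)"
      using topological_basis_open[OF \<B>(2)] by (auto simp: Q_def)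
    then obtain Q' where Q': "Q' \<subseteq> Q" "finite Q'" "supp g \<subseteq> (\<Union>q\<in>Q'. fst q)"
      using compactE_image[OF g(2), of Q fst] cover by metis
    obtain l where l: "set l = Q'" using finite_list[OF Q'(2)] by blast
    have "norm (g w - step_fun l w) < \<epsilon>" for w
    proof (cases "find (\<lambda>(B, y). w \<in> B) l")
      case None
      then have "w \<notin> supp g" using Q'(3) l by (force simp: find_None_iff)
      then show ?thesis using None \<epsilon> by (simp add: step_fun_def supp_zero)
    next
      case (Some q)
      have "find R xs = Some z \<Longrightarrow> z \<in> set xs \<and> R z" for R and xs :: "('a set \<times> 'b) list" and z
        by (auto simp: find_Some_iff)
      from this[OF Some] have "q \<in> Q" "w \<in> fst q" using l Q'(1) by (auto simp: case_prod_beta)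
      then show ?thesis using Some by (auto simp: step_fun_def Q_def split: prod.splits)
    qed
    moreover have "l \<in> lists (\<B> \<times> D)" using l Q'(1) by (auto simp: Q_def)
    ultimately show "\<exists>p\<in>step_fun ` lists (\<B> \<times> D). \<forall>w. norm (g w - p w) < \<epsilon>" by blast
  qed
qed

text \<open>One field is chosen for each member of a countable family of open sets that contains its
  support, each approximant of its divergence and each accuracy. The uniform distance of the divergences
  controls the integrals against an integrable function.\<close>

lemma countable_test_fields:
  obtains \<D> :: "(real^2 \<Rightarrow> ('b::euclidean_space)^2) set" where
    "countable \<D>"
    "\<And>\<phi>. \<phi> \<in> \<D> \<Longrightarrow> \<phi> \<in> C1c UNIV \<and> (\<forall>w. norm (\<phi> w) \<le> 1)"
    "\<And>U \<phi> \<epsilon>. open U \<Longrightarrow> \<phi> \<in> C1c U \<Longrightarrow> (\<forall>w. norm (\<phi> w) \<le> 1) \<Longrightarrow> \<epsilon> > 0 \<Longrightarrow>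
       \<exists>\<phi>'\<in>\<D>. supp \<phi>' \<subseteq> U \<and> (\<forall>w. norm (div2 \<phi> w - div2 \<phi>' w) \<le> \<epsilon>)"
proof -
  obtain P :: "(real^2 \<Rightarrow> 'b) set" where P: "countable P"
    "\<And>g \<epsilon>. continuous_on UNIV g \<Longrightarrow> compact (supp g) \<Longrightarrow> \<epsilon> > 0 \<Longrightarrow> \<exists>p\<in>P. \<forall>w. norm (g w - p w) < \<epsilon>"
    using countable_uniform_approximants by blast
  obtain \<B> :: "(real^2) set set" where \<B>: "countable \<B>" "topological_basis \<B>"
    using ex_countable_basis by blast
  define \<V> where "\<V> = Union ` {F. finite F \<and> F \<subseteq> \<B>}"
  have \<V>: "countable \<V>"
    unfolding \<V>_def using \<B>(1) by (intro countable_image countable_Collect_finite_subset)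
  define good where "good V p k \<phi> \<longleftrightarrow> \<phi> \<in> C1c V \<and> (\<forall>w. norm (\<phi> w) \<le> 1) \<and>
      (\<forall>w. norm (div2 \<phi> w - p w) < 1 / real (Suc k))" for V p k and \<phi> :: "real^2 \<Rightarrow> 'b^2"
  define sel where "sel = (\<lambda>(V, p, k). SOME \<phi>. good V p k \<phi>)"
  define I where "I = {(V, p, k) \<in> \<V> \<times> P \<times> (UNIV::nat set). \<exists>\<phi>. good V p k \<phi>}"
  have sel: "good V p k (sel (V, p, k))" if "(V, p, k) \<in> I" for V p k
  proof -
    have "\<exists>\<phi>. good V p k \<phi>" using that by (simp add: I_def)
    from someI_ex[OF this] show ?thesis by (simp add: sel_def)
  qed
  show thesis
  proof (rule that[of "sel ` I"])
    have "countable (\<V> \<times> P \<times> (UNIV::nat set))" using \<V> P(1) by (intro countable_SIGMA) auto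
    moreover have "I \<subseteq> \<V> \<times> P \<times> UNIV" by (auto simp: I_def)
    ultimately have "countable I" by (rule countable_subset[rotated])
    then show "countable (sel ` I)" by (rule countable_image)
    show "\<phi> \<in> C1c UNIV \<and> (\<forall>w. norm (\<phi> w) \<le> 1)" if "\<phi> \<in> sel ` I" for \<phi>
      using that sel by (force simp: good_def C1c_def)
    fix U \<epsilon> and \<phi> :: "real^2 \<Rightarrow> 'b^2"
    assume U: "open U" and \<phi>: "\<phi> \<in> C1c U" "\<forall>w. norm (\<phi> w) \<le> 1" and \<epsilon>: "\<epsilon> > (0::real)"
    have "\<exists>V\<in>\<V>. supp \<phi> \<subseteq> V \<and> V \<subseteq> U"
    proof -
      have sub: "supp \<phi> \<subseteq> (\<Union>B\<in>{B\<in>\<B>. B \<subseteq> U}. B)"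
      proof
        fix x assume "x \<in> supp \<phi>"
        then have "x \<in> U" using C1c_D(3)[OF \<phi>(1)] by blast
        then show "x \<in> (\<Union>B\<in>{B\<in>\<B>. B \<subseteq> U}. B)" using topological_basisE[OF \<B>(2) U] by blast
      qed
      obtain F where F: "F \<subseteq> {B\<in>\<B>. B \<subseteq> U}" "finite F" "supp \<phi> \<subseteq> (\<Union>B\<in>F. B)"
        by (rule compactE_image[OF C1c_D(2)[OF \<phi>(1)] _ sub])
           (use topological_basis_open[OF \<B>(2)] in auto)
      then show ?thesis by (intro bexI[of _ "\<Union>F"]) (auto simp: \<V>_def)
    qed
    then obtain V where V: "V \<in> \<V>" "supp \<phi> \<subseteq> V" "V \<subseteq> U" by blast
    obtain k where k: "1 / real (Suc k) < \<epsilon>/2"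
      using \<epsilon> nat_approx_posE[of "\<epsilon>/2"] by auto
    obtain p where p: "p \<in> P" "\<forall>w. norm (div2 \<phi> w - p w) < 1 / real (Suc k)"
      using P(2)[OF div2_continuous[OF C1c_D(1)[OF \<phi>(1)]]
          compact_supp_mono[OF C1c_D(2)[OF \<phi>(1)] supp_div2], of "1 / real (Suc k)"] by auto
    have "good V p k \<phi>" using \<phi> V(2) p(2) by (auto simp: good_def C1c_def)
    then have I: "(V, p, k) \<in> I" using V(1) p(1) by (auto simp: I_def)
    let ?\<phi> = "sel (V, p, k)"
    have "norm (div2 \<phi> w - div2 ?\<phi> w) \<le> \<epsilon>" for w
    proof -
      have "norm (div2 \<phi> w - div2 ?\<phi> w) \<le> norm (div2 \<phi> w - p w) + norm (div2 ?\<phi> w - p w)"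
        using norm_triangle_ineq4[of "div2 \<phi> w - p w" "div2 ?\<phi> w - p w"] by simp
      moreover have "norm (div2 \<phi> w - p w) < 1 / real (Suc k)" using p(2) by blast
      moreover have "norm (div2 ?\<phi> w - p w) < 1 / real (Suc k)"
        using sel[OF I] unfolding good_def by blast
      ultimately show ?thesis using k by linarith
    qed
    moreover have "supp ?\<phi> \<subseteq> U" using sel[OF I] V(3) C1c_D(3) unfolding good_def by blast
    ultimately show "\<exists>\<phi>'\<in>sel ` I. supp \<phi>' \<subseteq> U \<and> (\<forall>w. norm (div2 \<phi> w - div2 \<phi>' w) \<le> \<epsilon>)"
      using I by blast
  qed
qed

lemma plane_point_continuous: "continuous_on UNIV (\<lambda>(t, w). plane_point S j t w)"
  unfolding plane_point_def case_prod_beta by (intro continuous_intros)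

lemma plane_point_continuous_slice: "continuous_on UNIV (plane_point S j t)"
  unfolding plane_point_def[abs_def] by (intro continuous_intros)

lemma plane_point_measurable [measurable]:
  "(\<lambda>(t, w). plane_point S j t w) \<in> lborel \<Otimes>\<^sub>M lborel \<rightarrow>\<^sub>M borel"
  using borel_measurable_continuous_onI[OF plane_point_continuous] unfolding lborel_prod by simp

lemma plane_point_affine: "plane_point S j t w = t *\<^sub>R normal S j +
    ((w $ 1) *\<^sub>R dir_y S j + (w $ 2) *\<^sub>R dir_z S j)"
  by (simp add: plane_point_def)

lemma bounded_linear_plane: "bounded_linear (\<lambda>w::real^2. (w $ 1) *\<^sub>R a + (w $ 2) *\<^sub>R b)"
  by (intro bounded_linear_add bounded_linear_scaleR_const bounded_linear_vec_nth)

lemma open_planar_slice: "open U \<Longrightarrow> open (planar_slice S j U t)"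
  using open_vimage[OF _ plane_point_continuous_slice, of U]
  by (simp add: planar_slice_def vimage_def)

lemma open_slices_containing_compact:
  assumes "open U" "compact K" shows "open {t. K \<subseteq> planar_slice S j U t}"
proof (rule openI)
  fix t0 assume "t0 \<in> {t. K \<subseteq> planar_slice S j U t}"
  then have "{t0} \<times> K \<subseteq> (\<lambda>(t, w). plane_point S j t w) -` U" by (auto simp: planar_slice_def)
  then obtain T where T: "t0 \<in> T" "open T" "T \<times> K \<subseteq> (\<lambda>(t, w). plane_point S j t w) -` U"
    using Elementary_Topology.tube_lemma[OF assms(2) open_vimage[OF assms(1) plane_point_continuous]] by metis
  then have "T \<subseteq> {t. K \<subseteq> planar_slice S j U t}" by (auto simp: planar_slice_def)
  with T show "\<exists>e>0. ball t0 e \<subseteq> {t. K \<subseteq> planar_slice S j U t}"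
    by (meson open_contains_ball order_trans)
qed

text \<open>Orthonormal coordinates map null sets to null sets, so that Fubini's theorem applies to the
  product of the normal direction and the plane.\<close>

lemma AE_slices:
  assumes S: "valid_slip_system S" "j \<in> {1..num_slips S}"
    and Q: "AE x in lborel. Q x"
  shows "AE t in lborel. AE w in lborel. Q (plane_point S j t w)"
proof -
  define \<Psi> :: "real^3 \<Rightarrow> real \<times> (real^2)" where
    "\<Psi> x = (x \<bullet> normal S j, \<chi> k. if k = 1 then x \<bullet> dir_y S j else x \<bullet> dir_z S j)" for x
  have o: "normal S j \<bullet> normal S j = 1" "dir_y S j \<bullet> dir_y S j = 1" "dir_z S j \<bullet> dir_z S j = 1"
    "dir_y S j \<bullet> dir_z S j = 0" "dir_z S j \<bullet> dir_y S j = 0"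
    "dir_y S j \<bullet> normal S j = 0" "dir_z S j \<bullet> normal S j = 0"
    "normal S j \<bullet> dir_y S j = 0" "normal S j \<bullet> dir_z S j = 0"
    using S unfolding valid_slip_system_def by (auto simp: inner_commute norm_eq_1)
  have inv: "\<Psi> (plane_point S j t w) = (t, w)" for t w
  proof -
    have "k = 1 \<or> k = 2" for k :: 2 using exhaust_2 by blast
    then show ?thesis
      by (auto simp: \<Psi>_def plane_point_def inner_add_left o vec_eq_iff)
  qed
  have lin: "linear \<Psi>"
    by (rule linearI) (auto simp: \<Psi>_def inner_add_left vec_eq_iff)
  obtain N where N: "N \<in> null_sets lborel" "{x. \<not> Q x} \<subseteq> N"
    using Q by (auto elim!: AE_E simp: null_sets_def)
  have "negligible N" using N(1) by (auto simp: negligible_iff_null_sets intro: null_sets_completionI)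
  then have "negligible (\<Psi> ` N)"
    by (rule negligible_differentiable_image_negligible[rotated])
       (auto intro!: linear_imp_differentiable_on lin)
  then have "AE p in lebesgue. p \<notin> \<Psi> ` N" by (intro AE_not_in) (simp add: negligible_iff_null_sets)
  then have "AE p in lborel. p \<notin> \<Psi> ` N" by (simp add: AE_completion_iff)
  then have "AE p in lborel. Q (plane_point S j (fst p) (snd p))"
  proof eventually_elim
    case (elim p)
    have "\<Psi> (plane_point S j (fst p) (snd p)) = p" using inv by simp
    then have "plane_point S j (fst p) (snd p) \<notin> N" using elim by (metis imageI)
    then show ?case using N(2) by blast
  qed
  then have "AE p in lborel \<Otimes>\<^sub>M lborel. Q (plane_point S j (fst p) (snd p))"
    unfolding lborel_prod .
  from lborel_pair.AE_pair[OF this] show ?thesis by simp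
qed

lemma lebesgue_ex_borel:
  fixes f :: "'a::euclidean_space \<Rightarrow> 'b::euclidean_space"
  assumes "f \<in> borel_measurable lebesgue"
  shows "\<exists>g\<in>borel_measurable lborel. AE x in lborel. f x = g x"
proof -
  have "\<exists>g\<in>borel_measurable lborel. AE x in lborel. f x \<bullet> b = g x" for b
    by (rule completion_ex_borel_measurable_real) (use assms in measurable)
  then obtain g where g: "\<And>b. g b \<in> borel_measurable lborel" "\<And>b. AE x in lborel. f x \<bullet> b = g b x"
    by metis
  have "AE x in lborel. \<forall>b\<in>Basis. f x \<bullet> b = g b x"
    using g(2) by (intro AE_finite_allI) auto
  then have "AE x in lborel. f x = (\<Sum>b\<in>Basis. g b x *\<^sub>R b)"
    by eventually_elim (use euclidean_representation in \<open>metis (no_types, lifting) sum.cong\<close>)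
  moreover have "(\<lambda>x. \<Sum>b\<in>Basis. g b x *\<^sub>R b) \<in> borel_measurable lborel"
    using g(1) by (intro borel_measurable_sum borel_measurable_scaleR) auto
  ultimately show ?thesis by (rule bexI)
qed

text \<open>By \<open>countable_test_fields\<close> the total variation on a slice is a supremum of countably many integrals,
  each of which depends measurably on the slice. A test field contributes on those slices that contain its support;
  they form an open set of parameters \<open>t\<close>.\<close>

lemma slice_tv_borel:
  fixes g :: "real^3 \<Rightarrow> 'b::euclidean_space"
  assumes U: "open U" and g: "g \<in> borel_measurable borel"
  shows "(\<lambda>t. tv (planar_slice S j U t) (\<lambda>w. g (plane_point S j t w))) \<in> borel_measurable lborel"
proof -
  let ?P = "plane_point S j"
  obtain \<D> :: "(real^2 \<Rightarrow> 'b^2) set" where \<D>: "countable \<D>"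
    "\<And>\<phi>. \<phi> \<in> \<D> \<Longrightarrow> \<phi> \<in> C1c UNIV \<and> (\<forall>w. norm (\<phi> w) \<le> 1)"
    "\<And>U \<phi> \<epsilon>. open U \<Longrightarrow> \<phi> \<in> C1c U \<Longrightarrow> (\<forall>w. norm (\<phi> w) \<le> 1) \<Longrightarrow> \<epsilon> > 0 \<Longrightarrow>
       \<exists>\<phi>'\<in>\<D>. supp \<phi>' \<subseteq> U \<and> (\<forall>w. norm (div2 \<phi> w - div2 \<phi>' w) \<le> \<epsilon>)"
    using countable_test_fields by blast
  define V where "V t = planar_slice S j U t" for t
  define h where "h t w = indicator U (?P t w) *\<^sub>R g (?P t w)" for t w
  define J where "J \<phi> t = (if t \<in> {t. supp \<phi> \<subseteq> V t} then ennreal (LINT w|lborel. h t w \<bullet> div2 \<phi> w) else 0)"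
    for \<phi> t
  have Vo: "open (V t)" for t using open_planar_slice[OF U] by (simp add: V_def)
  have h_ind: "h t w = indicator (V t) w *\<^sub>R g (?P t w)" for t w
    by (simp add: h_def V_def planar_slice_def indicator_def)
  have P_t: "?P t \<in> borel_measurable borel" for t
    by (rule borel_measurable_continuous_onI[OF plane_point_continuous_slice])
  have gP: "(\<lambda>w. g (?P t w)) \<in> borel_measurable borel" for t
    using measurable_compose[OF P_t g] .
  have h_t: "h t \<in> borel_measurable borel" for t
    unfolding h_ind[abs_def]
    by (intro borel_measurable_scaleR borel_measurable_indicator gP borel_open Vo)
  have h_pair: "(\<lambda>p. h (fst p) (snd p)) \<in> borel_measurable (lborel \<Otimes>\<^sub>M lborel)"
  proof -
    have m: "(\<lambda>p. ?P (fst p) (snd p)) \<in> lborel \<Otimes>\<^sub>M lborel \<rightarrow>\<^sub>M borel"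
      using plane_point_measurable[of S j] by (simp add: case_prod_beta')
    have "(\<lambda>x. indicator U x *\<^sub>R g x) \<in> borel_measurable borel"
      by (intro borel_measurable_scaleR borel_measurable_indicator g borel_open U)
    from measurable_compose[OF m this] show ?thesis unfolding h_def .
  qed
  have int_iff: "integrable (lebesgue_on (V t)) (\<lambda>w. g (?P t w)) \<longleftrightarrow> (\<integral>\<^sup>+w. ennreal (norm (h t w)) \<partial>lborel) < \<infinity>" for t
  proof -
    have "integrable (lebesgue_on (V t)) (\<lambda>w. g (?P t w)) \<longleftrightarrow> integrable lebesgue (h t)"
      unfolding h_ind[abs_def] by (rule integrable_restrict_space) (use Vo[of t] in auto)
    also have "\<dots> \<longleftrightarrow> integrable lborel (h t)"
      by (rule integrable_completion) (use h_t[of t] in simp)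
    also have "\<dots> \<longleftrightarrow> (\<integral>\<^sup>+w. ennreal (norm (h t w)) \<partial>lborel) < \<infinity>"
      using h_t[of t] by (simp add: integrable_iff_bounded)
    finally show ?thesis .
  qed
  have int_eq: "(LINT w|lebesgue_on (V t). g (?P t w) \<bullet> d w) = (LINT w|lborel. h t w \<bullet> d w)"
    if "d \<in> borel_measurable borel" for t d
  proof -
    have "(LINT w|lebesgue_on (V t). g (?P t w) \<bullet> d w) = (LINT w|lebesgue. indicator (V t) w *\<^sub>R (g (?P t w) \<bullet> d w))"
      by (rule integral_restrict_space) (use Vo[of t] in auto)
    also have "\<dots> = (LINT w|lebesgue. h t w \<bullet> d w)" by (simp add: h_ind)
    also have "\<dots> = (LINT w|lborel. h t w \<bullet> d w)"
      by (rule integral_completion) (use h_t[of t] that in measurable)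
    finally show ?thesis .
  qed
  have eq: "tv (V t) (\<lambda>w. g (?P t w)) = (if (\<integral>\<^sup>+w. ennreal (norm (h t w)) \<partial>lborel) < \<infinity> then SUP \<phi>\<in>\<D>. J \<phi> t else \<infinity>)" for t
  proof (cases "integrable (lebesgue_on (V t)) (\<lambda>w. g (?P t w))")
    case int: True
    have hi: "integrable lborel (h t)"
      using int h_t[of t] unfolding int_iff by (simp add: integrable_iff_bounded)
    have "tv (V t) (\<lambda>w. g (?P t w)) \<le> (SUP \<phi>\<in>\<D>. J \<phi> t)"
    proof (rule tv_least[OF int])
      fix \<phi> :: "real^2 \<Rightarrow> 'b^2" assume \<phi>: "\<phi> \<in> C1c (V t)" "\<And>w. norm (\<phi> w) \<le> 1"
      show "ennreal (LINT w|lebesgue_on (V t). g (?P t w) \<bullet> div2 \<phi> w) \<le> (SUP \<phi>\<in>\<D>. J \<phi> t)"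
      proof (rule ennreal_le_epsilon)
        fix e :: real assume e: "0 < e"
        define A where "A = (LINT w|lborel. norm (h t w))"
        have A: "A \<ge> 0" by (simp add: A_def)
        obtain \<phi>' where \<phi>': "\<phi>' \<in> \<D>" "supp \<phi>' \<subseteq> V t" "\<forall>w. norm (div2 \<phi> w - div2 \<phi>' w) \<le> e / (A + 1)"
          using \<D>(3)[OF Vo[of t] \<phi>(1), of "e / (A + 1)"] \<phi>(2) e A by auto
        have \<phi>'C: "\<phi>' \<in> C1c UNIV" using \<D>(2)[OF \<phi>'(1)] by blast
        have i: "integrable lborel (\<lambda>w. h t w \<bullet> div2 \<psi> w)" if "\<psi> \<in> C1c X" for \<psi> :: "real^2 \<Rightarrow> 'b^2" and X
        proof -
          have "integrable lebesgue (h t)" using hi h_t[of t] by (subst integrable_completion) auto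
          then have "integrable lebesgue (\<lambda>w. h t w \<bullet> div2 \<psi> w)"
            using integrable_inner_div2[of UNIV "h t" \<psi>] that by (simp add: lebesgue_on_UNIV_eq)
          then show ?thesis
            using h_t[of t] div2_measurable[OF that] by (subst (asm) integrable_completion) auto
        qed
        have "(LINT w|lborel. h t w \<bullet> div2 \<phi> w) - (LINT w|lborel. h t w \<bullet> div2 \<phi>' w)
            = (LINT w|lborel. h t w \<bullet> (div2 \<phi> w - div2 \<phi>' w))"
          using i[OF \<phi>(1)] i[OF \<phi>'C] by (simp add: inner_diff_right)
        also have "\<dots> \<le> (LINT w|lborel. norm (h t w) * (e / (A + 1)))"
        proof (rule integral_mono)
          show "integrable lborel (\<lambda>w. h t w \<bullet> (div2 \<phi> w - div2 \<phi>' w))"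
            using i[OF \<phi>(1)] i[OF \<phi>'C] by (simp add: inner_diff_right)
          show "integrable lborel (\<lambda>w. norm (h t w) * (e / (A + 1)))" using hi by simp
          show "h t w \<bullet> (div2 \<phi> w - div2 \<phi>' w) \<le> norm (h t w) * (e / (A + 1))" for w
            using norm_cauchy_schwarz[of "h t w" "div2 \<phi> w - div2 \<phi>' w"]
              mult_left_mono[OF \<phi>'(3)[rule_format, of w] norm_ge_zero[of "h t w"]] by linarith
        qed
        also have "\<dots> = A * (e / (A + 1))" by (simp add: A_def)
        also have "\<dots> \<le> e" using A e by (simp add: field_simps)
        finally have "(LINT w|lborel. h t w \<bullet> div2 \<phi> w) \<le> (LINT w|lborel. h t w \<bullet> div2 \<phi>' w) + e"
          by simp
        then have "ennreal (LINT w|lborel. h t w \<bullet> div2 \<phi> w)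
            \<le> ennreal ((LINT w|lborel. h t w \<bullet> div2 \<phi>' w) + e)"
          by (rule ennreal_leI)
        also have "\<dots> \<le> ennreal (LINT w|lborel. h t w \<bullet> div2 \<phi>' w) + ennreal e" by (rule ennreal_add_le)
        also have "ennreal (LINT w|lborel. h t w \<bullet> div2 \<phi>' w) = J \<phi>' t" using \<phi>'(2) by (simp add: J_def)
        also have "J \<phi>' t + ennreal e \<le> (SUP \<phi>\<in>\<D>. J \<phi> t) + ennreal e"
          by (intro add_right_mono SUP_upper \<phi>'(1))
        finally show "ennreal (LINT w|lebesgue_on (V t). g (?P t w) \<bullet> div2 \<phi> w)
            \<le> (SUP \<phi>\<in>\<D>. J \<phi> t) + ennreal e"
          by (simp add: int_eq[OF div2_measurable[OF \<phi>(1)]])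
      qed
    qed
    moreover have "(SUP \<phi>\<in>\<D>. J \<phi> t) \<le> tv (V t) (\<lambda>w. g (?P t w))"
    proof (rule SUP_least)
      fix \<phi> assume \<phi>: "\<phi> \<in> \<D>"
      have C: "\<phi> \<in> C1c UNIV" and n: "\<And>w. norm (\<phi> w) \<le> 1" using \<D>(2)[OF \<phi>] by auto
      show "J \<phi> t \<le> tv (V t) (\<lambda>w. g (?P t w))"
      proof (cases "supp \<phi> \<subseteq> V t")
        case True
        then have "\<phi> \<in> C1c (V t)" using C by (auto simp: C1c_def)
        from tv_upper[OF int this n] show ?thesis
          using True by (simp add: J_def int_eq[OF div2_measurable[OF C]])
      qed (simp add: J_def)
    qed
    ultimately show ?thesis using int unfolding int_iff by (auto intro: antisym)
  next
    case False
    then show ?thesis using int_iff[of t] by (simp add: tv_not_integrable)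
  qed
  have nm: "(\<lambda>t. \<integral>\<^sup>+w. ennreal (norm (h t w)) \<partial>lborel) \<in> borel_measurable lborel"
    by (rule lborel.borel_measurable_nn_integral) (use h_pair in \<open>simp add: case_prod_beta'\<close>)
  have Jm: "J \<phi> \<in> borel_measurable lborel" if "\<phi> \<in> \<D>" for \<phi>
  proof -
    have C: "\<phi> \<in> C1c UNIV" using \<D>(2)[OF that] by blast
    have d: "(\<lambda>p. div2 \<phi> (snd p)) \<in> borel_measurable (lborel \<Otimes>\<^sub>M lborel)"
      using div2_measurable[OF C] by (intro measurable_compose[OF measurable_snd]) simp
    have "(\<lambda>t. LINT w|lborel. h t w \<bullet> div2 \<phi> w) \<in> borel_measurable lborel"
      by (rule lborel.borel_measurable_lebesgue_integral)
         (use borel_measurable_inner[OF h_pair d] in \<open>simp add: case_prod_beta'\<close>)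
    moreover have "{t. supp \<phi> \<subseteq> V t} \<in> sets lborel"
      using open_slices_containing_compact[OF U C1c_D(2)[OF C]] by (simp add: V_def)
    ultimately show ?thesis unfolding J_def[abs_def] by measurable
  qed
  have "(\<lambda>t. SUP \<phi>\<in>\<D>. J \<phi> t) \<in> borel_measurable lborel"
    by (rule borel_measurable_SUP[OF \<D>(1) Jm])
  then show ?thesis
    using nm unfolding V_def[symmetric] eq by measurable
qed

text \<open>A Lebesgue measurable function agrees with a Borel function almost everywhere, and therefore
  almost everywhere on almost every slice.\<close>

lemma slice_tv_ae_borel:
  fixes f :: "real^3 \<Rightarrow> 'b::euclidean_space"
  assumes S: "valid_slip_system S" "j \<in> {1..num_slips S}" and U: "open U"
    and f: "f \<in> borel_measurable (lebesgue_on U)"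
  shows "\<exists>G\<in>borel_measurable lborel. AE t in lborel.
    tv (planar_slice S j U t) (\<lambda>w. f (plane_point S j t w)) = G t"
proof -
  let ?P = "plane_point S j"
  have "(\<lambda>x. indicator U x *\<^sub>R f x) \<in> borel_measurable lebesgue"
    using f U by (subst (asm) borel_measurable_restrict_space_iff) auto
  then obtain g where g: "g \<in> borel_measurable lborel" "AE x in lborel. indicator U x *\<^sub>R f x = g x"
    using lebesgue_ex_borel by blast
  have gb: "g \<in> borel_measurable borel" using g(1) by simp
  have "AE t in lborel. AE w in lborel. indicator U (?P t w) *\<^sub>R f (?P t w) = g (?P t w)"
    by (rule AE_slices[OF S g(2)])
  then have "AE t in lborel. tv (planar_slice S j U t) (\<lambda>w. f (?P t w))
      = tv (planar_slice S j U t) (\<lambda>w. g (?P t w))"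
  proof eventually_elim
    case (elim t)
    define V where "V = planar_slice S j U t"
    have Vo: "open V" using open_planar_slice[OF U] by (simp add: V_def)
    have P_t: "?P t \<in> borel_measurable borel"
      by (rule borel_measurable_continuous_onI[OF plane_point_continuous_slice])
    have gl: "(\<lambda>w. g (?P t w)) \<in> borel_measurable lebesgue"
      using measurable_compose[OF P_t gb] by (intro measurable_completion) simp
    have ae: "AE w in lebesgue. g (?P t w) = indicator V w *\<^sub>R f (?P t w)"
      unfolding AE_completion_iff using elim
      by eventually_elim (simp add: V_def planar_slice_def indicator_def)
    have "(\<lambda>w. indicator V w *\<^sub>R f (?P t w)) \<in> borel_measurable lebesgue"
      by (rule borel_measurable_AE[OF gl ae])
    then have fm: "(\<lambda>w. f (?P t w)) \<in> borel_measurable (lebesgue_on V)"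
      using Vo by (subst borel_measurable_restrict_space_iff) auto
    have gm: "(\<lambda>w. g (?P t w)) \<in> borel_measurable (lebesgue_on V)"
      using gl by (rule measurable_restrict_space1)
    have "AE w in lebesgue_on V. f (?P t w) = g (?P t w)"
      using ae Vo by (subst AE_restrict_space_iff) (auto elim!: eventually_mono)
    from tv_cong_AE[OF fm gm this] show ?case by (simp add: V_def)
  qed
  then show ?thesis by (rule bexI[OF _ slice_tv_borel[OF U gb]])
qed

section \<open>Algebra of slip systems\<close>

lemma tensor_zero [simp]: "0 \<otimes>\<^sub>v m = 0"
  by (simp add: tensor_def vec_eq_iff)

lemma tensor_add: "(a + b) \<otimes>\<^sub>v m = a \<otimes>\<^sub>v m + b \<otimes>\<^sub>v m"
  by (simp add: tensor_def vec_eq_iff distrib_right)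

lemma tensor_scaleR: "(c *\<^sub>R a) \<otimes>\<^sub>v m = c *\<^sub>R (a \<otimes>\<^sub>v m)"
  by (simp add: tensor_def vec_eq_iff)

lemma tensor_diff: "(a - b) \<otimes>\<^sub>v m = a \<otimes>\<^sub>v m - b \<otimes>\<^sub>v m"
  by (simp add: tensor_def vec_eq_iff left_diff_distrib)

lemma tensor_mult_vec: "(a \<otimes>\<^sub>v m) *v v = (m \<bullet> v) *\<^sub>R a"
  by (simp add: tensor_def vec_eq_iff matrix_vector_mult_def inner_vec_def sum_distrib_left mult_ac)

lemma norm_matrix_square: "(norm (A::real^'n^'m))\<^sup>2 = (\<Sum>i\<in>UNIV. \<Sum>k\<in>UNIV. (A $ i $ k)\<^sup>2)"
  unfolding power2_norm_eq_inner inner_vec_def by (simp add: power2_eq_square)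

lemma norm_vec_square: "(norm (v::real^'n))\<^sup>2 = (\<Sum>i\<in>UNIV. (v $ i)\<^sup>2)"
  unfolding power2_norm_eq_inner inner_vec_def by (simp add: power2_eq_square)

lemma norm_tensor: "norm (a \<otimes>\<^sub>v m) = norm a * norm m"
proof -
  have "(norm (a \<otimes>\<^sub>v m))\<^sup>2 = (norm a * norm m)\<^sup>2"
    by (simp add: norm_matrix_square norm_vec_square power_mult_distrib tensor_def sum_product)
  then show ?thesis by (simp add: power2_eq_iff_nonneg)
qed

text \<open>For orthogonal \<open>s\<close> and \<open>m\<close> half of \<open>\<bar>s \<otimes> m\<bar>\<^sup>2\<close> survives symmetrization, so that the elastic
  energy controls the plastic distortion.\<close>

lemma norm_sym_tensor:
  assumes "s \<bullet> m = 0"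
  shows "(norm (sym_part (s \<otimes>\<^sub>v m)))\<^sup>2 = (norm (s \<otimes>\<^sub>v m))\<^sup>2 / 2"
proof -
  let ?T = "\<Sum>i\<in>UNIV. \<Sum>k\<in>UNIV. (s $ i * m $ k)\<^sup>2"
  have "(\<Sum>i\<in>UNIV. \<Sum>k\<in>UNIV. (s $ i * m $ k) * (s $ k * m $ i)) = (\<Sum>i\<in>UNIV. s $ i * m $ i) * (\<Sum>k\<in>UNIV. s $ k * m $ k)"
    unfolding sum_product by (intro sum.cong refl) (simp add: algebra_simps)
  then have cross: "(\<Sum>i\<in>UNIV. \<Sum>k\<in>UNIV. (s $ i * m $ k) * (s $ k * m $ i)) = 0"
    using assms by (simp add: inner_vec_def)
  have sw: "(\<Sum>i\<in>UNIV. \<Sum>k\<in>UNIV. (s $ k * m $ i)\<^sup>2) = ?T"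
    by (subst sum.swap) (simp add: mult.commute)
  have "(norm (sym_part (s \<otimes>\<^sub>v m)))\<^sup>2 = (\<Sum>i\<in>UNIV. \<Sum>k\<in>UNIV. ((s $ i * m $ k + s $ k * m $ i) / 2)\<^sup>2)"
    unfolding norm_matrix_square by (simp add: sym_part_def tensor_def transpose_def)
  also have "\<dots> = (\<Sum>i\<in>UNIV. \<Sum>k\<in>UNIV. (s $ i * m $ k)\<^sup>2 / 4 + (s $ k * m $ i)\<^sup>2 / 4
      + (s $ i * m $ k) * (s $ k * m $ i) / 2)"
    by (intro sum.cong refl) (simp add: power2_eq_square field_simps)
  also have "\<dots> = ?T / 4 + ?T / 4"
    using cross sw by (simp add: sum.distrib flip: sum_divide_distrib)
  finally show ?thesis by (simp add: norm_matrix_square tensor_def)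
qed

lemma bounded_linear_sym_part: "bounded_linear sym_part"
proof -
  have "linear sym_part"
    by (rule linearI) (simp_all add: sym_part_def vec_eq_iff transpose_def field_simps)
  then show ?thesis by (simp add: linear_conv_bounded_linear)
qed

lemma norm_sym_part_le: "norm (sym_part A) \<le> norm A"
proof -
  have "(norm (transpose A))\<^sup>2 = (norm A)\<^sup>2"
    unfolding norm_matrix_square transpose_def by (subst sum.swap) simp
  then have "norm (transpose A) = norm A" by (simp add: power2_eq_iff_nonneg)
  then have "norm (A + transpose A) \<le> 2 * norm A" using norm_triangle_ineq[of A "transpose A"] by simp
  then show ?thesis by (simp add: sym_part_def)
qed

abbreviation slips :: "slip_system \<Rightarrow> nat set" where "slips S \<equiv> {1..num_slips S}"

lemma slip_systemD:
  assumes "valid_slip_system S" "j \<in> slips S"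
  shows "norm (normal S j) = 1" "normal S j \<bullet> normal S j = 1"
    "norm (burgers S i j) = 1" "burgers S i j \<bullet> normal S j = 0" "normal S j \<bullet> burgers S i j = 0"
  using assms unfolding valid_slip_system_def by (auto simp: norm_eq_1 inner_commute)

text \<open>Both matrices act on a vector \<open>v\<close> as multiples of fixed vectors, with the factors \<open>m\<^sub>j \<bullet> v\<close> and
  \<open>m\<^sub>k \<bullet> v\<close>. If they agree and do not vanish, these factors are proportional, so that the normals
  are parallel.\<close>

lemma tensor_normal_inject:
  assumes S: "valid_slip_system S" "j \<in> slips S" "k \<in> slips S"
    and eq: "s \<otimes>\<^sub>v normal S j = r \<otimes>\<^sub>v normal S k" and s: "s \<noteq> 0"
  shows "k = j"
proof (rule ccontr)
  assume "k \<noteq> j"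
  define m where "m = normal S j"
  define n where "n = normal S k"
  have act: "(m \<bullet> v) *\<^sub>R s = (n \<bullet> v) *\<^sub>R r" for v
    using arg_cong[OF eq, of "\<lambda>A. A *v v"] by (simp add: tensor_mult_vec m_def n_def)
  have s': "s = (n \<bullet> m) *\<^sub>R r" using act[of m] slip_systemD(2)[OF S(1,2)] by (simp add: m_def)
  then have r: "r \<noteq> 0" using s by auto
  have "n \<bullet> v = ((n \<bullet> m) *\<^sub>R m) \<bullet> v" for v
  proof -
    have "((m \<bullet> v) * (n \<bullet> m)) *\<^sub>R r = (n \<bullet> v) *\<^sub>R r" using act[of v] s' by simp
    then show ?thesis using r by (simp add: mult.commute)
  qed
  then have "n = (n \<bullet> m) *\<^sub>R m" by (metis vector_eq_rdot)
  then have "collinear {0, m, n}" unfolding collinear_lemma by metis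
  then show False
    using S \<open>k \<noteq> j\<close> unfolding valid_slip_system_def m_def n_def by auto
qed

lemma slip_index_tensor:
  assumes "valid_slip_system S" "j \<in> slips S" "s \<bullet> normal S j = 0" "s \<noteq> 0"
  shows "slip_index S (s \<otimes>\<^sub>v normal S j) = j"
  unfolding slip_index_def
  by (rule some_equality) (use assms tensor_normal_inject in blast)+

lemma slip_index_mem:
  assumes "j \<in> slips S" "s \<bullet> normal S j = 0"
  shows "slip_index S (s \<otimes>\<^sub>v normal S j) \<in> slips S"
  unfolding slip_index_def using assms
  by (rule_tac someI2[of _ j]) auto

lemma slip_vec_tensor:
  assumes "valid_slip_system S" "j \<in> slips S" "s \<bullet> normal S j = 0"
  shows "slip_vec S (s \<otimes>\<^sub>v normal S j) = s"
proof (cases "s = 0")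
  case False
  then show ?thesis
    using slip_index_tensor[OF assms False] slip_systemD(2)[OF assms(1,2)]
    by (simp add: slip_vec_def tensor_mult_vec)
qed (simp add: slip_vec_def)

text \<open>The coordinates of a vector of the slip plane with respect to the two Burgers vectors, written
  with the dual basis.\<close>

definition slip_coord :: "slip_system \<Rightarrow> nat \<Rightarrow> real^3 \<Rightarrow> real^2" where
  "slip_coord S j s = (let b = burgers S 1 j; b' = burgers S 2 j; g = b \<bullet> b' in
     \<chi> i. if i = 1 then (s \<bullet> b - g * (s \<bullet> b')) / (1 - g\<^sup>2) else (s \<bullet> b' - g * (s \<bullet> b)) / (1 - g\<^sup>2))"

lemma bounded_linear_slip_coord: "bounded_linear (slip_coord S j)"
proof -
  have "linear (slip_coord S j)"
    by (rule linearI)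
       (simp_all add: slip_coord_def Let_def vec_eq_iff inner_add_left add_divide_distrib
          diff_divide_distrib distrib_left algebra_simps)
  then show ?thesis by (simp add: linear_conv_bounded_linear)
qed

lemma burgers_inner_square_less:
  assumes "valid_slip_system S" "j \<in> slips S"
  shows "(burgers S 1 j \<bullet> burgers S 2 j)\<^sup>2 < 1"
proof -
  let ?b = "burgers S 1 j" and ?b' = "burgers S 2 j"
  have n: "norm ?b = 1" "norm ?b' = 1" using slip_systemD[OF assms] by auto
  have ne: "?b \<noteq> ?b'" and ind: "independent {?b, ?b'}"
    using assms unfolding valid_slip_system_def by auto
  have "?b' \<noteq> - ?b"
  proof
    assume "?b' = - ?b"
    moreover have "- ?b \<in> span {?b}" by (intro span_neg span_base) simp
    ultimately have "?b' \<in> span ({?b, ?b'} - {?b'})" using ne by (simp add: insert_Diff_if)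
    then show False using ind unfolding dependent_def by blast
  qed
  then have "\<bar>?b \<bullet> ?b'\<bar> \<noteq> 1"
    using norm_cauchy_schwarz_abs_eq[of ?b ?b'] n ne by auto
  moreover have "\<bar>?b \<bullet> ?b'\<bar> \<le> 1" using Cauchy_Schwarz_ineq2[of ?b ?b'] n by simp
  ultimately have "\<bar>?b \<bullet> ?b'\<bar> < 1" by simp
  then show ?thesis by (simp add: abs_square_less_1)
qed

lemma slip_coord_combination:
  assumes "valid_slip_system S" "j \<in> slips S"
  shows "slip_coord S j (\<Sum>i\<in>UNIV. c $ i *\<^sub>R burgers S i j) = c"
proof -
  let ?b = "burgers S 1 j" and ?b' = "burgers S 2 j"
  define g where "g = ?b \<bullet> ?b'"
  have o: "?b \<bullet> ?b = 1" "?b' \<bullet> ?b' = 1" "?b' \<bullet> ?b = g" "?b \<bullet> ?b' = g"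
    using slip_systemD(3)[OF assms] by (simp_all add: g_def inner_commute norm_eq_1)
  have g1: "1 - g\<^sup>2 \<noteq> 0" using burgers_inner_square_less[OF assms] by (simp add: g_def)
  have e: "c1 + c2 * g - g * (c1 * g + c2) = c1 * (1 - g\<^sup>2)" "c1 * g + c2 - g * (c1 + c2 * g) = c2 * (1 - g\<^sup>2)"
    for c1 c2 by (simp_all add: power2_eq_square algebra_simps)
  show ?thesis
    using g1 by (simp add: slip_coord_def Let_def vec_eq_iff forall_2 sum_2 inner_add_left o e)
qed

text \<open>The dual basis makes the remainder orthogonal to both Burgers vectors, and it is orthogonal to
  the normal as well. These three vectors span the space.\<close>

lemma slip_plane_combination:
  assumes "valid_slip_system S" "j \<in> slips S" "s \<bullet> normal S j = 0"
  shows "s = (\<Sum>i\<in>UNIV. slip_coord S j s $ i *\<^sub>R burgers S i j)"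
proof -
  let ?b = "burgers S 1 j" and ?b' = "burgers S 2 j" and ?m = "normal S j"
  define g where "g = ?b \<bullet> ?b'"
  have o: "?b \<bullet> ?b = 1" "?b' \<bullet> ?b' = 1" "?b' \<bullet> ?b = g" "?b \<bullet> ?b' = g"
    using slip_systemD(3)[OF assms(1,2)] by (simp_all add: g_def inner_commute norm_eq_1)
  have g1: "1 - g\<^sup>2 \<noteq> 0" using burgers_inner_square_less[OF assms(1,2)] by (simp add: g_def)
  define c where "c = slip_coord S j s $ 1"
  define c' where "c' = slip_coord S j s $ 2"
  have cc: "c = (s \<bullet> ?b - g * (s \<bullet> ?b')) / (1 - g\<^sup>2)" "c' = (s \<bullet> ?b' - g * (s \<bullet> ?b)) / (1 - g\<^sup>2)"
    by (simp_all add: c_def c'_def slip_coord_def Let_def g_def)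
  define r where "r = s - (c *\<^sub>R ?b + c' *\<^sub>R ?b')"
  have e: "c + c' * g = s \<bullet> ?b" "c * g + c' = s \<bullet> ?b'"
  proof -
    have e: "c * (1 - g\<^sup>2) = s \<bullet> ?b - g * (s \<bullet> ?b')" "c' * (1 - g\<^sup>2) = s \<bullet> ?b' - g * (s \<bullet> ?b)"
      using g1 by (simp_all add: cc)
    have "(c + c' * g) * (1 - g\<^sup>2) = c * (1 - g\<^sup>2) + c' * (1 - g\<^sup>2) * g"
      "(c * g + c') * (1 - g\<^sup>2) = c * (1 - g\<^sup>2) * g + c' * (1 - g\<^sup>2)"
      by (simp_all add: algebra_simps)
    then have "(c + c' * g) * (1 - g\<^sup>2) = (s \<bullet> ?b) * (1 - g\<^sup>2)" "(c * g + c') * (1 - g\<^sup>2) = (s \<bullet> ?b') * (1 - g\<^sup>2)"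
      unfolding e by (simp_all add: algebra_simps power2_eq_square)
    then show "c + c' * g = s \<bullet> ?b" "c * g + c' = s \<bullet> ?b'" using g1 by simp_all
  qed
  have orth: "r \<bullet> ?b = 0" "r \<bullet> ?b' = 0" "r \<bullet> ?m = 0"
    using e slip_systemD[OF assms(1,2)] assms(3)
    by (simp_all add: r_def inner_diff_left inner_add_left o)
  have ind2: "independent {?b, ?b'}" and ne: "?b \<noteq> ?b'"
    using assms(1,2) unfolding valid_slip_system_def by auto
  have mo: "?m \<bullet> x = 0" if "x \<in> span {?b, ?b'}" for x
    using that slip_systemD(5)[OF assms(1,2)]
    by (induction rule: span_induct_alt) (auto simp: inner_add_right)
  have m0: "?m \<bullet> ?m = 1" using slip_systemD(2)[OF assms(1,2)] .
  then have m_notin: "?m \<notin> span {?b, ?b'}" using mo[of ?m] by auto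
  have "?b \<in> span {?b, ?b'}" "?b' \<in> span {?b, ?b'}" by (auto intro: span_base)
  then have "?m \<notin> {?b, ?b'}" using m_notin by auto
  then have card3: "card {?m, ?b, ?b'} = 3" using ne by auto
  have ind3: "independent {?m, ?b, ?b'}" using independent_insertI[OF m_notin ind2] .
  have "UNIV \<subseteq> span {?m, ?b, ?b'}"
    by (rule card_ge_dim_independent) (use ind3 card3 in \<open>auto simp: dim_UNIV\<close>)
  then have "r \<in> span {?m, ?b, ?b'}" by auto
  then have "r \<bullet> r = 0"
  proof -
    have "r \<bullet> x = 0" if "x \<in> span {?m, ?b, ?b'}" for x
      using that orth by (induction rule: span_induct_alt) (auto simp: inner_add_right)
    then show ?thesis using \<open>r \<in> span {?m, ?b, ?b'}\<close> by blast
  qed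
  then show ?thesis by (simp add: r_def sum_2 c_def c'_def)
qed

lemma slip_coeff_tensor:
  assumes "valid_slip_system S" "j \<in> slips S" "s \<bullet> normal S j = 0"
  shows "slip_coeff S (s \<otimes>\<^sub>v normal S j) = slip_coord S j s"
proof (cases "s = 0")
  case True
  define k where "k = slip_index S (s \<otimes>\<^sub>v normal S j)"
  have k: "k \<in> slips S" using slip_index_mem assms unfolding k_def by blast
  have z: "slip_coord S i 0 = 0" for i
    using linear_0[OF bounded_linear.linear[OF bounded_linear_slip_coord]] .
  have "(THE c. 0 = (\<Sum>i\<in>UNIV. c $ i *\<^sub>R burgers S i k)) = (0::real^2)"
    by (rule the_equality) (use slip_coord_combination[OF assms(1) k] z in \<open>simp, metis\<close>)
  then show ?thesis
    using slip_vec_tensor[OF assms] True by (simp add: slip_coeff_def z k_def)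
next
  case False
  have "(THE c. s = (\<Sum>i\<in>UNIV. c $ i *\<^sub>R burgers S i j)) = slip_coord S j s"
    by (rule the_equality)
       (use slip_coord_combination[OF assms(1,2)] slip_plane_combination[OF assms] in \<open>blast, metis\<close>)
  then show ?thesis
    by (simp add: slip_coeff_def slip_vec_tensor[OF assms] slip_index_tensor[OF assms False])
qed

section \<open>Fields with one active slip plane\<close>

text \<open>A plastic distortion is handled through its slip vectors \<open>s j\<close> in the planes with normals
  \<open>m\<^sub>j\<close>, at most one of which is nonzero at a given point.\<close>

definition slip_field :: "slip_system \<Rightarrow> (nat \<Rightarrow> real^3 \<Rightarrow> real^3) \<Rightarrow> real^3 \<Rightarrow> real^3^3" where
  "slip_field S s x = (\<Sum>j\<in>slips S. s j x \<otimes>\<^sub>v normal S j)"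

definition single_plane :: "slip_system \<Rightarrow> (real^3) set \<Rightarrow> (nat \<Rightarrow> real^3 \<Rightarrow> real^3) \<Rightarrow> bool" where
  "single_plane S \<Omega> s \<longleftrightarrow> (\<forall>x\<in>\<Omega>. \<forall>j\<in>slips S. s j x \<bullet> normal S j = 0 \<and>
     (\<forall>k\<in>slips S. j \<noteq> k \<longrightarrow> s j x = 0 \<or> s k x = 0))"

lemma single_planeE:
  assumes "single_plane S \<Omega> s" "x \<in> \<Omega>" "slips S \<noteq> {}"
  obtains j where "j \<in> slips S" "s j x \<bullet> normal S j = 0" "\<And>k. k \<in> slips S \<Longrightarrow> k \<noteq> j \<Longrightarrow> s k x = 0"
    "slip_field S s x = s j x \<otimes>\<^sub>v normal S j"
proof -
  obtain j where j: "j \<in> slips S" "\<And>k. k \<in> slips S \<Longrightarrow> k \<noteq> j \<Longrightarrow> s k x = 0"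
  proof (cases "\<exists>j\<in>slips S. s j x \<noteq> 0")
    case True
    then obtain j where j: "j \<in> slips S" "s j x \<noteq> 0" by blast
    show thesis
    proof (rule that[OF j(1)])
      show "s k x = 0" if "k \<in> slips S" "k \<noteq> j" for k
        using assms(1,2) j that unfolding single_plane_def by metis
    qed
  next
    case False
    then show thesis using assms(3) that by auto
  qed
  have "slip_field S s x = s j x \<otimes>\<^sub>v normal S j + (\<Sum>k\<in>slips S - {j}. s k x \<otimes>\<^sub>v normal S k)"
    unfolding slip_field_def by (rule sum.remove) (use j in auto)
  also have "(\<Sum>k\<in>slips S - {j}. s k x \<otimes>\<^sub>v normal S k) = 0"
    by (rule sum.neutral) (use j in auto)
  finally show thesis using j assms(1,2) by (intro that[of j]) (auto simp: single_plane_def)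
qed

lemma sum_single:
  assumes "finite A" "j \<in> A" "\<And>k. k \<in> A \<Longrightarrow> k \<noteq> j \<Longrightarrow> f k = 0"
  shows "(\<Sum>k\<in>A. f k) = f j"
  using sum.remove[OF assms(1,2), of f] assms(3) by (simp add: sum.neutral)

text \<open>Where the field does not vanish, the active plane is the one selected by \<open>slip_index\<close>. Where it
  vanishes, the selected index is arbitrary, but all slip vectors and coordinates are zero.\<close>

lemma slip_field_parts:
  assumes S: "valid_slip_system S" "slips S \<noteq> {}" and s: "single_plane S \<Omega> s" and x: "x \<in> \<Omega>"
  shows "j \<in> slips S \<Longrightarrow> indicator (slip_region S \<Omega> (slip_field S s) j) x *\<^sub>R slip_vec S (slip_field S s x) = s j x"
    "j \<in> slips S \<Longrightarrow> indicat_real (slip_region S \<Omega> (slip_field S s) j) x * slip_coeff S (slip_field S s x) $ i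
      = slip_coord S j (s j x) $ i"
    "\<bar>slip_coeff S (slip_field S s x) $ i\<bar> = (\<Sum>j\<in>slips S. \<bar>slip_coord S j (s j x) $ i\<bar>)"
    "norm (slip_field S s x) = (\<Sum>j\<in>slips S. norm (s j x))"
    "\<exists>j\<in>slips S. \<exists>r. r \<bullet> normal S j = 0 \<and> slip_field S s x = r \<otimes>\<^sub>v normal S j"
proof -
  obtain l where l: "l \<in> slips S" "s l x \<bullet> normal S l = 0" "\<And>k. k \<in> slips S \<Longrightarrow> k \<noteq> l \<Longrightarrow> s k x = 0"
    "slip_field S s x = s l x \<otimes>\<^sub>v normal S l"
    using single_planeE[OF s x S(2)] by blast
  note v = slip_vec_tensor[OF S(1) l(1,2)] and c = slip_coeff_tensor[OF S(1) l(1,2)]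
  have z: "slip_coord S i 0 = 0" for i
    using linear_0[OF bounded_linear.linear[OF bounded_linear_slip_coord]] .
  have idx: "slip_index S (slip_field S s x) = l" if "s l x \<noteq> 0"
    using slip_index_tensor[OF S(1) l(1,2) that] l(4) by simp
  have reg: "indicator (slip_region S \<Omega> (slip_field S s) j) x = (if j = l then 1 else 0 :: real)"
    if "s l x \<noteq> 0" for j
    using idx[OF that] x by (auto simp: slip_region_def indicator_def)
  show "indicator (slip_region S \<Omega> (slip_field S s) j) x *\<^sub>R slip_vec S (slip_field S s x) = s j x"
    if "j \<in> slips S"
    using reg[of j] v l(3)[OF that] unfolding l(4) by (cases "s l x = 0"; cases "j = l") auto
  show "indicat_real (slip_region S \<Omega> (slip_field S s) j) x * slip_coeff S (slip_field S s x) $ i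
      = slip_coord S j (s j x) $ i" if "j \<in> slips S"
    using reg[of j] c l(3)[OF that] unfolding l(4) by (cases "s l x = 0"; cases "j = l") (auto simp: z)
  show "\<bar>slip_coeff S (slip_field S s x) $ i\<bar> = (\<Sum>j\<in>slips S. \<bar>slip_coord S j (s j x) $ i\<bar>)"
    using sum_single[of "slips S" l "\<lambda>j. \<bar>slip_coord S j (s j x) $ i\<bar>"] l c by (simp add: z)
  show "norm (slip_field S s x) = (\<Sum>j\<in>slips S. norm (s j x))"
    using sum_single[of "slips S" l "\<lambda>j. norm (s j x)"] l slip_systemD(1)[OF S(1) l(1)]
    by (simp add: norm_tensor)
  show "\<exists>j\<in>slips S. \<exists>r. r \<bullet> normal S j = 0 \<and> slip_field S s x = r \<otimes>\<^sub>v normal S j"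
    using l by blast
qed

lemma sliced_tv_cong:
  assumes "\<And>x. x \<in> \<Omega> \<Longrightarrow> f x = g x" shows "sliced_tv S j \<Omega> f = sliced_tv S j \<Omega> g"
  unfolding sliced_tv_def
  by (intro nn_integral_cong tv_cong) (use assms in \<open>auto simp: planar_slice_def\<close>)

lemma energy_slip_field:
  assumes S: "valid_slip_system S" "slips S \<noteq> {}" and s: "single_plane S \<Omega> s"
    and ssc: "\<And>x j. x \<in> \<Omega> \<Longrightarrow> j \<in> slips S \<Longrightarrow> \<exists>i c. s j x = c *\<^sub>R burgers S i j"
  shows "SSC S \<Omega> (slip_field S s)"
    "energy S \<sigma> \<tau> \<Omega> u (slip_field S s) = elastic_energy \<Omega> u (slip_field S s)
      + ennreal \<sigma> * (\<Sum>j\<in>slips S. sliced_tv S j \<Omega> (s j))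
      + ennreal \<tau> * (\<integral>\<^sup>+x. (\<Sum>j\<in>slips S. ennreal (norm (s j x))) \<partial>lebesgue_on \<Omega>)"
proof -
  show *: "SSC S \<Omega> (slip_field S s)"
    unfolding SSC_def
  proof (rule AE_I2)
    fix x assume "x \<in> space (lebesgue_on \<Omega>)"
    then have x: "x \<in> \<Omega>" by simp
    show "\<exists>j\<in>slips S. \<exists>i c. slip_field S s x = (c *\<^sub>R burgers S i j) \<otimes>\<^sub>v normal S j"
      by (rule single_planeE[OF s x S(2)]) (use ssc[OF x] in metis)
  qed
  have "curl_norm S \<Omega> (slip_field S s) = (\<Sum>j\<in>slips S. sliced_tv S j \<Omega> (s j))"
    unfolding curl_norm_def
    by (intro sum.cong refl sliced_tv_cong slip_field_parts(1)[OF S s])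
  moreover have "(\<integral>\<^sup>+x. ennreal (norm (slip_field S s x)) \<partial>lebesgue_on \<Omega>)
      = (\<integral>\<^sup>+x. (\<Sum>j\<in>slips S. ennreal (norm (s j x))) \<partial>lebesgue_on \<Omega>)"
    by (intro nn_integral_cong) (simp add: slip_field_parts(4)[OF S s])
  ultimately show "energy S \<sigma> \<tau> \<Omega> u (slip_field S s) = elastic_energy \<Omega> u (slip_field S s)
      + ennreal \<sigma> * (\<Sum>j\<in>slips S. sliced_tv S j \<Omega> (s j))
      + ennreal \<tau> * (\<integral>\<^sup>+x. (\<Sum>j\<in>slips S. ennreal (norm (s j x))) \<partial>lebesgue_on \<Omega>)"
    using * by (simp add: energy_def)
qed

lemma energy_rel_slip_field:
  assumes S: "valid_slip_system S" "slips S \<noteq> {}" and s: "single_plane S \<Omega> s"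
  shows "energy_rel S \<sigma> \<tau> \<Omega> u (slip_field S s) = elastic_energy \<Omega> u (slip_field S s)
      + ennreal \<sigma> * (\<Sum>j\<in>slips S. \<Sum>i\<in>UNIV. sliced_tv S j \<Omega> (\<lambda>x. slip_coord S j (s j x) $ i))
      + ennreal \<tau> * (\<Sum>i\<in>UNIV. \<integral>\<^sup>+x. (\<Sum>j\<in>slips S. ennreal \<bar>slip_coord S j (s j x) $ i\<bar>) \<partial>lebesgue_on \<Omega>)"
proof -
  have "RSC S \<Omega> (slip_field S s)"
    unfolding RSC_def by (intro AE_I2) (use slip_field_parts(5)[OF S s] in simp)
  moreover have "curl_norm_lam S \<Omega> (slip_field S s)
      = (\<Sum>j\<in>slips S. \<Sum>i\<in>UNIV. sliced_tv S j \<Omega> (\<lambda>x. slip_coord S j (s j x) $ i))"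
    unfolding curl_norm_lam_def
    by (intro sum.cong refl sliced_tv_cong slip_field_parts(2)[OF S s])
  moreover have "norm_1_lam S \<Omega> (slip_field S s)
      = (\<Sum>i\<in>UNIV. \<integral>\<^sup>+x. (\<Sum>j\<in>slips S. ennreal \<bar>slip_coord S j (s j x) $ i\<bar>) \<partial>lebesgue_on \<Omega>)"
    unfolding norm_1_lam_def
    by (intro sum.cong refl nn_integral_cong) (simp add: slip_field_parts(3)[OF S s])
  ultimately show ?thesis by (simp add: energy_rel_def)
qed

lemma energy_rel_cong:
  assumes "\<And>x. x \<in> \<Omega> \<Longrightarrow> \<beta> x = \<gamma> x"
  shows "energy_rel S \<sigma> \<tau> \<Omega> u \<beta> = energy_rel S \<sigma> \<tau> \<Omega> u \<gamma>"
proof -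
  have r: "RSC S \<Omega> \<beta> = RSC S \<Omega> \<gamma>" unfolding RSC_def by (rule AE_cong) (use assms in auto)
  have "slip_region S \<Omega> \<beta> j = slip_region S \<Omega> \<gamma> j" for j using assms by (auto simp: slip_region_def)
  then have "curl_norm_lam S \<Omega> \<beta> = curl_norm_lam S \<Omega> \<gamma>"
    unfolding curl_norm_lam_def by (intro sum.cong refl sliced_tv_cong) (simp add: assms)
  moreover have "norm_1_lam S \<Omega> \<beta> = norm_1_lam S \<Omega> \<gamma>"
    unfolding norm_1_lam_def by (intro sum.cong refl nn_integral_cong) (simp add: assms)
  moreover have "elastic_energy \<Omega> u \<beta> = elastic_energy \<Omega> u \<gamma>"
    unfolding elastic_energy_def by (intro nn_integral_cong) (simp add: assms)
  ultimately show ?thesis using r by (simp add: energy_rel_def)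
qed

section \<open>Convexity of the relaxed energy\<close>

lemma sliced_tv_zero [simp]: "sliced_tv S j \<Omega> (\<lambda>x. 0) = 0"
  by (simp add: sliced_tv_def)

lemma sliced_tv_lincomb:
  fixes f g :: "real^3 \<Rightarrow> real"
  assumes S: "valid_slip_system S" "j \<in> slips S" and U: "open U"
    and f: "f \<in> borel_measurable (lebesgue_on U)" and g: "g \<in> borel_measurable (lebesgue_on U)"
    and ab: "a \<ge> 0" "b \<ge> 0"
  shows "sliced_tv S j U (\<lambda>x. a * f x + b * g x)
    \<le> ennreal a * sliced_tv S j U f + ennreal b * sliced_tv S j U g"
proof -
  let ?tv = "\<lambda>f t. tv (planar_slice S j U t) (\<lambda>w. f (plane_point S j t w) :: real)"
  obtain F where F: "F \<in> borel_measurable lborel" "AE t in lborel. ?tv f t = F t"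
    using slice_tv_ae_borel[OF S U f] by blast
  obtain G where G: "G \<in> borel_measurable lborel" "AE t in lborel. ?tv g t = G t"
    using slice_tv_ae_borel[OF S U g] by blast
  have pt: "?tv (\<lambda>x. a * f x + b * g x) t \<le> ennreal a * ?tv f t + ennreal b * ?tv g t" for t
  proof -
    have "?tv (\<lambda>x. a * f x + b * g x) t \<le> ?tv (\<lambda>x. a * f x) t + ?tv (\<lambda>x. b * g x) t"
      by (rule tv_add)
    also have "\<dots> \<le> ennreal \<bar>a\<bar> * ?tv f t + ennreal \<bar>b\<bar> * ?tv g t"
      using tv_scaleR[of _ a "\<lambda>w. f (plane_point S j t w)"] tv_scaleR[of _ b "\<lambda>w. g (plane_point S j t w)"]
      by (intro add_mono) simp_all
    finally show ?thesis using ab by simp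
  qed
  have "sliced_tv S j U (\<lambda>x. a * f x + b * g x) \<le> (\<integral>\<^sup>+t. ennreal a * ?tv f t + ennreal b * ?tv g t \<partial>lborel)"
    unfolding sliced_tv_def by (intro nn_integral_mono pt)
  also have "\<dots> = (\<integral>\<^sup>+t. ennreal a * F t + ennreal b * G t \<partial>lborel)"
    by (rule nn_integral_cong_AE) (use F(2) G(2) in \<open>eventually_elim, simp\<close>)
  also have "\<dots> = ennreal a * (\<integral>\<^sup>+t. F t \<partial>lborel) + ennreal b * (\<integral>\<^sup>+t. G t \<partial>lborel)"
    using F(1) G(1) by (simp add: nn_integral_add nn_integral_cmult)
  also have "(\<integral>\<^sup>+t. F t \<partial>lborel) = sliced_tv S j U f"
    unfolding sliced_tv_def by (rule nn_integral_cong_AE) (use F(2) in \<open>eventually_elim, simp\<close>)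
  also have "(\<integral>\<^sup>+t. G t \<partial>lborel) = sliced_tv S j U g"
    unfolding sliced_tv_def by (rule nn_integral_cong_AE) (use G(2) in \<open>eventually_elim, simp\<close>)
  finally show ?thesis .
qed

lemma bounded_linear_tensor: "bounded_linear (\<lambda>s. s \<otimes>\<^sub>v m)"
proof -
  have "linear (\<lambda>s. s \<otimes>\<^sub>v m)" by (rule linearI) (simp_all add: tensor_add tensor_scaleR)
  then show ?thesis by (simp add: linear_conv_bounded_linear)
qed

lemma bounded_linear_measurable:
  fixes L :: "'b::euclidean_space \<Rightarrow> 'c::euclidean_space"
  assumes "bounded_linear L" "f \<in> borel_measurable M"
  shows "(\<lambda>x. L (f x)) \<in> borel_measurable M"
  using measurable_compose[OF assms(2) borel_measurable_continuous_onI[OF linear_continuous_on[OF assms(1)]]] .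

lemma elastic_measurable:
  assumes "u \<in> H1 \<Omega>" "\<beta> \<in> borel_measurable (lebesgue_on \<Omega>)"
  shows "(\<lambda>x. sym_part (wgrad \<Omega> u x - \<beta> x)) \<in> borel_measurable (lebesgue_on \<Omega>)"
  by (intro bounded_linear_measurable[OF bounded_linear_sym_part] borel_measurable_diff
      L2_measurable[OF wgrad_L2[OF assms(1)]] assms(2))

lemma norm_square_convex:
  fixes a b :: "'a::real_inner"
  assumes "0 \<le> \<theta>" "\<theta> \<le> 1"
  shows "(norm ((1 - \<theta>) *\<^sub>R a + \<theta> *\<^sub>R b))\<^sup>2 \<le> (1 - \<theta>) * (norm a)\<^sup>2 + \<theta> * (norm b)\<^sup>2"
proof -
  have "(1 - \<theta>) * (norm a)\<^sup>2 + \<theta> * (norm b)\<^sup>2 - (norm ((1 - \<theta>) *\<^sub>R a + \<theta> *\<^sub>R b))\<^sup>2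
      = (1 - \<theta>) * \<theta> * (norm (a - b))\<^sup>2"
    unfolding power2_norm_eq_inner
    by (simp add: inner_add_left inner_add_right inner_diff_left inner_diff_right inner_commute algebra_simps)
  moreover have "0 \<le> (1 - \<theta>) * \<theta> * (norm (a - b))\<^sup>2" using assms by simp
  ultimately show ?thesis by linarith
qed

lemma energy_rel_one_plane:
  assumes S: "valid_slip_system S" "j \<in> slips S" and s: "\<And>x. x \<in> U \<Longrightarrow> s x \<bullet> normal S j = 0"
  shows "energy_rel S \<sigma> \<tau> U v (\<lambda>x. s x \<otimes>\<^sub>v normal S j) = elastic_energy U v (\<lambda>x. s x \<otimes>\<^sub>v normal S j)
     + ennreal \<sigma> * (\<Sum>i\<in>UNIV. sliced_tv S j U (\<lambda>x. slip_coord S j (s x) $ i))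
     + ennreal \<tau> * (\<Sum>i\<in>UNIV. \<integral>\<^sup>+x. ennreal \<bar>slip_coord S j (s x) $ i\<bar> \<partial>lebesgue_on U)"
proof -
  define r where "r k x = (if k = j then s x else 0)" for k x
  have ne: "slips S \<noteq> {}" using S(2) by blast
  have z: "slip_coord S i 0 = 0" for i
    using linear_0[OF bounded_linear.linear[OF bounded_linear_slip_coord]] .
  have r: "single_plane S U r" using s by (auto simp: single_plane_def r_def)
  have f: "slip_field S r = (\<lambda>x. s x \<otimes>\<^sub>v normal S j)"
  proof
    fix x
    have "slip_field S r x = r j x \<otimes>\<^sub>v normal S j"
      unfolding slip_field_def by (rule sum_single) (use S(2) in \<open>auto simp: r_def\<close>)
    then show "slip_field S r x = s x \<otimes>\<^sub>v normal S j" by (simp add: r_def)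
  qed
  have "(\<Sum>k\<in>slips S. \<Sum>i\<in>UNIV. sliced_tv S k U (\<lambda>x. slip_coord S k (r k x) $ i))
      = (\<Sum>i\<in>UNIV. sliced_tv S j U (\<lambda>x. slip_coord S j (r j x) $ i))"
    by (rule sum_single) (use S(2) in \<open>auto simp: r_def z\<close>)
  moreover have "(\<Sum>k\<in>slips S. ennreal \<bar>slip_coord S k (r k x) $ i\<bar>) = ennreal \<bar>slip_coord S j (r j x) $ i\<bar>" for x i
    by (rule sum_single) (use S(2) in \<open>auto simp: r_def z\<close>)
  ultimately show ?thesis
    using energy_rel_slip_field[OF S(1) ne r, of \<sigma> \<tau> v] unfolding f by (simp add: r_def)
qed

text \<open>The coordinates of the slip vector are linear, so that the three terms of the energy are a
  convex quadratic function and two seminorms of it.\<close>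

lemma energy_rel_convex:
  assumes S: "valid_slip_system S" "j \<in> slips S" and U: "open U" and v: "v \<in> H1 U"
    and \<theta>: "0 \<le> \<theta>" "\<theta> \<le> 1"
    and s: "s \<in> borel_measurable (lebesgue_on U)" "\<And>x. x \<in> U \<Longrightarrow> s x \<bullet> normal S j = 0"
    and r: "r \<in> borel_measurable (lebesgue_on U)" "\<And>x. x \<in> U \<Longrightarrow> r x \<bullet> normal S j = 0"
  shows "energy_rel S \<sigma> \<tau> U v (\<lambda>x. ((1 - \<theta>) *\<^sub>R s x + \<theta> *\<^sub>R r x) \<otimes>\<^sub>v normal S j)
    \<le> ennreal (1 - \<theta>) * energy_rel S \<sigma> \<tau> U v (\<lambda>x. s x \<otimes>\<^sub>v normal S j)
      + ennreal \<theta> * energy_rel S \<sigma> \<tau> U v (\<lambda>x. r x \<otimes>\<^sub>v normal S j)"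
proof -
  define c where "c s x i = slip_coord S j (s x) $ i" for s :: "real^3 \<Rightarrow> real^3" and x i
  define q where "q x = (1 - \<theta>) *\<^sub>R s x + \<theta> *\<^sub>R r x" for x
  define el where "el s = elastic_energy U v (\<lambda>x. s x \<otimes>\<^sub>v normal S j)" for s
  define A where "A s i = sliced_tv S j U (\<lambda>x. c s x i)" for s i
  define B where "B s i = (\<integral>\<^sup>+x. ennreal \<bar>c s x i\<bar> \<partial>lebesgue_on U)" for s i
  have \<theta>': "0 \<le> 1 - \<theta>" using \<theta> by simp
  have qt: "q x \<bullet> normal S j = 0" if "x \<in> U" for x
    using s(2)[OF that] r(2)[OF that] by (simp add: q_def inner_add_left)
  have lin: "linear (slip_coord S j)" by (rule bounded_linear.linear[OF bounded_linear_slip_coord])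
  have cq: "c q x i = (1 - \<theta>) * c s x i + \<theta> * c r x i" for x i
    by (simp add: c_def q_def linear_add[OF lin] linear_scale[OF lin])
  have cm: "(\<lambda>x. c s x i) \<in> borel_measurable (lebesgue_on U)" "(\<lambda>x. c r x i) \<in> borel_measurable (lebesgue_on U)" for i
    unfolding c_def using s(1) r(1)
    by (auto intro!: bounded_linear_measurable[OF bounded_linear_vec_nth]
        bounded_linear_measurable[OF bounded_linear_slip_coord])
  have A: "A q i \<le> ennreal (1 - \<theta>) * A s i + ennreal \<theta> * A r i" for i
    unfolding A_def cq by (rule sliced_tv_lincomb[OF S U cm \<theta>' \<theta>(1)])
  have B: "B q i \<le> ennreal (1 - \<theta>) * B s i + ennreal \<theta> * B r i" for i
  proof -
    have pt: "ennreal \<bar>c q x i\<bar> \<le> ennreal (1 - \<theta>) * ennreal \<bar>c s x i\<bar> + ennreal \<theta> * ennreal \<bar>c r x i\<bar>" for x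
    proof -
      have "\<bar>c q x i\<bar> \<le> (1 - \<theta>) * \<bar>c s x i\<bar> + \<theta> * \<bar>c r x i\<bar>"
        using abs_triangle_ineq[of "(1 - \<theta>) * c s x i" "\<theta> * c r x i"] \<theta> by (simp add: cq abs_mult)
      then have "ennreal \<bar>c q x i\<bar> \<le> ennreal ((1 - \<theta>) * \<bar>c s x i\<bar> + \<theta> * \<bar>c r x i\<bar>)" by (rule ennreal_leI)
      then show ?thesis using \<theta> by (simp add: ennreal_mult')
    qed
    have "B q i \<le> (\<integral>\<^sup>+x. ennreal (1 - \<theta>) * ennreal \<bar>c s x i\<bar> + ennreal \<theta> * ennreal \<bar>c r x i\<bar> \<partial>lebesgue_on U)"
      unfolding B_def by (intro nn_integral_mono pt)
    also have "\<dots> = ennreal (1 - \<theta>) * B s i + ennreal \<theta> * B r i"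
      unfolding B_def using cm[of i] by (simp add: nn_integral_add nn_integral_cmult)
    finally show ?thesis .
  qed
  have el: "el q \<le> ennreal (1 - \<theta>) * el s + ennreal \<theta> * el r"
  proof -
    define D where "D s x = sym_part (wgrad U v x - s x \<otimes>\<^sub>v normal S j)" for s x
    have Dm: "D s \<in> borel_measurable (lebesgue_on U)" "D r \<in> borel_measurable (lebesgue_on U)"
      unfolding D_def[abs_def] using s(1) r(1)
      by (auto intro!: elastic_measurable[OF v] bounded_linear_measurable[OF bounded_linear_tensor])
    have sl: "linear sym_part" by (rule bounded_linear.linear[OF bounded_linear_sym_part])
    have "D q x = (1 - \<theta>) *\<^sub>R D s x + \<theta> *\<^sub>R D r x" for x
    proof -
      have "q x \<otimes>\<^sub>v normal S j = (1 - \<theta>) *\<^sub>R (s x \<otimes>\<^sub>v normal S j) + \<theta> *\<^sub>R (r x \<otimes>\<^sub>v normal S j)"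
        by (simp only: q_def tensor_add tensor_scaleR)
      then have "wgrad U v x - q x \<otimes>\<^sub>v normal S j = (1 - \<theta>) *\<^sub>R (wgrad U v x - s x \<otimes>\<^sub>v normal S j)
          + \<theta> *\<^sub>R (wgrad U v x - r x \<otimes>\<^sub>v normal S j)"
        by (simp add: algebra_simps)
      then show ?thesis unfolding D_def by (simp add: linear_add[OF sl] linear_scale[OF sl])
    qed
    then have pt: "ennreal ((norm (D q x))\<^sup>2) \<le> ennreal (1 - \<theta>) * ennreal ((norm (D s x))\<^sup>2)
        + ennreal \<theta> * ennreal ((norm (D r x))\<^sup>2)" for x
      using ennreal_leI[OF norm_square_convex[OF \<theta>, of "D s x" "D r x"]] \<theta> by (simp add: ennreal_mult')
    have "el q \<le> (\<integral>\<^sup>+x. ennreal (1 - \<theta>) * ennreal ((norm (D s x))\<^sup>2)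
        + ennreal \<theta> * ennreal ((norm (D r x))\<^sup>2) \<partial>lebesgue_on U)"
      unfolding el_def elastic_energy_def D_def[symmetric] by (intro nn_integral_mono pt)
    also have "\<dots> = ennreal (1 - \<theta>) * el s + ennreal \<theta> * el r"
      using Dm unfolding el_def elastic_energy_def D_def[symmetric]
      by (simp add: nn_integral_add nn_integral_cmult)
    finally show ?thesis .
  qed
  have "el q + ennreal \<sigma> * (\<Sum>i\<in>UNIV. A q i) + ennreal \<tau> * (\<Sum>i\<in>UNIV. B q i)
      \<le> (ennreal (1 - \<theta>) * el s + ennreal \<theta> * el r)
        + ennreal \<sigma> * (\<Sum>i\<in>UNIV. ennreal (1 - \<theta>) * A s i + ennreal \<theta> * A r i)
        + ennreal \<tau> * (\<Sum>i\<in>UNIV. ennreal (1 - \<theta>) * B s i + ennreal \<theta> * B r i)"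
    by (intro add_mono mult_left_mono sum_mono el A B) auto
  also have "\<dots> = ennreal (1 - \<theta>) * (el s + ennreal \<sigma> * (\<Sum>i\<in>UNIV. A s i) + ennreal \<tau> * (\<Sum>i\<in>UNIV. B s i))
      + ennreal \<theta> * (el r + ennreal \<sigma> * (\<Sum>i\<in>UNIV. A r i) + ennreal \<tau> * (\<Sum>i\<in>UNIV. B r i))"
    by (simp add: sum_2 distrib_left mult.left_commute add_ac)
  finally show ?thesis
    using energy_rel_one_plane[OF S s(2), where \<sigma>=\<sigma> and \<tau>=\<tau> and v=v]
      energy_rel_one_plane[OF S r(2), where \<sigma>=\<sigma> and \<tau>=\<tau> and v=v]
      energy_rel_one_plane[OF S qt, where \<sigma>=\<sigma> and \<tau>=\<tau> and v=v]
    unfolding el_def A_def B_def c_def q_def[symmetric] by simp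
qed

section \<open>Raising the energy to a prescribed value\<close>

text \<open>A radial bump in the first component: the entry in the first row and column of its gradient
  does not vanish off the centre in the direction of the first axis, and symmetrization keeps it.\<close>

lemma bump_displacement:
  assumes "open \<Omega>" "\<Omega> \<noteq> ({} :: (real^3) set)"
  obtains \<phi> x where "\<phi> \<in> Cinfc \<Omega>" "x \<in> \<Omega>" "sym_part (grad_mat \<phi> x) \<noteq> 0"
proof -
  obtain p r where pr: "p \<in> \<Omega>" "r > 0" "cball p r \<subseteq> \<Omega>"
    using assms open_contains_cball by blast
  define y where "y x = r\<^sup>2 + (-1) * ((x - p) \<bullet> (x - p))" for x
  define \<phi> where "\<phi> x = flat_exp 0 (y x) *\<^sub>R (axis 1 1 :: real^3)" for x
  define x0 where "x0 = p + (r/2) *\<^sub>R axis 1 1"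
  have sm: "smooth_on UNIV \<phi>"
    unfolding smooth_on_def \<phi>_def y_def
    by (intro allI Ck_on_scaleR Ck_on_flat_exp_bump Ck_on_const open_UNIV)
  have nz: "x \<in> cball p r" if "\<phi> x \<noteq> 0" for x
  proof -
    have "y x > 0" using that by (auto simp: \<phi>_def flat_exp_def split: if_splits)
    then have "(norm (x - p))\<^sup>2 < r\<^sup>2" by (simp add: y_def power2_norm_eq_inner)
    then have "norm (x - p) < r" using pr(2) by (auto intro: power2_less_imp_less)
    then show ?thesis by (simp add: dist_norm norm_minus_commute)
  qed
  have "compact (supp \<phi>)" "supp \<phi> \<subseteq> cball p r"
    using compact_supp_subset[of "cball p r" \<phi>, OF compact_cball nz] by blast+
  then have C: "\<phi> \<in> Cinfc \<Omega>" using sm pr(3) unfolding Cinfc_def by blast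
  have in\<Omega>: "x0 \<in> \<Omega>" using pr by (auto simp: x0_def dist_norm)
  have y0: "y x0 > 0" using pr(2) by (simp add: y_def x0_def inner_axis_axis power2_eq_square)
  have "(y has_derivative (\<lambda>v. - 2 * ((x0 - p) \<bullet> v))) (at x0)"
    unfolding y_def by (auto intro!: derivative_eq_intros simp: fun_eq_iff inner_commute)
  from has_derivative_compose[OF this flat_exp_deriv[of 0, unfolded has_field_derivative_def]]
  have "((\<lambda>x. flat_exp 0 (y x)) has_derivative (\<lambda>v. flat_exp 2 (y x0) * (- 2 * ((x0 - p) \<bullet> v)))) (at x0)"
    by (simp add: numeral_2_eq_2)
  from has_derivative_scaleR_left[OF this, of "axis 1 1 :: real^3"]
  have "(\<phi> has_derivative (\<lambda>v. (flat_exp 2 (y x0) * (- 2 * ((x0 - p) \<bullet> v))) *\<^sub>R axis 1 1)) (at x0)"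
    by (simp add: \<phi>_def[abs_def])
  from frechet_derivative_at[OF this]
  have "frechet_derivative \<phi> (at x0) = (\<lambda>v. (flat_exp 2 (y x0) * (- 2 * ((x0 - p) \<bullet> v))) *\<^sub>R axis 1 1)"
    by simp
  then have "sym_part (grad_mat \<phi> x0) $ 1 $ 1 = - flat_exp 2 (y x0) * r"
    by (simp add: sym_part_def grad_mat_def transpose_def x0_def inner_axis_axis)
  moreover have "flat_exp 2 (y x0) > 0" using y0 by (simp add: flat_exp_def)
  ultimately have "sym_part (grad_mat \<phi> x0) $ 1 $ 1 \<noteq> 0" using pr(2) by simp
  then have "sym_part (grad_mat \<phi> x0) \<noteq> 0" by auto
  then show thesis using that[OF C in\<Omega>] by blast
qed

text \<open>Along a line \<open>u + t \<phi>\<close> the elastic energy is a quadratic polynomial in \<open>t\<close> with positive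
  leading coefficient, whereas the other terms of the energy do not change. Hence the energy takes
  every larger value.\<close>

lemma energy_attains_larger_values:
  assumes \<Omega>: "open \<Omega>" "\<Omega> \<noteq> {}" and u: "u \<in> H1 \<Omega>"
    and \<beta>: "\<beta> \<in> borel_measurable (lebesgue_on \<Omega>)" "SSC S \<Omega> \<beta>"
    and e: "energy S \<sigma> \<tau> \<Omega> u \<beta> \<le> e" "e < \<infinity>"
  shows "\<exists>\<phi>\<in>Cinfc \<Omega>. energy S \<sigma> \<tau> \<Omega> (\<lambda>x. u x + \<phi> x) \<beta> = e"
proof -
  obtain \<phi> x0 where \<phi>: "\<phi> \<in> Cinfc \<Omega>" "x0 \<in> \<Omega>" "sym_part (grad_mat \<phi> x0) \<noteq> 0"
    using bump_displacement[OF \<Omega>] by blast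
  define A where "A x = sym_part (wgrad \<Omega> u x - \<beta> x)" for x
  define B where "B x = sym_part (grad_mat \<phi> x)" for x
  define R where "R = ennreal \<sigma> * curl_norm S \<Omega> \<beta> + ennreal \<tau> * (\<integral>\<^sup>+x. ennreal (norm (\<beta> x)) \<partial>lebesgue_on \<Omega>)"
  have energy: "energy S \<sigma> \<tau> \<Omega> w \<beta> = elastic_energy \<Omega> w \<beta> + R" for w
    using \<beta>(2) by (simp add: energy_def R_def add.assoc)
  have Am: "A \<in> borel_measurable (lebesgue_on \<Omega>)"
    unfolding A_def[abs_def] by (rule elastic_measurable[OF u \<beta>(1)])
  have fin: "elastic_energy \<Omega> u \<beta> < \<infinity>" "R < \<infinity>"
  proof -
    have "elastic_energy \<Omega> u \<beta> \<le> e" "R \<le> e"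
      using e(1) unfolding energy by (auto intro: order_trans[rotated])
    then show "elastic_energy \<Omega> u \<beta> < \<infinity>" "R < \<infinity>"
      using e(2) by (auto intro: order_le_less_trans)
  qed
  have AL: "A \<in> L2 \<Omega>"
    using Am fin(1) unfolding L2_def elastic_energy_def A_def by simp
  have "grad_mat \<phi> \<in> L2 \<Omega>"
    using is_weak_gradient_Cinfc[OF \<Omega>(1) \<phi>(1)] by (simp add: is_weak_gradient_def)
  then have BL: "B \<in> L2 \<Omega>"
    unfolding B_def[abs_def] by (rule L2_linear[OF _ bounded_linear_sym_part])
  have i: "integrable (lebesgue_on \<Omega>) (\<lambda>x. (norm (A x))\<^sup>2)" "integrable (lebesgue_on \<Omega>) (\<lambda>x. (norm (B x))\<^sup>2)"
    "integrable (lebesgue_on \<Omega>) (\<lambda>x. (norm (A x + B x))\<^sup>2)"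
    using AL BL L2_add[OF AL BL] by (simp_all add: L2_iff)
  have ip: "integrable (lebesgue_on \<Omega>) (\<lambda>x. A x \<bullet> B x)"
  proof -
    have eq: "A x \<bullet> B x = ((norm (A x + B x))\<^sup>2 - (norm (A x))\<^sup>2 - (norm (B x))\<^sup>2) / 2" for x
      unfolding power2_norm_eq_inner by (simp add: inner_add_left inner_add_right inner_commute)
    show ?thesis unfolding eq using i by simp
  qed
  define a where "a = (LINT x|lebesgue_on \<Omega>. (norm (A x))\<^sup>2)"
  define b where "b = (LINT x|lebesgue_on \<Omega>. A x \<bullet> B x)"
  define c where "c = (LINT x|lebesgue_on \<Omega>. (norm (B x))\<^sup>2)"
  define q where "q t = a + 2 * b * t + c * t\<^sup>2" for t
  have elastic: "elastic_energy \<Omega> (\<lambda>x. u x + t *\<^sub>R \<phi> x) \<beta> = ennreal (q t)" for t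
  proof -
    have sl: "linear sym_part" by (rule bounded_linear.linear[OF bounded_linear_sym_part])
    have "AE x in lebesgue_on \<Omega>. ennreal ((norm (sym_part (wgrad \<Omega> (\<lambda>x. u x + t *\<^sub>R \<phi> x) x - \<beta> x)))\<^sup>2)
        = ennreal ((norm (A x + t *\<^sub>R B x))\<^sup>2)"
      using H1_add_Cinfc(2)[OF \<Omega>(1) u \<phi>(1), of t]
    proof eventually_elim
      case (elim x)
      have "wgrad \<Omega> (\<lambda>x. u x + t *\<^sub>R \<phi> x) x - \<beta> x = (wgrad \<Omega> u x - \<beta> x) + t *\<^sub>R grad_mat \<phi> x"
        using elim by simp
      then have "sym_part (wgrad \<Omega> (\<lambda>x. u x + t *\<^sub>R \<phi> x) x - \<beta> x) = A x + t *\<^sub>R B x"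
        unfolding A_def B_def by (simp only: linear_add[OF sl] linear_scale[OF sl])
      then show ?case by (simp only:)
    qed
    then have "elastic_energy \<Omega> (\<lambda>x. u x + t *\<^sub>R \<phi> x) \<beta> = (\<integral>\<^sup>+x. ennreal ((norm (A x + t *\<^sub>R B x))\<^sup>2) \<partial>lebesgue_on \<Omega>)"
      unfolding elastic_energy_def by (rule nn_integral_cong_AE)
    also have "\<dots> = ennreal (LINT x|lebesgue_on \<Omega>. (norm (A x + t *\<^sub>R B x))\<^sup>2)"
      by (rule nn_integral_eq_integral)
         (use L2_add[OF AL L2_scaleR[OF BL, of t]] in \<open>auto simp: L2_iff\<close>)
    also have "(LINT x|lebesgue_on \<Omega>. (norm (A x + t *\<^sub>R B x))\<^sup>2)
        = (LINT x|lebesgue_on \<Omega>. ((norm (A x))\<^sup>2 + (2 * t) * (A x \<bullet> B x)) + t\<^sup>2 * (norm (B x))\<^sup>2)"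
      unfolding power2_norm_eq_inner
      by (simp add: inner_add_left inner_add_right inner_commute power2_eq_square algebra_simps)
    also have "\<dots> = q t"
      using i ip by (simp add: q_def a_def b_def c_def)
    finally show ?thesis .
  qed
  have c_pos: "c > 0"
  proof -
    have "c \<ge> 0" by (simp add: c_def)
    moreover have "c \<noteq> 0"
    proof
      assume "c = 0"
      then have "AE x in lebesgue_on \<Omega>. (norm (B x))\<^sup>2 = 0"
        using integral_nonneg_eq_0_iff_AE[OF i(2)] by (simp add: c_def)
      then have "AE x in lebesgue. x \<in> \<Omega> \<longrightarrow> x \<in> {x. B x = 0}"
        using \<Omega>(1) by (subst (asm) AE_restrict_space_iff) auto
      moreover have "continuous_on UNIV B"
        unfolding B_def
        by (rule bounded_linear.continuous_on[OF bounded_linear_sym_part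
              grad_mat_continuous[OF Ck_on_Cinfc[OF \<phi>(1)]]])
      then have "closed {x. B x = 0}" by (intro closed_Collect_eq continuous_on_const)
      ultimately have "x0 \<in> {x. B x = 0}"
        using mem_closed_if_AE_lebesgue_open[OF \<Omega>(1)] \<phi>(2) by blast
      then show False using \<phi>(3) by (simp add: B_def)
    qed
    ultimately show ?thesis by simp
  qed
  have a0: "a \<ge> 0" by (simp add: a_def)
  obtain r where r: "e = ennreal r + R" "r \<ge> q 0"
  proof -
    have e0: "elastic_energy \<Omega> u \<beta> = ennreal (q 0)" using elastic[of 0] by simp
    have le: "ennreal (q 0) + R \<le> e" using e(1) unfolding energy e0 .
    have "R \<le> e" using le by (rule order_trans[rotated]) simp
    then have dec: "e = (e - R) + R" by (simp add: diff_add_cancel_ennreal)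
    have "e - R < \<infinity>" using e(2) by (meson diff_le_self_ennreal order_le_less_trans)
    then obtain r where r: "e - R = ennreal r" "r \<ge> 0" by (cases "e - R") auto
    have "ennreal (q 0) \<le> e - R" using le fin(2) by (simp add: ennreal_le_minus_iff)
    then have "q 0 \<le> r" using r a0 by (simp add: q_def)
    moreover have "e = ennreal r + R" using dec unfolding r(1) .
    ultimately show thesis by (rule that[rotated])
  qed
  \<comment> \<open>for \<open>t \<ge> 1\<close> and \<open>c t \<ge> 2 \<bar>b\<bar> + \<bar>r\<bar>\<close> the quadratic term dominates the linear one and \<open>r\<close>\<close>
  define T where "T = (2 * \<bar>b\<bar> + \<bar>r\<bar> + 1) / c + 1"
  have T: "T \<ge> 1" using c_pos by (simp add: T_def)
  have "q T \<ge> r"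
  proof -
    have "c * T \<ge> 2 * \<bar>b\<bar> + \<bar>r\<bar>" using c_pos by (simp add: T_def field_simps)
    then have "(c * T) * T \<ge> (2 * \<bar>b\<bar> + \<bar>r\<bar>) * T" using T by (intro mult_right_mono) auto
    moreover have "\<bar>r\<bar> \<le> \<bar>r\<bar> * T" using mult_left_mono[OF T, of "\<bar>r\<bar>"] by simp
    moreover have "- (2 * \<bar>b\<bar> * T) \<le> 2 * b * T"
    proof -
      have "- \<bar>b\<bar> * T \<le> b * T" using T by (intro mult_right_mono) auto
      then show ?thesis by linarith
    qed
    ultimately have "2 * b * T + c * T\<^sup>2 \<ge> \<bar>r\<bar>" by (simp add: power2_eq_square algebra_simps)
    then show ?thesis using a0 by (simp add: q_def)
  qed
  moreover have "continuous_on {0..T} q" unfolding q_def by (intro continuous_intros)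
  ultimately obtain t where "q t = r"
    using IVT'[of q 0 r T] r(2) T by auto
  then have "energy S \<sigma> \<tau> \<Omega> (\<lambda>x. u x + t *\<^sub>R \<phi> x) \<beta> = e"
    unfolding energy elastic r(1) by simp
  moreover have "(\<lambda>x. t *\<^sub>R \<phi> x) \<in> Cinfc \<Omega>"
  proof -
    have "supp (\<lambda>x. t *\<^sub>R \<phi> x) \<subseteq> supp \<phi>" by (rule supp_subset) (use supp_zero[of _ \<phi>] in auto)
    then show ?thesis
      using compact_supp_mono[OF Cinfc_supp(1)[OF \<phi>(1)]] Cinfc_supp(2)[OF \<phi>(1)] Ck_on_Cinfc[OF \<phi>(1)]
      unfolding Cinfc_def smooth_on_def by (auto intro!: Ck_on_scaleR Ck_on_const)
  qed
  ultimately show ?thesis by (rule bexI)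
qed

section \<open>Laminates\<close>

text \<open>The function \<open>arcsin (sin t)\<close> is a triangle wave with slope \<open>sgn (cos t)\<close>. Shrinking the
  argument of the inverse sine by factors \<open>r k < 1\<close> makes it smooth, keeps the slopes bounded
  by one and recovers the square wave in the limit \<open>r k \<longlonglongrightarrow> 1\<close>. A high frequency makes the amplitude small.\<close>

lemma smooth_triangle_wave:
  fixes \<eta> :: real assumes "\<eta> > 0"
  obtains \<omega> and H H' :: "nat \<Rightarrow> real \<Rightarrow> real" where
    "\<omega> > 0" "\<And>k m. Ck_on m UNIV (H k)" "\<And>k t. (H k has_real_derivative H' k t) (at t)"
    "\<And>k t. \<bar>H k t\<bar> \<le> \<eta>" "\<And>k t. \<bar>H' k t\<bar> \<le> 1"
    "\<And>t. cos (\<omega> * t) \<noteq> 0 \<Longrightarrow> (\<lambda>k. H' k t) \<longlonglongrightarrow> (if cos (\<omega> * t) > 0 then 1 else - 1)"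
proof -
  define \<omega> where "\<omega> = pi / (2 * \<eta>)"
  define r where "r k = 1 - inverse (real (Suc (Suc k)))" for k
  define H where "H k t = (1 / \<omega>) * arcsin (r k * sin (\<omega> * t))" for k t
  define H' where "H' k t = r k * cos (\<omega> * t) / sqrt (1 - (r k * sin (\<omega> * t))\<^sup>2)" for k t
  have \<omega>: "\<omega> > 0" using assms by (simp add: \<omega>_def)
  have r: "0 < r k" "r k < 1" for k by (auto simp: r_def field_simps)
  have in_range: "\<bar>r k * sin y\<bar> < 1" for k y
  proof -
    have "\<bar>r k * sin y\<bar> \<le> r k * 1"
      unfolding abs_mult using r[of k] abs_sin_le_one[of y] by (intro mult_mono) auto
    then show ?thesis using r(2)[of k] by simp
  qed
  then have in_range': "- 1 < r k * sin y" "r k * sin y < 1" for k y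
    using in_range[of k y] by (auto simp: abs_less_iff)
  show thesis
  proof (rule that[of \<omega> H H'])
    show "Ck_on m UNIV (H k)" for k m
    proof -
      have "Ck_on m UNIV (\<lambda>t. \<omega> * t)"
        by (intro Ck_on_mult Ck_on_const Ck_on_linear bounded_linear_ident open_UNIV)
      from Ck_on_real_compose[OF open_UNIV open_UNIV Ck_on_sin_cos[OF open_UNIV, THEN conjunct1] this UNIV_I]
      have "Ck_on m UNIV (\<lambda>t. r k * sin (\<omega> * t))"
        by (intro Ck_on_mult Ck_on_const open_UNIV)
      from Ck_on_real_compose[OF open_UNIV open_greaterThanLessThan Ck_on_arcsin this]
      have "Ck_on m UNIV (\<lambda>t. arcsin (r k * sin (\<omega> * t)))" using in_range' by simp
      then show ?thesis unfolding H_def by (intro Ck_on_mult Ck_on_const open_UNIV)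
    qed
    show "(H k has_real_derivative H' k t) (at t)" for k t
    proof -
      have "((\<lambda>t. r k * sin (\<omega> * t)) has_real_derivative r k * (cos (\<omega> * t) * \<omega>)) (at t)"
        by (auto intro!: derivative_eq_intros)
      from DERIV_chain2[OF DERIV_arcsin[OF in_range'] this]
      have "((\<lambda>t. arcsin (r k * sin (\<omega> * t))) has_real_derivative
          inverse (sqrt (1 - (r k * sin (\<omega> * t))\<^sup>2)) * (r k * (cos (\<omega> * t) * \<omega>))) (at t)" .
      from DERIV_cmult[OF this, of "1 / \<omega>"]
      show ?thesis unfolding H_def[abs_def]
        by (rule DERIV_cong) (use \<omega> in \<open>simp add: H'_def divide_inverse\<close>)
    qed
    show "\<bar>H k t\<bar> \<le> \<eta>" for k t
    proof -
      have "\<bar>arcsin (r k * sin (\<omega> * t))\<bar> \<le> pi / 2"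
        using arcsin_lbound[of "r k * sin (\<omega> * t)"] arcsin_ubound[of "r k * sin (\<omega> * t)"]
          in_range'[where k=k and y="\<omega> * t"] by (simp add: abs_le_iff)
      then have "\<bar>H k t\<bar> \<le> (1 / \<omega>) * (pi / 2)"
        unfolding H_def abs_mult using \<omega> by (intro mult_mono) auto
      also have "\<dots> = \<eta>" using assms by (simp add: \<omega>_def)
      finally show ?thesis .
    qed
    show "\<bar>H' k t\<bar> \<le> 1" for k t
    proof -
      let ?q = "1 - (r k * sin (\<omega> * t))\<^sup>2"
      have q: "?q > 0" using in_range[of k "\<omega> * t"] abs_square_less_1[of "r k * sin (\<omega> * t)"] by simp
      have "(r k * sin (\<omega> * t))\<^sup>2 + (r k * cos (\<omega> * t))\<^sup>2
          = (r k)\<^sup>2 * ((sin (\<omega> * t))\<^sup>2 + (cos (\<omega> * t))\<^sup>2)"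
        by (simp only: power_mult_distrib distrib_left)
      also have "\<dots> \<le> 1" using r[of k] by (simp add: power_le_one)
      finally have "(r k * cos (\<omega> * t))\<^sup>2 \<le> ?q" by linarith
      then have "\<bar>r k * cos (\<omega> * t)\<bar> \<le> sqrt ?q" by (metis real_sqrt_abs real_sqrt_le_mono)
      then show ?thesis using q by (simp add: H'_def abs_mult)
    qed
    show "(\<lambda>k. H' k t) \<longlonglongrightarrow> (if cos (\<omega> * t) > 0 then 1 else - 1)" if nz: "cos (\<omega> * t) \<noteq> 0" for t
    proof -
      have "(\<lambda>k. inverse (real (Suc (Suc k)))) \<longlonglongrightarrow> 0"
        using LIMSEQ_Suc[OF LIMSEQ_inverse_real_of_nat] .
      from tendsto_diff[OF tendsto_const this, of 1]
      have r1: "r \<longlonglongrightarrow> 1" by (simp only: r_def[abs_def] diff_zero)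
      have s: "1 - (1 * sin (\<omega> * t))\<^sup>2 = (cos (\<omega> * t))\<^sup>2" by (simp add: cos_squared_eq)
      have "(\<lambda>k. H' k t) \<longlonglongrightarrow> 1 * cos (\<omega> * t) / sqrt (1 - (1 * sin (\<omega> * t))\<^sup>2)"
        unfolding H'_def using nz s by (intro tendsto_intros r1) (simp only: real_sqrt_eq_0_iff power_eq_0_iff, simp)
      moreover have "1 * cos (\<omega> * t) / sqrt (1 - (1 * sin (\<omega> * t))\<^sup>2) = (if cos (\<omega> * t) > 0 then 1 else - 1)"
        using nz unfolding s by (auto simp: field_simps)
      ultimately show ?thesis by simp
    qed
  qed (rule \<omega>)
qed

lemma AE_cos_nonzero:
  fixes m :: "'a::euclidean_space"
  assumes "\<omega> \<noteq> 0" "m \<noteq> 0"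
  shows "AE x in lebesgue. cos (\<omega> * (x \<bullet> m)) \<noteq> 0"
proof -
  have "{x. cos (\<omega> * (x \<bullet> m)) = 0} \<subseteq> (\<Union>i::int. {x. m \<bullet> x = (of_int i * pi + pi / 2) / \<omega>})"
    using assms(1) by (auto simp: cos_zero_iff_int2 field_simps inner_commute)
  moreover have "negligible (\<Union>i::int. {x. m \<bullet> x = (of_int i * pi + pi / 2) / \<omega>})"
    by (intro negligible_countable_Union) (use assms(2) negligible_hyperplane in auto)
  ultimately have "negligible {x. cos (\<omega> * (x \<bullet> m)) = 0}" by (rule negligible_subset[rotated])
  then have "AE x in lebesgue. x \<notin> {x. cos (\<omega> * (x \<bullet> m)) = 0}"
    by (intro AE_not_in) (simp add: negligible_iff_null_sets)
  then show ?thesis by simp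
qed

lemma dominated_L2_small:
  fixes g :: "nat \<Rightarrow> 'a::euclidean_space \<Rightarrow> real" and D :: "'a \<Rightarrow> real"
  assumes D: "D \<in> L2 \<Omega>" and g: "\<And>k. g k \<in> borel_measurable (lebesgue_on \<Omega>)"
    and bound: "\<And>k x. x \<in> \<Omega> \<Longrightarrow> \<bar>g k x\<bar> \<le> C * \<bar>D x\<bar>"
    and lim: "AE x in lebesgue_on \<Omega>. (\<lambda>k. g k x) \<longlonglongrightarrow> 0" and \<epsilon>: "\<epsilon> > 0"
  shows "\<exists>k. (\<integral>\<^sup>+x. ennreal ((g k x)\<^sup>2) \<partial>lebesgue_on \<Omega>) \<le> ennreal \<epsilon>"
proof -
  have CD: "integrable (lebesgue_on \<Omega>) (\<lambda>x. C\<^sup>2 * (norm (D x))\<^sup>2)" using D by (simp add: L2_iff)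
  have b: "(g k x)\<^sup>2 \<le> C\<^sup>2 * (norm (D x))\<^sup>2" if "x \<in> \<Omega>" for k x
    using power_mono[OF bound[OF that, of k], of 2] by (simp add: power_mult_distrib)
  have "(\<lambda>k. \<integral>\<^sup>+x. ennreal ((g k x)\<^sup>2) \<partial>lebesgue_on \<Omega>) \<longlonglongrightarrow> (\<integral>\<^sup>+x. 0 \<partial>lebesgue_on \<Omega>)"
  proof (rule nn_integral_dominated_convergence[where w = "\<lambda>x. ennreal (C\<^sup>2 * (norm (D x))\<^sup>2)"])
    show "(\<lambda>x. ennreal ((g k x)\<^sup>2)) \<in> borel_measurable (lebesgue_on \<Omega>)" for k using g[of k] by measurable
    show "(\<lambda>x. ennreal (C\<^sup>2 * (norm (D x))\<^sup>2)) \<in> borel_measurable (lebesgue_on \<Omega>)"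
      using CD by (intro measurable_compose[OF borel_measurable_integrable measurable_ennreal])
    show "AE x in lebesgue_on \<Omega>. ennreal ((g k x)\<^sup>2) \<le> ennreal (C\<^sup>2 * (norm (D x))\<^sup>2)" for k
      by (intro AE_I2 ennreal_leI b) simp
    show "(\<integral>\<^sup>+x. ennreal (C\<^sup>2 * (norm (D x))\<^sup>2) \<partial>lebesgue_on \<Omega>) < \<infinity>"
      using CD unfolding integrable_iff_bounded by (simp only: real_norm_def abs_mult abs_power2 power2_abs)
    show "AE x in lebesgue_on \<Omega>. (\<lambda>k. ennreal ((g k x)\<^sup>2)) \<longlonglongrightarrow> 0"
      using lim
    proof eventually_elim
      case (elim x)
      have "(\<lambda>k. (g k x)\<^sup>2) \<longlonglongrightarrow> 0\<^sup>2" by (intro tendsto_intros elim)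
      then have "(\<lambda>k. ennreal ((g k x)\<^sup>2)) \<longlonglongrightarrow> ennreal 0" by (intro tendsto_ennrealI) simp
      then show ?case by simp
    qed
  qed simp
  then have "(\<lambda>k. \<integral>\<^sup>+x. ennreal ((g k x)\<^sup>2) \<partial>lebesgue_on \<Omega>) \<longlonglongrightarrow> 0" by simp
  then have "\<forall>\<^sub>F k in sequentially. (\<integral>\<^sup>+x. ennreal ((g k x)\<^sup>2) \<partial>lebesgue_on \<Omega>) < ennreal \<epsilon>"
    by (rule order_tendstoD) (use \<epsilon> in simp)
  then show ?thesis by (meson eventually_sequentially order_refl less_imp_le)
qed

lemma norm_add_square_Young:
  fixes a b :: "'a::real_inner" and \<delta> :: real
  assumes "\<delta> > 0"
  shows "(norm (a + b))\<^sup>2 \<le> (1 + \<delta>) * (norm a)\<^sup>2 + (1 + 1 / \<delta>) * (norm b)\<^sup>2"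
proof -
  have e: "\<delta> * (1 / \<delta>) = 1" using assms by simp
  have "0 \<le> \<delta> * (norm (a - (1 / \<delta>) *\<^sub>R b))\<^sup>2" using assms by simp
  also have "\<dots> = \<delta> * (a \<bullet> a) - 2 * (\<delta> * (1 / \<delta>)) * (a \<bullet> b) + (\<delta> * (1 / \<delta>)) * (1 / \<delta>) * (b \<bullet> b)"
    unfolding power2_norm_eq_inner
    by (simp add: inner_diff_left inner_diff_right inner_commute algebra_simps)
  finally have "2 * (a \<bullet> b) \<le> \<delta> * (a \<bullet> a) + (1 / \<delta>) * (b \<bullet> b)" unfolding e by simp
  then show ?thesis
    unfolding power2_norm_eq_inner
    by (simp add: inner_add_left inner_add_right inner_commute distrib_right)
qed

lemma Cinfc_scaleR:
  fixes d :: "'a::euclidean_space \<Rightarrow> 'b::euclidean_space"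
  assumes "open \<Omega>" "\<psi> \<in> Cinfc \<Omega>" "\<And>k. Ck_on k \<Omega> d"
  shows "(\<lambda>x. \<psi> x *\<^sub>R d x) \<in> Cinfc \<Omega>"
proof -
  let ?f = "\<lambda>x. \<psi> x *\<^sub>R d x"
  have "Ck_on k UNIV ?f" for k
  proof -
    have "Ck_on k \<Omega> ?f"
      by (intro Ck_on_scaleR assms(1,3) Ck_on_subset[OF Ck_on_Cinfc[OF assms(2)]]) simp
    moreover have "Ck_on k (- supp \<psi>) ?f"
      by (rule Ck_on_cong[of _ "\<lambda>x. 0"]) (auto simp: supp_zero intro: Ck_on_const)
    ultimately have "Ck_on k (\<Omega> \<union> - supp \<psi>) ?f" by (intro Ck_on_Un assms(1)) auto
    moreover have "\<Omega> \<union> - supp \<psi> = UNIV" using Cinfc_supp(2)[OF assms(2)] by auto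
    ultimately show ?thesis by simp
  qed
  moreover have s: "supp ?f \<subseteq> supp \<psi>" by (rule supp_subset) (use supp_zero[of _ \<psi>] in auto)
  moreover have "compact (supp ?f)"
    using compact_Int_closed[OF Cinfc_supp(1)[OF assms(2)] closed_supp[of ?f]] s by (simp add: Int_absorb1)
  ultimately show ?thesis
    using Cinfc_supp(2)[OF assms(2)] unfolding Cinfc_def smooth_on_def by blast
qed

lemma Cinfc_scaleR_smooth:
  fixes w :: "'a::euclidean_space \<Rightarrow> 'b::euclidean_space"
  assumes "w \<in> Cinfc \<Omega>" "\<And>k. Ck_on k UNIV f"
  shows "(\<lambda>x. f x *\<^sub>R w x) \<in> Cinfc \<Omega>"
proof -
  have s: "supp (\<lambda>x. f x *\<^sub>R w x) \<subseteq> supp w" by (rule supp_subset) (use supp_zero[of _ w] in auto)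
  then show ?thesis
    using compact_supp_mono[OF Cinfc_supp(1)[OF assms(1)] s] Cinfc_supp(2)[OF assms(1)]
      Ck_on_scaleR[OF open_UNIV assms(2) Ck_on_Cinfc[OF assms(1)]]
    unfolding Cinfc_def smooth_on_def by blast
qed

lemma Cinfc_sum:
  fixes w :: "'i \<Rightarrow> 'a::euclidean_space \<Rightarrow> 'b::euclidean_space"
  assumes "finite I" "\<And>i. i \<in> I \<Longrightarrow> w i \<in> Cinfc \<Omega>"
  shows "(\<lambda>x. \<Sum>i\<in>I. w i x) \<in> Cinfc \<Omega>"
proof -
  let ?f = "\<lambda>x. \<Sum>i\<in>I. w i x"
  have K: "compact (\<Union>i\<in>I. supp (w i))" by (intro compact_UN assms(1)) (rule Cinfc_supp(1)[OF assms(2)])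
  have nz: "x \<in> (\<Union>i\<in>I. supp (w i))" if "?f x \<noteq> 0" for x
  proof -
    obtain i where "i \<in> I" "w i x \<noteq> 0" using \<open>?f x \<noteq> 0\<close> by (meson sum.neutral)
    then show ?thesis using supp_zero[of x "w i"] by blast
  qed
  have "Ck_on k UNIV ?f" for k by (intro Ck_on_sum open_UNIV) (use assms(2) Ck_on_Cinfc in blast)
  moreover have "(\<Union>i\<in>I. supp (w i)) \<subseteq> \<Omega>" using assms(2) Cinfc_supp(2) by blast
  ultimately show ?thesis
    using compact_supp_subset[of "\<Union>i\<in>I. supp (w i)" ?f, OF K nz]
    unfolding Cinfc_def smooth_on_def by blast
qed

lemma Ck_on_imp_differentiable: "Ck_on 1 UNIV f \<Longrightarrow> f differentiable (at x)"
  by simp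

lemma grad_mat_sum:
  assumes "finite I" "\<And>i. i \<in> I \<Longrightarrow> w i differentiable (at x)"
  shows "grad_mat (\<lambda>x. \<Sum>i\<in>I. w i x) x = (\<Sum>i\<in>I. grad_mat (w i) x)"
proof -
  have "((\<lambda>x. \<Sum>i\<in>I. w i x) has_derivative (\<lambda>v. \<Sum>i\<in>I. frechet_derivative (w i) (at x) v)) (at x)"
    using assms by (intro has_derivative_sum) (simp add: frechet_derivative_works[symmetric])
  from frechet_derivative_at[OF this]
  have "frechet_derivative (\<lambda>x. \<Sum>i\<in>I. w i x) (at x) = (\<lambda>v. \<Sum>i\<in>I. frechet_derivative (w i) (at x) v)"
    by simp
  then show ?thesis by (simp add: grad_mat_def vec_eq_iff)
qed

lemma grad_mat_profile:
  assumes "(H has_real_derivative H') (at (x \<bullet> m))" "w differentiable (at x)"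
  shows "grad_mat (\<lambda>x. H (x \<bullet> m) *\<^sub>R w x) x = H' *\<^sub>R (w x \<otimes>\<^sub>v m) + H (x \<bullet> m) *\<^sub>R grad_mat w x"
proof -
  have "((\<lambda>x. x \<bullet> m) has_derivative (\<lambda>v. v \<bullet> m)) (at x)"
    by (auto intro!: derivative_eq_intros)
  from has_derivative_compose[OF this assms(1)[unfolded has_field_derivative_def]]
  have "((\<lambda>x. H (x \<bullet> m)) has_derivative (\<lambda>v. H' * (v \<bullet> m))) (at x)" .
  moreover have "(w has_derivative frechet_derivative w (at x)) (at x)"
    using assms(2) by (simp add: frechet_derivative_works)
  ultimately have "((\<lambda>x. H (x \<bullet> m) *\<^sub>R w x) has_derivative
      (\<lambda>v. H (x \<bullet> m) *\<^sub>R frechet_derivative w (at x) v + (H' * (v \<bullet> m)) *\<^sub>R w x)) (at x)"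
    by (rule has_derivative_scaleR)
  from frechet_derivative_at[OF this]
  have "frechet_derivative (\<lambda>x. H (x \<bullet> m) *\<^sub>R w x) (at x) =
      (\<lambda>v. H (x \<bullet> m) *\<^sub>R frechet_derivative w (at x) v + (H' * (v \<bullet> m)) *\<^sub>R w x)" by simp
  then show ?thesis
    by (simp add: grad_mat_def vec_eq_iff tensor_def inner_axis' mult_ac)
qed

text \<open>The layers are perpendicular to the normal, so that every planar slice lies within one layer.
  The factor \<open>2\<close> makes up for the fact that each Burgers vector is used in only one of the two kinds of
  layers; the sine bounds the strengths.\<close>

definition laminate :: "slip_system \<Rightarrow> real \<Rightarrow> (nat \<Rightarrow> 2 \<Rightarrow> real^3 \<Rightarrow> real) \<Rightarrow> real set \<Rightarrow> nat \<Rightarrow> real^3 \<Rightarrow> real^3" where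
  "laminate S e c L j x = (if x \<bullet> normal S j \<in> L
     then (2 * (sin (e * c j 1 x) / e)) *\<^sub>R burgers S 1 j
     else (2 * (sin (e * c j 2 x) / e)) *\<^sub>R burgers S 2 j)"

lemma abs_truncation_le:
  assumes "e > 0" shows "\<bar>sin (e * y) / e\<bar> \<le> \<bar>y :: real\<bar>"
  using abs_sin_x_le_abs_x[of "e * y"] assms by (simp add: abs_mult field_simps)

lemma plane_point_normal:
  assumes "valid_slip_system S" "j \<in> slips S"
  shows "plane_point S j t w \<bullet> normal S j = t"
  using assms unfolding valid_slip_system_def plane_point_def
  by (simp add: inner_add_left norm_eq_1)

lemma continuous_on_measurable_lebesgue_on:
  fixes f :: "'a::euclidean_space \<Rightarrow> 'b::euclidean_space"
  assumes "open \<Omega>" "continuous_on \<Omega> f" shows "f \<in> borel_measurable (lebesgue_on \<Omega>)"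
  by (rule continuous_imp_measurable_on_sets_lebesgue[OF assms(2)]) (use assms(1) in auto)

lemma laminate_measurable:
  assumes "open \<Omega>" "\<And>i. continuous_on \<Omega> (c j i)" "L \<in> sets borel"
  shows "laminate S e c L j \<in> borel_measurable (lebesgue_on \<Omega>)"
proof -
  have T: "continuous_on UNIV (\<lambda>y. sin (e * y) / e)" by (cases "e = 0") (auto intro!: continuous_intros)
  have c: "continuous_on \<Omega> (\<lambda>x. sin (e * c j i x) / e)" for i
    using continuous_on_compose2[OF T assms(2)] by simp
  have m: "(\<lambda>x. (2 * (sin (e * c j i x) / e)) *\<^sub>R burgers S i j) \<in> borel_measurable (lebesgue_on \<Omega>)" for i
    by (intro continuous_on_measurable_lebesgue_on[OF assms(1)] continuous_on_scaleR continuous_on_mult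
        continuous_on_const c)
  have "(\<lambda>x. x \<bullet> normal S j) \<in> borel_measurable (lebesgue_on \<Omega>)"
    by (intro continuous_on_measurable_lebesgue_on[OF assms(1)] continuous_intros)
  from measurable_sets[OF this assms(3)]
  have set: "{x \<in> space (lebesgue_on \<Omega>). x \<bullet> normal S j \<in> L} \<in> sets (lebesgue_on \<Omega>)"
    by (simp add: vimage_def Int_def conj_commute)
  show ?thesis
    unfolding laminate_def[abs_def] by (intro measurable_If m set)
qed

text \<open>In one of the two laminates with exchanged layers a given plane carries the first Burgers vector,
  in the other one the second, each at twice its strength. Adding the costs therefore gives at most
  twice the relaxed cost, whatever the layers are, and one of the two laminates costs no more
  than the relaxed energy allows.\<close>

lemma laminate_cost:
  fixes c :: "nat \<Rightarrow> 2 \<Rightarrow> real^3 \<Rightarrow> real" and \<sigma> \<tau> :: real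
  assumes S: "valid_slip_system S" and \<Omega>: "open \<Omega>"
    and c: "\<And>j i. j \<in> slips S \<Longrightarrow> Ck_on 1 \<Omega> (c j i)" and e: "e > 0" and L: "L \<in> sets borel"
  defines "cost \<equiv> (\<lambda>P. ennreal \<sigma> * (\<Sum>j\<in>slips S. sliced_tv S j \<Omega> (laminate S e c P j))
      + ennreal \<tau> * (\<integral>\<^sup>+x. (\<Sum>j\<in>slips S. ennreal (norm (laminate S e c P j x))) \<partial>lebesgue_on \<Omega>))"
  shows "cost L + cost (- L) \<le>
    2 * (ennreal \<sigma> * (\<Sum>j\<in>slips S. \<Sum>i\<in>UNIV. sliced_tv S j \<Omega> (c j i))
      + ennreal \<tau> * (\<Sum>i\<in>UNIV. \<integral>\<^sup>+x. (\<Sum>j\<in>slips S. ennreal \<bar>c j i x\<bar>) \<partial>lebesgue_on \<Omega>))"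
proof -
  have cc: "continuous_on \<Omega> (c j i)" if "j \<in> slips S" for j i using Ck_on_continuous[OF c[OF that]] .
  have cm: "c j i \<in> borel_measurable (lebesgue_on \<Omega>)" if "j \<in> slips S" for j i
    by (rule continuous_on_measurable_lebesgue_on[OF \<Omega> cc[OF that]])
  have curl: "sliced_tv S j \<Omega> (laminate S e c L j) + sliced_tv S j \<Omega> (laminate S e c (- L) j)
      \<le> 2 * (\<Sum>i\<in>UNIV. sliced_tv S j \<Omega> (c j i))" if j: "j \<in> slips S" for j
  proof -
    define f where "f i t = tv (planar_slice S j \<Omega> t) (\<lambda>w. c j i (plane_point S j t w))" for i t
    have "\<exists>F\<in>borel_measurable lborel. AE t in lborel. f i t = F t" for i
      unfolding f_def by (rule slice_tv_ae_borel[OF S j \<Omega> cm[OF j]])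
    then obtain F where F: "\<And>i. F i \<in> borel_measurable lborel" "\<And>i. AE t in lborel. f i t = F i t" by metis
    have slice: "tv (planar_slice S j \<Omega> t) (\<lambda>w. (2 * (sin (e * c j i (plane_point S j t w)) / e)) *\<^sub>R burgers S i j)
        \<le> 2 * f i t" for i t
    proof -
      let ?U = "planar_slice S j \<Omega> t"
      have "Ck_on 1 {w::real^2. t *\<^sub>R normal S j + ((w $ 1) *\<^sub>R dir_y S j + (w $ 2) *\<^sub>R dir_z S j) \<in> \<Omega>}
          (\<lambda>w. c j i (t *\<^sub>R normal S j + ((w $ 1) *\<^sub>R dir_y S j + (w $ 2) *\<^sub>R dir_z S j)))"
        by (rule Ck_on_affine_compose[OF \<Omega> bounded_linear_plane c[OF j]])
      then have c1: "Ck_on 1 ?U (\<lambda>w. c j i (plane_point S j t w))"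
        by (simp only: planar_slice_def plane_point_affine)
      have "tv ?U (\<lambda>w. (2 * (sin (e * c j i (plane_point S j t w)) / e)) *\<^sub>R burgers S i j)
          \<le> ennreal (norm (burgers S i j)) * tv ?U (\<lambda>w. 2 * (sin (e * c j i (plane_point S j t w)) / e))"
        by (rule tv_scaleR_vector)
      also have "\<dots> = tv ?U (\<lambda>w. 2 *\<^sub>R (sin (e * c j i (plane_point S j t w)) / e))"
        using slip_systemD(3)[OF S j] by simp
      also have "\<dots> \<le> ennreal \<bar>2\<bar> * tv ?U (\<lambda>w. sin (e * c j i (plane_point S j t w)) / e)"
        by (rule tv_scaleR)
      also have "\<dots> \<le> 2 * f i t"
        unfolding f_def
        by (intro mult_mono tv_sin_truncation[OF open_planar_slice[OF \<Omega>] c1 e]) auto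
      finally show ?thesis .
    qed
    have bound: "sliced_tv S j \<Omega> (laminate S e c P j) \<le> (\<integral>\<^sup>+t. (if t \<in> P then 2 * F 1 t else 2 * F 2 t) \<partial>lborel)" for P
    proof -
      have pt: "tv (planar_slice S j \<Omega> t) (\<lambda>w. laminate S e c P j (plane_point S j t w))
          \<le> (if t \<in> P then 2 * f 1 t else 2 * f 2 t)" for t
        using slice[of t 1] slice[of t 2] by (simp add: laminate_def plane_point_normal[OF S j])
      have "sliced_tv S j \<Omega> (laminate S e c P j) \<le> (\<integral>\<^sup>+t. (if t \<in> P then 2 * f 1 t else 2 * f 2 t) \<partial>lborel)"
        unfolding sliced_tv_def by (intro nn_integral_mono pt)
      also have "\<dots> = (\<integral>\<^sup>+t. (if t \<in> P then 2 * F 1 t else 2 * F 2 t) \<partial>lborel)"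
        by (rule nn_integral_cong_AE) (use F(2)[of 1] F(2)[of 2] in \<open>eventually_elim, simp\<close>)
      finally show ?thesis .
    qed
    have [measurable]: "L \<in> sets lborel" "- L \<in> sets lborel" using L by auto
    have "sliced_tv S j \<Omega> (laminate S e c L j) + sliced_tv S j \<Omega> (laminate S e c (- L) j)
      \<le> (\<integral>\<^sup>+t. (if t \<in> L then 2 * F 1 t else 2 * F 2 t) \<partial>lborel)
        + (\<integral>\<^sup>+t. (if t \<in> - L then 2 * F 1 t else 2 * F 2 t) \<partial>lborel)"
      by (intro add_mono bound)
    also have "\<dots> = (\<integral>\<^sup>+t. (if t \<in> L then 2 * F 1 t else 2 * F 2 t) + (if t \<in> - L then 2 * F 1 t else 2 * F 2 t) \<partial>lborel)"
      by (rule nn_integral_add[symmetric]) (use F(1)[of 1] F(1)[of 2] in measurable)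
    also have "\<dots> = (\<integral>\<^sup>+t. 2 * F 1 t + 2 * F 2 t \<partial>lborel)"
      by (intro nn_integral_cong) (auto simp: add.commute)
    also have "\<dots> = 2 * (\<integral>\<^sup>+t. F 1 t \<partial>lborel) + 2 * (\<integral>\<^sup>+t. F 2 t \<partial>lborel)"
      using F(1)[of 1] F(1)[of 2] by (simp add: nn_integral_add nn_integral_cmult)
    also have "(\<integral>\<^sup>+t. F 1 t \<partial>lborel) = sliced_tv S j \<Omega> (c j 1)"
      unfolding sliced_tv_def by (rule nn_integral_cong_AE) (use F(2)[of 1] in \<open>eventually_elim, simp add: f_def\<close>)
    also have "(\<integral>\<^sup>+t. F 2 t \<partial>lborel) = sliced_tv S j \<Omega> (c j 2)"
      unfolding sliced_tv_def by (rule nn_integral_cong_AE) (use F(2)[of 2] in \<open>eventually_elim, simp add: f_def\<close>)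
    finally show ?thesis by (simp add: sum_2 distrib_left)
  qed
  define N where "N P = (\<integral>\<^sup>+x. (\<Sum>j\<in>slips S. ennreal (norm (laminate S e c P j x))) \<partial>lebesgue_on \<Omega>)" for P
  define V where "V P = (\<Sum>j\<in>slips S. sliced_tv S j \<Omega> (laminate S e c P j))" for P
  have lm: "laminate S e c P j \<in> borel_measurable (lebesgue_on \<Omega>)" if "j \<in> slips S" "P \<in> sets borel" for j P
    using laminate_measurable[where c=c and j=j, OF \<Omega> cc[OF that(1)] that(2)] .
  have mass: "N L + N (- L) \<le> 2 * (\<Sum>i\<in>UNIV. \<integral>\<^sup>+x. (\<Sum>j\<in>slips S. ennreal \<bar>c j i x\<bar>) \<partial>lebesgue_on \<Omega>)"
  proof -
    have nm: "(\<lambda>x. \<Sum>j\<in>slips S. ennreal (norm (laminate S e c P j x))) \<in> borel_measurable (lebesgue_on \<Omega>)"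
      if "P \<in> sets borel" for P
    proof (rule borel_measurable_sum)
      fix j assume "j \<in> slips S"
      from lm[OF this that] show "(\<lambda>x. ennreal (norm (laminate S e c P j x))) \<in> borel_measurable (lebesgue_on \<Omega>)"
        by measurable
    qed
    have pt: "(\<Sum>j\<in>slips S. ennreal (norm (laminate S e c L j x))) + (\<Sum>j\<in>slips S. ennreal (norm (laminate S e c (- L) j x)))
        \<le> (\<Sum>i\<in>UNIV. 2 * (\<Sum>j\<in>slips S. ennreal \<bar>c j i x\<bar>))" for x
    proof -
      have "ennreal (norm (laminate S e c L j x)) + ennreal (norm (laminate S e c (- L) j x))
          \<le> (\<Sum>i\<in>UNIV. 2 * ennreal \<bar>c j i x\<bar>)" if j: "j \<in> slips S" for j
      proof -
        have n: "norm ((2 * (sin (e * y) / e)) *\<^sub>R burgers S i j) \<le> 2 * \<bar>y\<bar>" for y i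
          using abs_truncation_le[OF e, of y] slip_systemD(3)[OF S j] by simp
        have "norm (laminate S e c L j x) + norm (laminate S e c (- L) j x) \<le> 2 * \<bar>c j 1 x\<bar> + 2 * \<bar>c j 2 x\<bar>"
          using n[of "c j 1 x" 1] n[of "c j 2 x" 2] unfolding laminate_def by (simp split: if_split)
        then have "ennreal (norm (laminate S e c L j x) + norm (laminate S e c (- L) j x))
            \<le> ennreal (2 * \<bar>c j 1 x\<bar> + 2 * \<bar>c j 2 x\<bar>)" by (rule ennreal_leI)
        then show ?thesis by (simp add: sum_2 ennreal_mult')
      qed
      then have "(\<Sum>j\<in>slips S. ennreal (norm (laminate S e c L j x)) + ennreal (norm (laminate S e c (- L) j x)))
          \<le> (\<Sum>j\<in>slips S. \<Sum>i\<in>UNIV. 2 * ennreal \<bar>c j i x\<bar>)" by (rule sum_mono)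
      also have "\<dots> = (\<Sum>i\<in>UNIV. 2 * (\<Sum>j\<in>slips S. ennreal \<bar>c j i x\<bar>))"
        unfolding sum_distrib_left by (rule sum.swap)
      finally show ?thesis by (simp only: sum.distrib)
    qed
    have "N L + N (- L) = (\<integral>\<^sup>+x. (\<Sum>j\<in>slips S. ennreal (norm (laminate S e c L j x)))
        + (\<Sum>j\<in>slips S. ennreal (norm (laminate S e c (- L) j x))) \<partial>lebesgue_on \<Omega>)"
      unfolding N_def by (rule nn_integral_add[symmetric]) (use nm L in auto)
    also have "\<dots> \<le> (\<integral>\<^sup>+x. (\<Sum>i\<in>UNIV. 2 * (\<Sum>j\<in>slips S. ennreal \<bar>c j i x\<bar>)) \<partial>lebesgue_on \<Omega>)"
      by (intro nn_integral_mono pt)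
    also have "\<dots> = (\<Sum>i\<in>UNIV. \<integral>\<^sup>+x. 2 * (\<Sum>j\<in>slips S. ennreal \<bar>c j i x\<bar>) \<partial>lebesgue_on \<Omega>)"
      by (rule nn_integral_sum) (use cm in measurable)
    also have "\<dots> = (\<Sum>i\<in>UNIV. 2 * (\<integral>\<^sup>+x. (\<Sum>j\<in>slips S. ennreal \<bar>c j i x\<bar>) \<partial>lebesgue_on \<Omega>))"
      by (intro sum.cong refl nn_integral_cmult) (use cm in measurable)
    finally show ?thesis by (simp add: sum_distrib_left)
  qed
  have "V L + V (- L) \<le> (\<Sum>j\<in>slips S. 2 * (\<Sum>i\<in>UNIV. sliced_tv S j \<Omega> (c j i)))"
    unfolding V_def sum.distrib[symmetric] by (intro sum_mono curl)
  then have V: "V L + V (- L) \<le> 2 * (\<Sum>j\<in>slips S. \<Sum>i\<in>UNIV. sliced_tv S j \<Omega> (c j i))"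
    by (simp add: sum_distrib_left)
  have "cost L + cost (- L) = ennreal \<sigma> * (V L + V (- L)) + ennreal \<tau> * (N L + N (- L))"
    unfolding cost_def V_def N_def by (simp add: distrib_left add_ac)
  also have "\<dots> \<le> ennreal \<sigma> * (2 * (\<Sum>j\<in>slips S. \<Sum>i\<in>UNIV. sliced_tv S j \<Omega> (c j i)))
      + ennreal \<tau> * (2 * (\<Sum>i\<in>UNIV. \<integral>\<^sup>+x. (\<Sum>j\<in>slips S. ennreal \<bar>c j i x\<bar>) \<partial>lebesgue_on \<Omega>))"
    by (intro add_mono mult_left_mono V mass) auto
  finally show ?thesis by (simp add: distrib_left mult.left_commute)
qed

section \<open>Laminates with almost the relaxed energy\<close>

lemma L2_sum:
  fixes f :: "'i \<Rightarrow> 'a::euclidean_space \<Rightarrow> 'b::euclidean_space"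
  assumes "finite I" "\<And>i. i \<in> I \<Longrightarrow> f i \<in> L2 \<Omega>"
  shows "(\<lambda>x. \<Sum>i\<in>I. f i x) \<in> L2 \<Omega>"
  using assms
proof (induction I rule: finite_induct)
  case empty
  show ?case by (simp add: L2_iff)
next
  case (insert i I)
  then show ?case using L2_add[of "f i" \<Omega> "\<lambda>x. \<Sum>i\<in>I. f i x"] by simp
qed

lemma L2_norm: "f \<in> L2 \<Omega> \<Longrightarrow> (\<lambda>x. norm (f x)) \<in> L2 \<Omega>"
  unfolding L2_iff by (auto intro: borel_measurable_norm)

text \<open>The symmetric part of the plastic distortion is the difference of the symmetrized gradient and
  the elastic strain, which are both square integrable, and it determines the norm of the plastic
  distortion because only one plane is active.\<close>

lemma slip_vectors_L2:
  assumes S: "valid_slip_system S" "slips S \<noteq> {}" and \<Omega>: "open \<Omega>" and u: "u \<in> H1 \<Omega>"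
    and s: "single_plane S \<Omega> s" "\<And>j. j \<in> slips S \<Longrightarrow> continuous_on \<Omega> (s j)"
    and fin: "elastic_energy \<Omega> u (slip_field S s) < \<infinity>" and j: "j \<in> slips S"
  shows "s j \<in> L2 \<Omega>"
proof -
  let ?\<beta> = "slip_field S s"
  have sm: "s k \<in> borel_measurable (lebesgue_on \<Omega>)" if "k \<in> slips S" for k
    by (rule continuous_on_measurable_lebesgue_on[OF \<Omega> s(2)[OF that]])
  have \<beta>m: "?\<beta> \<in> borel_measurable (lebesgue_on \<Omega>)"
    unfolding slip_field_def[abs_def]
    by (intro borel_measurable_sum bounded_linear_measurable[OF bounded_linear_tensor] sm)
  have A: "(\<lambda>x. sym_part (wgrad \<Omega> u x - ?\<beta> x)) \<in> L2 \<Omega>"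
    using elastic_measurable[OF u \<beta>m] fin unfolding L2_def elastic_energy_def by simp
  have sl: "linear sym_part" by (rule bounded_linear.linear[OF bounded_linear_sym_part])
  have "(\<lambda>x. sym_part (wgrad \<Omega> u x) - sym_part (wgrad \<Omega> u x - ?\<beta> x)) \<in> L2 \<Omega>"
    by (intro L2_minus A L2_linear[OF wgrad_L2[OF u] bounded_linear_sym_part])
  moreover have "sym_part (wgrad \<Omega> u x) - sym_part (wgrad \<Omega> u x - ?\<beta> x) = sym_part (?\<beta> x)" for x
    by (simp add: linear_diff[OF sl])
  ultimately have B: "(\<lambda>x. sym_part (?\<beta> x)) \<in> L2 \<Omega>" by simp
  show ?thesis
  proof (rule L2_bound[OF B sm[OF j]])
    fix x assume x: "x \<in> \<Omega>"
    have "norm (s j x) \<le> norm (?\<beta> x)"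
      unfolding slip_field_parts(4)[OF S s(1) x] by (rule member_le_sum) (use j in auto)
    also have "norm (?\<beta> x) \<le> 2 * norm (sym_part (?\<beta> x))"
    proof -
      obtain l where l: "s l x \<bullet> normal S l = 0" "?\<beta> x = s l x \<otimes>\<^sub>v normal S l"
        using single_planeE[OF s(1) x S(2)] by metis
      have "(norm (?\<beta> x))\<^sup>2 = 2 * (norm (sym_part (?\<beta> x)))\<^sup>2"
        unfolding l(2) by (simp add: norm_sym_tensor[OF l(1)])
      also have "\<dots> \<le> (2 * norm (sym_part (?\<beta> x)))\<^sup>2" by (simp add: power_mult_distrib)
      finally show ?thesis by (rule power2_le_imp_le) simp
    qed
    finally show "norm (s j x) \<le> 2 * norm (sym_part (?\<beta> x))" .
  qed
qed

lemma ennreal_min_le_average: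
  fixes a b m :: ennreal assumes "a + b \<le> 2 * m" "m < \<infinity>" shows "a \<le> m \<or> b \<le> m"
proof (rule ccontr)
  assume "\<not> (a \<le> m \<or> b \<le> m)"
  then have "m \<le> a" "m < b" by auto
  have "m + b \<le> a + b" using \<open>m \<le> a\<close> by (rule add_right_mono)
  also have "\<dots> \<le> m + m" using assms(1) by (simp add: mult_2)
  finally have "b \<le> m" using assms(2) by (auto simp: ennreal_add_left_cancel_le)
  then show False using \<open>m < b\<close> by simp
qed

lemma sum_four_squares_le:
  fixes a b c d :: real shows "(a + b + c + d)\<^sup>2 \<le> 4 * (a\<^sup>2 + b\<^sup>2 + c\<^sup>2 + d\<^sup>2)"
proof -
  have "4 * (a\<^sup>2 + b\<^sup>2 + c\<^sup>2 + d\<^sup>2) - (a + b + c + d)\<^sup>2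
     = (a - b)\<^sup>2 + (a - c)\<^sup>2 + (a - d)\<^sup>2 + (b - c)\<^sup>2 + (b - d)\<^sup>2 + (c - d)\<^sup>2"
    by (simp add: power2_eq_square algebra_simps)
  moreover have "0 \<le> \<dots>" by simp
  ultimately show ?thesis by linarith
qed

lemma truncation_tendsto: "(\<lambda>k. sin (1 / real (Suc k) * y) / (1 / real (Suc k))) \<longlonglongrightarrow> (y::real)"
proof (cases "y = 0")
  case False
  have "((\<lambda>h. sin h / h) \<longlongrightarrow> 1) (at (0::real))"
    using DERIV_sin[of 0] by (simp add: DERIV_def)
  moreover have "filterlim (\<lambda>k. 1 / real (Suc k) * y) (at 0) sequentially"
    unfolding filterlim_at
    using tendsto_mult_right[OF LIMSEQ_inverse_real_of_nat, of y] False
    by (auto simp: inverse_eq_divide)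
  ultimately have "(\<lambda>k. sin (1 / real (Suc k) * y) / (1 / real (Suc k) * y)) \<longlonglongrightarrow> 1"
    by (rule filterlim_compose)
  from tendsto_mult_left[OF this, of y]
  have "(\<lambda>k. y * (sin (1 / real (Suc k) * y) / (1 / real (Suc k) * y))) \<longlonglongrightarrow> y" by simp
  moreover have "y * (sin (1 / real (Suc k) * y) / (1 / real (Suc k) * y)) = sin (1 / real (Suc k) * y) / (1 / real (Suc k))" for k
  proof -
    have "y * (z / (q * y)) = z / q" for z q :: real using False by simp
    then show ?thesis .
  qed
  ultimately show ?thesis by (simp only:)
qed simp

text \<open>By Young's inequality the elastic energy is upper semicontinuous under errors that are small
  in \<open>L2\<close>.\<close>

lemma elastic_energy_perturbation:
  assumes \<Omega>: "open \<Omega>" and u: "u \<in> H1 \<Omega>" and \<beta>: "\<beta> \<in> borel_measurable (lebesgue_on \<Omega>)"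
    and fin: "elastic_energy \<Omega> u \<beta> < \<infinity>" and \<epsilon>: "\<epsilon> > 0"
  obtains \<kappa> where "\<kappa> > 0" "\<And>v \<gamma> g. v \<in> Cinfc \<Omega> \<Longrightarrow> g \<in> borel_measurable (lebesgue_on \<Omega>) \<Longrightarrow>
      (\<integral>\<^sup>+x. ennreal ((g x)\<^sup>2) \<partial>lebesgue_on \<Omega>) \<le> ennreal \<kappa> \<Longrightarrow>
      (\<And>x. x \<in> \<Omega> \<Longrightarrow> norm (\<beta> x - \<gamma> x + grad_mat v x) \<le> g x) \<Longrightarrow>
      elastic_energy \<Omega> (\<lambda>x. u x + v x) \<gamma> \<le> elastic_energy \<Omega> u \<beta> + ennreal \<epsilon>"
proof -
  let ?M = "lebesgue_on \<Omega>"
  obtain e0 where e0: "elastic_energy \<Omega> u \<beta> = ennreal e0" "e0 \<ge> 0"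
    using fin by (cases "elastic_energy \<Omega> u \<beta>") auto
  define \<delta> where "\<delta> = \<epsilon> / (2 * (e0 + 1))"
  have \<delta>: "\<delta> > 0" "\<delta> * e0 \<le> \<epsilon> / 2" using \<epsilon> e0(2) by (auto simp: \<delta>_def field_simps)
  have d1: "1 + 1 / \<delta> > 0" using \<delta>(1) by (simp add: add_pos_pos)
  define \<kappa> where "\<kappa> = \<epsilon> / (2 * (1 + 1 / \<delta>))"
  have \<kappa>: "\<kappa> > 0" unfolding \<kappa>_def using \<epsilon> d1 by (intro divide_pos_pos mult_pos_pos) auto
  have \<kappa>2: "(1 + 1 / \<delta>) * \<kappa> = \<epsilon> / 2"
  proof -
    have "K * (\<epsilon> / (2 * K)) = \<epsilon> / 2" if "K > 0" for K using that by simp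
    from this[OF d1] show ?thesis unfolding \<kappa>_def .
  qed
  show thesis
  proof (rule that[OF \<kappa>])
    fix v \<gamma> g
    assume v: "v \<in> Cinfc \<Omega>" and g: "g \<in> borel_measurable ?M" "(\<integral>\<^sup>+x. ennreal ((g x)\<^sup>2) \<partial>?M) \<le> ennreal \<kappa>"
      and err: "\<And>x. x \<in> \<Omega> \<Longrightarrow> norm (\<beta> x - \<gamma> x + grad_mat v x) \<le> g x"
    define A where "A x = sym_part (wgrad \<Omega> u x - \<beta> x)" for x
    have Am: "A \<in> borel_measurable ?M" unfolding A_def[abs_def] by (rule elastic_measurable[OF u \<beta>])
    have sl: "linear sym_part" by (rule bounded_linear.linear[OF bounded_linear_sym_part])
    have wg: "AE x in ?M. wgrad \<Omega> (\<lambda>x. u x + v x) x = wgrad \<Omega> u x + grad_mat v x"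
      using H1_add_Cinfc(2)[OF \<Omega> u v, of 1] by simp
    have pt: "AE x in ?M. ennreal ((norm (sym_part (wgrad \<Omega> (\<lambda>x. u x + v x) x - \<gamma> x)))\<^sup>2)
        \<le> ennreal (1 + \<delta>) * ennreal ((norm (A x))\<^sup>2) + ennreal (1 + 1 / \<delta>) * ennreal ((g x)\<^sup>2)"
      using wg AE_space
    proof eventually_elim
      case (elim x)
      define B where "B = sym_part (\<beta> x - \<gamma> x + grad_mat v x)"
      have "wgrad \<Omega> (\<lambda>x. u x + v x) x - \<gamma> x = (wgrad \<Omega> u x - \<beta> x) + (\<beta> x - \<gamma> x + grad_mat v x)"
        using elim(1) by simp
      then have AB: "sym_part (wgrad \<Omega> (\<lambda>x. u x + v x) x - \<gamma> x) = A x + B"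
        unfolding A_def B_def by (simp only: linear_add[OF sl, symmetric])
      have "norm B \<le> g x"
        unfolding B_def using elim(2) by (intro order_trans[OF norm_sym_part_le err]) simp
      then have "(1 + 1 / \<delta>) * (norm B)\<^sup>2 \<le> (1 + 1 / \<delta>) * (g x)\<^sup>2"
        using d1 by (intro mult_left_mono power_mono) auto
      then have "(norm (A x + B))\<^sup>2 \<le> (1 + \<delta>) * (norm (A x))\<^sup>2 + (1 + 1 / \<delta>) * (g x)\<^sup>2"
        using norm_add_square_Young[OF \<delta>(1), of "A x" B] by linarith
      then have "ennreal ((norm (A x + B))\<^sup>2) \<le> ennreal ((1 + \<delta>) * (norm (A x))\<^sup>2 + (1 + 1 / \<delta>) * (g x)\<^sup>2)"
        by (rule ennreal_leI)
      also have "\<dots> = ennreal ((1 + \<delta>) * (norm (A x))\<^sup>2) + ennreal ((1 + 1 / \<delta>) * (g x)\<^sup>2)"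
        by (rule ennreal_plus) (use \<delta>(1) d1 in auto)
      also have "\<dots> = ennreal (1 + \<delta>) * ennreal ((norm (A x))\<^sup>2) + ennreal (1 + 1 / \<delta>) * ennreal ((g x)\<^sup>2)"
        using \<delta>(1) d1 by (intro arg_cong2[where f = "(+)"] ennreal_mult) auto
      finally show ?case unfolding AB .
    qed
    have "elastic_energy \<Omega> (\<lambda>x. u x + v x) \<gamma> \<le> (\<integral>\<^sup>+x. ennreal (1 + \<delta>) * ennreal ((norm (A x))\<^sup>2)
        + ennreal (1 + 1 / \<delta>) * ennreal ((g x)\<^sup>2) \<partial>?M)"
      unfolding elastic_energy_def by (rule nn_integral_mono_AE[OF pt])
    also have "\<dots> = ennreal (1 + \<delta>) * (\<integral>\<^sup>+x. ennreal ((norm (A x))\<^sup>2) \<partial>?M)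
        + ennreal (1 + 1 / \<delta>) * (\<integral>\<^sup>+x. ennreal ((g x)\<^sup>2) \<partial>?M)"
      using Am g(1) by (simp add: nn_integral_add nn_integral_cmult)
    also have "(\<integral>\<^sup>+x. ennreal ((norm (A x))\<^sup>2) \<partial>?M) = ennreal e0"
      by (simp add: A_def e0(1)[symmetric] elastic_energy_def)
    also have "ennreal (1 + \<delta>) * ennreal e0 + ennreal (1 + 1 / \<delta>) * (\<integral>\<^sup>+x. ennreal ((g x)\<^sup>2) \<partial>?M)
        \<le> ennreal (1 + \<delta>) * ennreal e0 + ennreal (1 + 1 / \<delta>) * ennreal \<kappa>"
      by (intro add_left_mono mult_left_mono g(2)) auto
    also have "\<dots> = ennreal ((1 + \<delta>) * e0) + ennreal ((1 + 1 / \<delta>) * \<kappa>)"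
      using \<delta>(1) d1 \<kappa> e0(2) by (intro arg_cong2[where f = "(+)"] ennreal_mult[symmetric]) auto
    also have "\<dots> = ennreal ((1 + \<delta>) * e0 + (1 + 1 / \<delta>) * \<kappa>)"
      by (rule ennreal_plus[symmetric]) (use \<delta>(1) d1 \<kappa> e0(2) in auto)
    also have "\<dots> \<le> ennreal (e0 + \<epsilon>)"
      unfolding \<kappa>2 using \<delta>(2) by (intro ennreal_leI) (simp add: distrib_right)
    also have "\<dots> = elastic_energy \<Omega> u \<beta> + ennreal \<epsilon>" using e0 \<epsilon> by simp
    finally show "elastic_energy \<Omega> (\<lambda>x. u x + v x) \<gamma> \<le> elastic_energy \<Omega> u \<beta> + ennreal \<epsilon>" .
  qed
qed

lemma nn_integral_four_squares_le:
  fixes f g h k :: "'a \<Rightarrow> real"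
  assumes m: "f \<in> borel_measurable M" "g \<in> borel_measurable M" "h \<in> borel_measurable M" "k \<in> borel_measurable M"
    and \<kappa>: "\<kappa> \<ge> 0" "(\<integral>\<^sup>+x. ennreal ((f x)\<^sup>2) \<partial>M) \<le> ennreal (\<kappa> / 16)" "(\<integral>\<^sup>+x. ennreal ((g x)\<^sup>2) \<partial>M) \<le> ennreal (\<kappa> / 16)"
      "(\<integral>\<^sup>+x. ennreal ((h x)\<^sup>2) \<partial>M) \<le> ennreal (\<kappa> / 16)" "(\<integral>\<^sup>+x. ennreal ((k x)\<^sup>2) \<partial>M) \<le> ennreal (\<kappa> / 16)"
  shows "(\<integral>\<^sup>+x. ennreal ((f x + g x + h x + k x)\<^sup>2) \<partial>M) \<le> ennreal \<kappa>"
proof -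
  have pt: "ennreal ((f x + g x + h x + k x)\<^sup>2)
      \<le> ennreal 4 * (ennreal ((f x)\<^sup>2) + ennreal ((g x)\<^sup>2) + ennreal ((h x)\<^sup>2) + ennreal ((k x)\<^sup>2))" for x
    using ennreal_leI[OF sum_four_squares_le[of "f x" "g x" "h x" "k x"]] by (simp add: ennreal_mult')
  have "(\<integral>\<^sup>+x. ennreal ((f x + g x + h x + k x)\<^sup>2) \<partial>M) \<le> (\<integral>\<^sup>+x. ennreal 4 *
      (ennreal ((f x)\<^sup>2) + ennreal ((g x)\<^sup>2) + ennreal ((h x)\<^sup>2) + ennreal ((k x)\<^sup>2)) \<partial>M)"
    by (intro nn_integral_mono pt)
  also have "\<dots> = ennreal 4 * ((\<integral>\<^sup>+x. ennreal ((f x)\<^sup>2) \<partial>M) + (\<integral>\<^sup>+x. ennreal ((g x)\<^sup>2) \<partial>M)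
      + (\<integral>\<^sup>+x. ennreal ((h x)\<^sup>2) \<partial>M) + (\<integral>\<^sup>+x. ennreal ((k x)\<^sup>2) \<partial>M))"
    using m by (simp add: nn_integral_add nn_integral_cmult)
  also have "\<dots> \<le> ennreal 4 * (ennreal (\<kappa> / 16) + ennreal (\<kappa> / 16) + ennreal (\<kappa> / 16) + ennreal (\<kappa> / 16))"
    by (intro mult_left_mono add_mono \<kappa>) auto
  also have "\<dots> = ennreal 4 * ennreal (\<kappa> / 4)"
    using \<kappa>(1) by (simp del: ennreal_plus add: ennreal_plus[symmetric])
  also have "\<dots> = ennreal (4 * (\<kappa> / 4))" by (rule ennreal_mult[symmetric]) (use \<kappa>(1) in auto)
  also have "\<dots> = ennreal \<kappa>" by simp
  finally show ?thesis .
qed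

text \<open>The displacement that compensates the oscillations of a laminate.\<close>

definition plane_waves :: "slip_system \<Rightarrow> (real \<Rightarrow> real) \<Rightarrow> (nat \<Rightarrow> real^3 \<Rightarrow> real^3) \<Rightarrow> real^3 \<Rightarrow> real^3" where
  "plane_waves S H w x = (\<Sum>j\<in>slips S. H (x \<bullet> normal S j) *\<^sub>R w j x)"

lemma plane_wave_Cinfc:
  fixes w :: "'a::euclidean_space \<Rightarrow> 'b::euclidean_space"
  assumes "\<And>k. Ck_on k UNIV H" "w \<in> Cinfc \<Omega>"
  shows "(\<lambda>x. H (x \<bullet> m) *\<^sub>R w x) \<in> Cinfc \<Omega>"
proof (rule Cinfc_scaleR_smooth[OF assms(2)])
  show "Ck_on k UNIV (\<lambda>x. H (x \<bullet> m))" for k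
    by (rule Ck_on_real_compose[OF open_UNIV open_UNIV assms(1) Ck_on_linear UNIV_I])
       (simp_all add: bounded_linear_inner_left)
qed

lemma plane_waves_Cinfc:
  assumes "\<And>k. Ck_on k UNIV H" "\<And>j. j \<in> slips S \<Longrightarrow> w j \<in> Cinfc \<Omega>"
  shows "plane_waves S H w \<in> Cinfc \<Omega>"
  unfolding plane_waves_def[abs_def] by (intro Cinfc_sum plane_wave_Cinfc assms finite_atLeastAtMost)

lemma grad_mat_plane_waves:
  assumes "\<And>k. Ck_on k UNIV H" "\<And>t. (H has_real_derivative H' t) (at t)" "\<And>j. j \<in> slips S \<Longrightarrow> w j \<in> Cinfc \<Omega>"
  shows "grad_mat (plane_waves S H w) x = (\<Sum>j\<in>slips S. H' (x \<bullet> normal S j) *\<^sub>R (w j x \<otimes>\<^sub>v normal S j)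
      + H (x \<bullet> normal S j) *\<^sub>R grad_mat (w j) x)"
proof -
  have "grad_mat (plane_waves S H w) x = (\<Sum>j\<in>slips S. grad_mat (\<lambda>x. H (x \<bullet> normal S j) *\<^sub>R w j x) x)"
    unfolding plane_waves_def[abs_def]
    by (rule grad_mat_sum) (use Ck_on_imp_differentiable[OF Ck_on_Cinfc[OF plane_wave_Cinfc[OF assms(1,3)]]] in auto)
  also have "\<dots> = (\<Sum>j\<in>slips S. H' (x \<bullet> normal S j) *\<^sub>R (w j x \<otimes>\<^sub>v normal S j)
      + H (x \<bullet> normal S j) *\<^sub>R grad_mat (w j) x)"
    by (intro sum.cong refl grad_mat_profile assms(2) Ck_on_imp_differentiable Ck_on_Cinfc[OF assms(3)])
  finally show ?thesis .
qed

definition coords :: "slip_system \<Rightarrow> (nat \<Rightarrow> real^3 \<Rightarrow> real^3) \<Rightarrow> nat \<Rightarrow> 2 \<Rightarrow> real^3 \<Rightarrow> real" where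
  "coords S s j i x = slip_coord S j (s j x) $ i"

lemma laminate_admissible:
  assumes S: "valid_slip_system S" "slips S \<noteq> {}" and \<Omega>: "open \<Omega>" and s: "single_plane S \<Omega> s"
    and c: "\<And>j i. j \<in> slips S \<Longrightarrow> continuous_on \<Omega> (coords S s j i)" and e: "e > 0" and P: "P \<in> sets borel"
  shows "single_plane S \<Omega> (laminate S e (coords S s) P)"
    "slip_field S (laminate S e (coords S s) P) \<in> Linf \<Omega>"
    "\<exists>i q. laminate S e (coords S s) P j x = q *\<^sub>R burgers S i j"
proof -
  let ?r = "laminate S e (coords S s) P"
  have z: "slip_coord S j 0 = 0" for j
    using linear_0[OF bounded_linear.linear[OF bounded_linear_slip_coord]] .
  show single: "single_plane S \<Omega> ?r"
    unfolding single_plane_def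
  proof (intro ballI conjI impI)
    fix x j assume x: "x \<in> \<Omega>" and j: "j \<in> slips S"
    show "?r j x \<bullet> normal S j = 0"
      unfolding laminate_def using slip_systemD(4)[OF S(1) j] by simp
    fix l assume l: "l \<in> slips S" "j \<noteq> l"
    have "s j x = 0 \<or> s l x = 0" using s x j l unfolding single_plane_def by blast
    then show "?r j x = 0 \<or> ?r l x = 0" by (auto simp: laminate_def coords_def z)
  qed
  show "\<exists>i q. ?r j x = q *\<^sub>R burgers S i j" unfolding laminate_def by auto
  have rm: "?r j \<in> borel_measurable (lebesgue_on \<Omega>)" if "j \<in> slips S" for j
    using laminate_measurable[where c="coords S s" and j=j, OF \<Omega> c[OF that] P] .
  have m: "slip_field S ?r \<in> borel_measurable (lebesgue_on \<Omega>)"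
    unfolding slip_field_def[abs_def]
    by (intro borel_measurable_sum bounded_linear_measurable[OF bounded_linear_tensor] rm)
  have "norm (slip_field S ?r x) \<le> (\<Sum>j\<in>slips S. 2 / e)" if "x \<in> \<Omega>" for x
  proof -
    have "norm (?r j x) \<le> 2 / e" if j: "j \<in> slips S" for j
    proof -
      have "norm ((2 * (sin y / e)) *\<^sub>R burgers S i j) \<le> 2 / e" for y i
        using slip_systemD(3)[OF S(1) j] e abs_sin_le_one[of y] by (simp add: abs_mult divide_right_mono)
      then show ?thesis unfolding laminate_def by simp
    qed
    then show ?thesis unfolding slip_field_parts(4)[OF S single that] by (rule sum_mono)
  qed
  then have "AE x in lebesgue_on \<Omega>. norm (slip_field S ?r x) \<le> (\<Sum>j\<in>slips S. 2 / e)" by (intro AE_I2) simp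
  with m show "slip_field S ?r \<in> Linf \<Omega>" unfolding Linf_def by blast
qed

text \<open>With \<open>a\<^sub>i\<close> the truncated coefficients and
  \<open>d = a\<^sub>1 b\<^sub>1 - a\<^sub>2 b\<^sub>2\<close>, the laminate is \<open>a\<^sub>1 b\<^sub>1 + a\<^sub>2 b\<^sub>2 \<plusminus> d\<close>, and the displacement
  \<open>H (x \<bullet> m) \<psi> d\<close> with a triangle wave \<open>H\<close> and a cutoff \<open>\<psi>\<close> has the gradient
  \<open>H' \<psi> d \<otimes> m + H \<nabla> (\<psi> d)\<close>. The four error terms stem from the truncation, the cutoff,
  the last summand and the smoothing of the wave; they are made small in this order.\<close>

lemma laminate_approximation:
  fixes \<sigma> \<tau> :: real
  assumes S: "valid_slip_system S" "slips S \<noteq> {}" and \<Omega>: "open \<Omega>" and u: "u \<in> H1 \<Omega>"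
    and s: "single_plane S \<Omega> s" "\<And>j. j \<in> slips S \<Longrightarrow> smooth_on \<Omega> (s j)"
    and fin: "energy_rel S \<sigma> \<tau> \<Omega> u (slip_field S s) < \<infinity>" and \<epsilon>: "\<epsilon> > 0"
  shows "\<exists>v\<in>Cinfc \<Omega>. \<exists>\<gamma>\<in>Linf \<Omega>. SSC S \<Omega> \<gamma> \<and>
    energy S \<sigma> \<tau> \<Omega> (\<lambda>x. u x + v x) \<gamma> \<le> energy_rel S \<sigma> \<tau> \<Omega> u (slip_field S s) + ennreal \<epsilon>"
proof -
  let ?J = "slips S" and ?\<beta> = "slip_field S s" and ?M = "lebesgue_on \<Omega>"
  define c where "c = coords S s"
  have c_def': "c j i x = slip_coord S j (s j x) $ i" for j i x by (simp add: c_def coords_def)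
  have sCk: "Ck_on k \<Omega> (s j)" if "j \<in> ?J" for j k using s(2)[OF that] by (simp add: smooth_on_def)
  have cCk: "Ck_on k \<Omega> (c j i)" if "j \<in> ?J" for j i k
    unfolding c_def'[abs_def]
    by (intro Ck_on_component \<Omega> Ck_on_linear_compose[OF \<Omega> bounded_linear_slip_coord] sCk that)
  have c_cont: "continuous_on \<Omega> (c j i)" if "j \<in> ?J" for j i using Ck_on_continuous[OF cCk[OF that]] .
  have cm: "c j i \<in> borel_measurable ?M" if "j \<in> ?J" for j i
    by (rule continuous_on_measurable_lebesgue_on[OF \<Omega> c_cont[OF that]])
  define E0 where "E0 = elastic_energy \<Omega> u ?\<beta>"
  define F0 where "F0 = ennreal \<sigma> * (\<Sum>j\<in>?J. \<Sum>i\<in>UNIV. sliced_tv S j \<Omega> (c j i))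
      + ennreal \<tau> * (\<Sum>i\<in>UNIV. \<integral>\<^sup>+x. (\<Sum>j\<in>?J. ennreal \<bar>c j i x\<bar>) \<partial>?M)"
  have Erel: "energy_rel S \<sigma> \<tau> \<Omega> u ?\<beta> = E0 + F0"
    unfolding energy_rel_slip_field[OF S s(1)] E0_def F0_def c_def'[abs_def] by (simp add: add.assoc)
  have E0fin: "E0 < \<infinity>" and F0fin: "F0 < \<infinity>"
    using fin unfolding Erel by auto
  have sL2: "s j \<in> L2 \<Omega>" if "j \<in> ?J" for j
    by (rule slip_vectors_L2[OF S \<Omega> u s(1) Ck_on_continuous[OF sCk] E0fin[unfolded E0_def] that])
  have cL2: "c j i \<in> L2 \<Omega>" if "j \<in> ?J" for j i
    unfolding c_def'[abs_def]
    by (intro L2_linear[OF _ bounded_linear_vec_nth] L2_linear[OF _ bounded_linear_slip_coord] sL2 that)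
  define D where "D x = (\<Sum>j\<in>?J. \<Sum>i\<in>UNIV. \<bar>c j i x\<bar>)" for x
  have DL2: "D \<in> L2 \<Omega>"
    unfolding D_def[abs_def]
    by (intro L2_sum finite_atLeastAtMost finite_class.finite_UNIV)
       (use L2_norm[OF cL2] in simp)
  have D0: "D x \<ge> 0" for x unfolding D_def by (intro sum_nonneg) auto
  have \<beta>m: "?\<beta> \<in> borel_measurable ?M"
    unfolding slip_field_def[abs_def]
    by (intro borel_measurable_sum bounded_linear_measurable[OF bounded_linear_tensor] L2_measurable[OF sL2])
  obtain \<kappa>0 where \<kappa>0: "\<kappa>0 > 0" and perturb: "\<And>v \<gamma> g. v \<in> Cinfc \<Omega> \<Longrightarrow> g \<in> borel_measurable ?M \<Longrightarrow>
      (\<integral>\<^sup>+x. ennreal ((g x)\<^sup>2) \<partial>?M) \<le> ennreal \<kappa>0 \<Longrightarrow> (\<And>x. x \<in> \<Omega> \<Longrightarrow> norm (?\<beta> x - \<gamma> x + grad_mat v x) \<le> g x) \<Longrightarrow>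
      elastic_energy \<Omega> (\<lambda>x. u x + v x) \<gamma> \<le> E0 + ennreal \<epsilon>"
    using elastic_energy_perturbation[OF \<Omega> u \<beta>m E0fin[unfolded E0_def] \<epsilon>] unfolding E0_def by blast
  define \<kappa> where "\<kappa> = \<kappa>0 / 16"
  have \<kappa>: "\<kappa> > 0" using \<kappa>0 by (simp add: \<kappa>_def)
  \<comment> \<open>truncation at height \<open>1/e\<close>, with \<open>e\<close> so small that its error is negligible in \<open>L2\<close>\<close>
  define T where "T e y = sin (e * y) / e" for e y :: real
  have Tle: "\<bar>T e y\<bar> \<le> \<bar>y\<bar>" if "e > 0" for e y
    unfolding T_def by (rule abs_truncation_le[OF that])
  have Tcont: "continuous_on UNIV (T e)" for e
    unfolding T_def[abs_def] by (cases "e = 0") (auto intro!: continuous_intros)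
  have Tm: "(\<lambda>x. T e (c j i x)) \<in> borel_measurable ?M" if "j \<in> ?J" for e j i
    using measurable_compose[OF cm[OF that] borel_measurable_continuous_onI[OF Tcont]] .
  define g1 where "g1 e x = (\<Sum>j\<in>?J. \<Sum>i\<in>UNIV. \<bar>c j i x - T e (c j i x)\<bar>)" for e x
  have g1m: "g1 e \<in> borel_measurable ?M" for e
    unfolding g1_def[abs_def] by (intro borel_measurable_sum borel_measurable_abs borel_measurable_diff cm Tm)
  have "\<exists>k. (\<integral>\<^sup>+x. ennreal ((g1 (1 / real (Suc k)) x)\<^sup>2) \<partial>?M) \<le> ennreal \<kappa>"
  proof (rule dominated_L2_small[OF DL2 g1m _ _ \<kappa>])
    show "\<bar>g1 (1 / real (Suc k)) x\<bar> \<le> 2 * \<bar>D x\<bar>" for k x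
    proof -
      have le: "\<bar>c j i x - T (1 / real (Suc k)) (c j i x)\<bar> \<le> 2 * \<bar>c j i x\<bar>" for j i
        using Tle[of "1 / real (Suc k)" "c j i x"] by simp
      have "g1 (1 / real (Suc k)) x \<le> (\<Sum>j\<in>?J. \<Sum>i\<in>UNIV. 2 * \<bar>c j i x\<bar>)"
        unfolding g1_def by (intro sum_mono le)
      also have "\<dots> = 2 * D x" by (simp add: D_def sum_distrib_left)
      finally show ?thesis using D0[of x] by (simp add: g1_def sum_nonneg)
    qed
    have "(\<lambda>k. g1 (1 / real (Suc k)) x) \<longlonglongrightarrow> (\<Sum>j\<in>?J. \<Sum>i\<in>UNIV. \<bar>c j i x - c j i x\<bar>)" for x
      unfolding g1_def T_def by (intro tendsto_intros truncation_tendsto)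
    then show "AE x in ?M. (\<lambda>k. g1 (1 / real (Suc k)) x) \<longlonglongrightarrow> 0" by simp
  qed
  then obtain e where e: "e > 0" "(\<integral>\<^sup>+x. ennreal ((g1 e x)\<^sup>2) \<partial>?M) \<le> ennreal \<kappa>"
    by (metis of_nat_0_less_iff zero_less_Suc zero_less_divide_1_iff)
  define a where "a j i x = T e (c j i x)" for j i x
  define d where "d j x = a j 1 x *\<^sub>R burgers S 1 j - a j 2 x *\<^sub>R burgers S 2 j" for j x
  have aCk: "Ck_on k \<Omega> (a j i)" if "j \<in> ?J" for j i k
  proof -
    have "Ck_on k \<Omega> (\<lambda>x. e * c j i x)" by (intro Ck_on_mult Ck_on_const \<Omega> cCk that)
    from Ck_on_real_compose[OF \<Omega> open_UNIV Ck_on_sin_cos[OF open_UNIV, THEN conjunct1] this UNIV_I]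
    have "Ck_on k \<Omega> (\<lambda>x. (1 / e) * sin (e * c j i x))" by (intro Ck_on_mult Ck_on_const \<Omega>)
    then show ?thesis by (simp add: a_def[abs_def] T_def)
  qed
  have dCk: "Ck_on k \<Omega> (d j)" if "j \<in> ?J" for j k
  proof -
    have "Ck_on k \<Omega> (\<lambda>x. a j 1 x *\<^sub>R burgers S 1 j + (- 1) *\<^sub>R (a j 2 x *\<^sub>R burgers S 2 j))"
      by (intro Ck_on_add Ck_on_scaleR Ck_on_const \<Omega> aCk that)
    then show ?thesis by (simp add: d_def[abs_def])
  qed
  have dm: "d j \<in> borel_measurable ?M" if "j \<in> ?J" for j
    by (rule continuous_on_measurable_lebesgue_on[OF \<Omega> Ck_on_continuous[OF dCk[OF that]]])
  have d_le: "norm (d j x) \<le> (\<Sum>i\<in>UNIV. \<bar>c j i x\<bar>)" if "j \<in> ?J" for j x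
  proof -
    have "norm (d j x) \<le> \<bar>a j 1 x\<bar> + \<bar>a j 2 x\<bar>"
      unfolding d_def using norm_triangle_ineq4[of "a j 1 x *\<^sub>R burgers S 1 j" "a j 2 x *\<^sub>R burgers S 2 j"]
        slip_systemD(3)[OF S(1) that] by simp
    then show ?thesis
      using Tle[OF e(1), of "c j 1 x"] Tle[OF e(1), of "c j 2 x"] by (simp add: a_def sum_2)
  qed
  have dD: "(\<Sum>j\<in>?J. norm (d j x)) \<le> D x" for x unfolding D_def by (intro sum_mono d_le)
  \<comment> \<open>a cutoff that removes only a negligible part of \<open>d\<close> near the boundary\<close>
  obtain \<psi>s :: "nat \<Rightarrow> real^3 \<Rightarrow> real" where \<psi>s: "\<And>n. \<psi>s n \<in> Cinfc \<Omega>" "\<And>n x. 0 \<le> \<psi>s n x" "\<And>n x. \<psi>s n x \<le> 1"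
      "\<And>x. (\<lambda>n. \<psi>s n x) \<longlonglongrightarrow> indicator \<Omega> x" using smooth_cutoffs[OF \<Omega>] by blast
  have \<psi>m: "\<psi>s n \<in> borel_measurable ?M" for n by (rule L2_measurable[OF Cinfc_L2[OF \<Omega> \<psi>s(1)]])
  define g2 where "g2 n x = (1 - \<psi>s n x) * (\<Sum>j\<in>?J. norm (d j x))" for n x
  have g2m: "g2 n \<in> borel_measurable ?M" for n
    unfolding g2_def[abs_def]
    by (intro borel_measurable_times borel_measurable_diff borel_measurable_const borel_measurable_sum
        borel_measurable_norm[THEN measurable_compose_rev] dm \<psi>m)
  have "\<exists>n. (\<integral>\<^sup>+x. ennreal ((g2 n x)\<^sup>2) \<partial>?M) \<le> ennreal \<kappa>"
  proof (rule dominated_L2_small[OF DL2 g2m _ _ \<kappa>])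
    show "\<bar>g2 n x\<bar> \<le> 1 * \<bar>D x\<bar>" for n x
    proof -
      have "\<bar>g2 n x\<bar> = (1 - \<psi>s n x) * (\<Sum>j\<in>?J. norm (d j x))"
        using \<psi>s(3)[of n x] by (simp add: g2_def abs_mult sum_nonneg)
      also have "\<dots> \<le> 1 * D x" using \<psi>s(2,3)[of n x] by (intro mult_mono dD) (auto simp: sum_nonneg)
      finally show ?thesis using D0[of x] by simp
    qed
    show "AE x in ?M. (\<lambda>n. g2 n x) \<longlonglongrightarrow> 0"
    proof (rule AE_I2)
      fix x assume "x \<in> space ?M"
      then have "(\<lambda>n. g2 n x) \<longlonglongrightarrow> (1 - 1) * (\<Sum>j\<in>?J. norm (d j x))"
        unfolding g2_def using \<psi>s(4)[of x] by (intro tendsto_intros) simp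
      then show "(\<lambda>n. g2 n x) \<longlonglongrightarrow> 0" by simp
    qed
  qed
  then obtain n where n: "(\<integral>\<^sup>+x. ennreal ((g2 n x)\<^sup>2) \<partial>?M) \<le> ennreal \<kappa>" by blast
  define \<psi> where "\<psi> = \<psi>s n"
  have \<psi>: "\<psi> \<in> Cinfc \<Omega>" "\<And>x. 0 \<le> \<psi> x" "\<And>x. \<psi> x \<le> 1" using \<psi>s by (auto simp: \<psi>_def)
  define w where "w j x = \<psi> x *\<^sub>R d j x" for j x
  have wC: "w j \<in> Cinfc \<Omega>" if "j \<in> ?J" for j
    unfolding w_def[abs_def] by (rule Cinfc_scaleR[OF \<Omega> \<psi>(1) dCk[OF that]])
  have wm: "w j \<in> borel_measurable ?M" if "j \<in> ?J" for j by (rule L2_measurable[OF Cinfc_L2[OF \<Omega> wC[OF that]]])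
  have w_le: "norm (w j x) \<le> norm (d j x)" for j x
    using \<psi>(2,3)[of x] by (simp add: w_def mult_left_le_one_le)
  \<comment> \<open>the amplitude \<open>\<eta>\<close> of the wave is adapted to the now fixed gradients of \<open>\<psi> d\<close>\<close>
  define G where "G x = (\<Sum>j\<in>?J. norm (grad_mat (w j) x))" for x
  have GL2: "G \<in> L2 \<Omega>"
    unfolding G_def[abs_def]
    by (intro L2_sum finite_atLeastAtMost L2_norm)
       (use is_weak_gradient_Cinfc[OF \<Omega> wC] in \<open>simp add: is_weak_gradient_def\<close>)
  define \<Gamma> where "\<Gamma> = (LINT x|?M. (norm (G x))\<^sup>2)"
  have \<Gamma>: "\<Gamma> \<ge> 0" by (simp add: \<Gamma>_def)
  define \<eta> where "\<eta> = sqrt (\<kappa> / (\<Gamma> + 1))"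
  have \<eta>: "\<eta> > 0" using \<kappa> \<Gamma> by (simp add: \<eta>_def)
  define g4 where "g4 x = \<eta> * G x" for x
  have g4m: "g4 \<in> borel_measurable ?M"
    unfolding g4_def[abs_def] by (intro borel_measurable_times borel_measurable_const L2_measurable[OF GL2])
  have g4: "(\<integral>\<^sup>+x. ennreal ((g4 x)\<^sup>2) \<partial>?M) \<le> ennreal \<kappa>"
  proof -
    have "(\<integral>\<^sup>+x. ennreal ((g4 x)\<^sup>2) \<partial>?M) = (\<integral>\<^sup>+x. ennreal (\<eta>\<^sup>2 * (norm (G x))\<^sup>2) \<partial>?M)"
      by (simp add: g4_def power_mult_distrib)
    also have "\<dots> = ennreal (LINT x|?M. \<eta>\<^sup>2 * (norm (G x))\<^sup>2)"
      by (rule nn_integral_eq_integral) (use GL2 in \<open>auto simp: L2_iff\<close>)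
    also have "(LINT x|?M. \<eta>\<^sup>2 * (norm (G x))\<^sup>2) = \<eta>\<^sup>2 * \<Gamma>" by (simp add: \<Gamma>_def)
    also have "\<eta>\<^sup>2 * \<Gamma> \<le> \<kappa>"
    proof -
      have "\<eta>\<^sup>2 = \<kappa> / (\<Gamma> + 1)" using \<kappa> \<Gamma> by (simp add: \<eta>_def)
      then have "\<eta>\<^sup>2 * \<Gamma> + \<eta>\<^sup>2 = \<kappa>" using \<Gamma> by (simp add: field_simps)
      then show ?thesis using zero_le_power2[of \<eta>] by linarith
    qed
    finally show ?thesis by (simp add: ennreal_leI)
  qed
  \<comment> \<open>with the layers fixed, the slopes of the wave approach the square wave \<open>h\<close> almost everywhere\<close>
  obtain \<omega> and Hs Hs' :: "nat \<Rightarrow> real \<Rightarrow> real" where H: "\<omega> > 0" "\<And>k m. Ck_on m UNIV (Hs k)"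
    "\<And>k t. (Hs k has_real_derivative Hs' k t) (at t)" "\<And>k t. \<bar>Hs k t\<bar> \<le> \<eta>" "\<And>k t. \<bar>Hs' k t\<bar> \<le> 1"
    "\<And>t. cos (\<omega> * t) \<noteq> 0 \<Longrightarrow> (\<lambda>k. Hs' k t) \<longlonglongrightarrow> (if cos (\<omega> * t) > 0 then 1 else - 1)"
    using smooth_triangle_wave[OF \<eta>] by blast
  define L where "L = {t. cos (\<omega> * t) > 0}"
  have "open L" unfolding L_def by (intro open_Collect_less continuous_intros)
  then have L_sets: "L \<in> sets borel" by simp
  define h where "h t = (if t \<in> L then 1 else - 1 :: real)" for t
  define g3 where "g3 k x = (\<Sum>j\<in>?J. \<bar>Hs' k (x \<bullet> normal S j) - h (x \<bullet> normal S j)\<bar> * norm (w j x))" for k x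
  have Hs'm: "Hs' k \<in> borel_measurable borel" for k
  proof -
    have "Hs' k t = frechet_derivative (Hs k) (at t) 1" for t
      using frechet_derivative_at[OF H(3)[of k t, unfolded has_field_derivative_def]] by (metis mult_1_right)
    then have "continuous_on UNIV (Hs' k)" using H(2)[of "Suc 0" k] by (simp cong: continuous_on_cong)
    then show ?thesis by (rule borel_measurable_continuous_onI)
  qed
  have hm: "h \<in> borel_measurable borel" unfolding h_def[abs_def] using L_sets by measurable
  have nm: "(\<lambda>x. x \<bullet> normal S j) \<in> borel_measurable ?M" for j
    by (intro continuous_on_measurable_lebesgue_on[OF \<Omega>] continuous_intros)
  have g3m: "g3 k \<in> borel_measurable ?M" for k
    unfolding g3_def[abs_def]
    by (intro borel_measurable_sum borel_measurable_times borel_measurable_abs borel_measurable_diff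
        measurable_compose[OF nm Hs'm] measurable_compose[OF nm hm] borel_measurable_norm[THEN measurable_compose_rev] wm)
  have "\<exists>k. (\<integral>\<^sup>+x. ennreal ((g3 k x)\<^sup>2) \<partial>?M) \<le> ennreal \<kappa>"
  proof (rule dominated_L2_small[OF DL2 g3m _ _ \<kappa>])
    show "\<bar>g3 k x\<bar> \<le> 2 * \<bar>D x\<bar>" for k x
    proof -
      have "\<bar>Hs' k t - h t\<bar> \<le> 2" for t using H(5)[of k t] by (auto simp: h_def abs_le_iff)
      then have "g3 k x \<le> (\<Sum>j\<in>?J. 2 * norm (d j x))"
        unfolding g3_def by (intro sum_mono mult_mono w_le) auto
      also have "\<dots> \<le> 2 * D x" using dD[of x] by (simp flip: sum_distrib_left)
      finally show ?thesis using D0[of x] by (simp add: g3_def sum_nonneg)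
    qed
    have nz: "AE x in lebesgue. \<forall>j\<in>?J. cos (\<omega> * (x \<bullet> normal S j)) \<noteq> 0"
      by (intro AE_finite_allI finite_atLeastAtMost AE_cos_nonzero)
         (use H(1) slip_systemD(1)[OF S(1)] in force)+
    then have "AE x in ?M. \<forall>j\<in>?J. cos (\<omega> * (x \<bullet> normal S j)) \<noteq> 0"
      using \<Omega> by (subst AE_restrict_space_iff) (auto elim: eventually_mono)
    then show "AE x in ?M. (\<lambda>k. g3 k x) \<longlonglongrightarrow> 0"
    proof eventually_elim
      case (elim x)
      have lim: "(\<lambda>k. Hs' k (x \<bullet> normal S j)) \<longlonglongrightarrow> h (x \<bullet> normal S j)" if "j \<in> ?J" for j
        using H(6)[of "x \<bullet> normal S j"] elim that by (simp add: h_def L_def)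
      have "(\<lambda>k. g3 k x) \<longlonglongrightarrow> (\<Sum>j\<in>?J. \<bar>h (x \<bullet> normal S j) - h (x \<bullet> normal S j)\<bar> * norm (w j x))"
        unfolding g3_def by (intro tendsto_intros lim)
      then show ?case by simp
    qed
  qed
  then obtain k where k: "(\<integral>\<^sup>+x. ennreal ((g3 k x)\<^sup>2) \<partial>?M) \<le> ennreal \<kappa>" by blast
  \<comment> \<open>the cheaper one of the two laminates; its oscillating part is \<open>p h d\<close>\<close>
  define cost where "cost P = ennreal \<sigma> * (\<Sum>j\<in>?J. sliced_tv S j \<Omega> (laminate S e c P j))
      + ennreal \<tau> * (\<integral>\<^sup>+x. (\<Sum>j\<in>?J. ennreal (norm (laminate S e c P j x))) \<partial>?M)" for P
  have "cost L + cost (- L) \<le> 2 * F0"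
    unfolding cost_def F0_def by (rule laminate_cost[OF S(1) \<Omega> cCk e(1) L_sets])
  then have "cost L \<le> F0 \<or> cost (- L) \<le> F0" using F0fin by (rule ennreal_min_le_average)
  then obtain P p where P: "cost P \<le> F0" "P = L \<and> p = 1 \<or> P = - L \<and> p = (- 1 :: real)" by blast
  have P_sets: "P \<in> sets borel" using P(2) L_sets by auto
  define r where "r = laminate S e c P"
  have r_eq: "r j x = a j 1 x *\<^sub>R burgers S 1 j + a j 2 x *\<^sub>R burgers S 2 j + (p * h (x \<bullet> normal S j)) *\<^sub>R d j x" for j x
  proof -
    have two: "(2 * y) *\<^sub>R b = y *\<^sub>R b + y *\<^sub>R b" for y and b :: "real^3"
      by (simp only: mult_2 scaleR_left_distrib)
    have "r j x = (if x \<bullet> normal S j \<in> P then (2 * a j 1 x) *\<^sub>R burgers S 1 j else (2 * a j 2 x) *\<^sub>R burgers S 2 j)"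
      by (simp only: r_def laminate_def a_def T_def)
    then show ?thesis using P(2) unfolding h_def d_def by (auto simp: two)
  qed
  note adm = laminate_admissible[OF S \<Omega> s(1) c_cont[unfolded c_def] e(1) P_sets, folded c_def, folded r_def]
  define \<gamma> where "\<gamma> = slip_field S r"
  have \<gamma>: "SSC S \<Omega> \<gamma>" "energy S \<sigma> \<tau> \<Omega> v \<gamma> = elastic_energy \<Omega> v \<gamma> + cost P" for v
    using energy_slip_field[OF S adm(1,3)] unfolding \<gamma>_def cost_def r_def
    by (simp_all add: add.assoc)
  define v where "v = plane_waves S (\<lambda>t. p * Hs k t) w"
  have pH: "Ck_on m UNIV (\<lambda>t. p * Hs k t)" for m by (intro Ck_on_mult Ck_on_const open_UNIV H(2))
  have vC: "v \<in> Cinfc \<Omega>" unfolding v_def by (rule plane_waves_Cinfc[OF pH wC])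
  have grad_v: "grad_mat v x = (\<Sum>j\<in>?J. (p * Hs' k (x \<bullet> normal S j)) *\<^sub>R (w j x \<otimes>\<^sub>v normal S j)
      + (p * Hs k (x \<bullet> normal S j)) *\<^sub>R grad_mat (w j) x)" for x
    unfolding v_def by (rule grad_mat_plane_waves[OF pH DERIV_cmult[OF H(3)] wC])
  have pm: "\<bar>p\<bar> = 1" using P(2) by auto
  have err: "norm (?\<beta> x - \<gamma> x + grad_mat v x) \<le> g1 e x + g2 n x + g3 k x + g4 x"
    if x: "x \<in> \<Omega>" for x
  proof -
    let ?m = "\<lambda>j. normal S j" and ?t = "\<lambda>j. x \<bullet> normal S j"
    define q where "q j = ((\<Sum>i\<in>UNIV. (c j i x - a j i x) *\<^sub>R burgers S i j)
      - (p * h (?t j) * (1 - \<psi> x)) *\<^sub>R d j x + (p * (Hs' k (?t j) - h (?t j))) *\<^sub>R w j x)" for j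
    have dec: "?\<beta> x - \<gamma> x + grad_mat v x = (\<Sum>j\<in>?J. q j \<otimes>\<^sub>v ?m j + (p * Hs k (?t j)) *\<^sub>R grad_mat (w j) x)"
    proof -
      have eq: "s j x \<otimes>\<^sub>v ?m j - r j x \<otimes>\<^sub>v ?m j + ((p * Hs' k (?t j)) *\<^sub>R (w j x \<otimes>\<^sub>v ?m j)
          + (p * Hs k (?t j)) *\<^sub>R grad_mat (w j) x) = q j \<otimes>\<^sub>v ?m j + (p * Hs k (?t j)) *\<^sub>R grad_mat (w j) x"
        if j: "j \<in> ?J" for j
      proof -
        have sj: "s j x = (\<Sum>i\<in>UNIV. c j i x *\<^sub>R burgers S i j)"
          unfolding c_def' using slip_plane_combination[OF S(1) j] s(1) x j unfolding single_plane_def by blast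
        have "s j x - r j x + (p * Hs' k (?t j)) *\<^sub>R w j x = q j"
          unfolding q_def sj r_eq w_def sum_2 by (simp add: algebra_simps)
        then have "q j \<otimes>\<^sub>v ?m j = s j x \<otimes>\<^sub>v ?m j - r j x \<otimes>\<^sub>v ?m j + (p * Hs' k (?t j)) *\<^sub>R (w j x \<otimes>\<^sub>v ?m j)"
          by (metis tensor_add tensor_diff tensor_scaleR)
        then show ?thesis by simp
      qed
      show ?thesis
        unfolding \<gamma>_def slip_field_def grad_v sum_subtractf[symmetric] sum.distrib[symmetric]
        by (rule sum.cong[OF refl eq])
    qed
    have summand: "norm (q j \<otimes>\<^sub>v ?m j + (p * Hs k (?t j)) *\<^sub>R grad_mat (w j) x)
        \<le> (\<Sum>i\<in>UNIV. \<bar>c j i x - T e (c j i x)\<bar>) + (1 - \<psi> x) * norm (d j x)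
          + \<bar>Hs' k (?t j) - h (?t j)\<bar> * norm (w j x) + \<eta> * norm (grad_mat (w j) x)" if j: "j \<in> ?J" for j
    proof -
      have 1: "norm (\<Sum>i\<in>UNIV. (c j i x - a j i x) *\<^sub>R burgers S i j) \<le> (\<Sum>i\<in>UNIV. \<bar>c j i x - T e (c j i x)\<bar>)"
        by (rule order_trans[OF norm_sum]) (simp add: slip_systemD(3)[OF S(1) j] a_def)
      have 2: "norm ((p * h (?t j) * (1 - \<psi> x)) *\<^sub>R d j x) = (1 - \<psi> x) * norm (d j x)"
        using pm \<psi>(3)[of x] by (simp add: abs_mult h_def)
      have 3: "norm ((p * (Hs' k (?t j) - h (?t j))) *\<^sub>R w j x) = \<bar>Hs' k (?t j) - h (?t j)\<bar> * norm (w j x)"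
        using pm by (simp add: abs_mult)
      have 4: "norm ((p * Hs k (?t j)) *\<^sub>R grad_mat (w j) x) \<le> \<eta> * norm (grad_mat (w j) x)"
        using pm H(4)[of k "?t j"] by (simp add: abs_mult mult_right_mono)
      have "norm (q j \<otimes>\<^sub>v ?m j + (p * Hs k (?t j)) *\<^sub>R grad_mat (w j) x)
          \<le> norm (q j) + norm ((p * Hs k (?t j)) *\<^sub>R grad_mat (w j) x)"
        using norm_triangle_ineq[of "q j \<otimes>\<^sub>v ?m j" "(p * Hs k (?t j)) *\<^sub>R grad_mat (w j) x"]
        by (simp only: norm_tensor slip_systemD(1)[OF S(1) j] mult_1_right)
      moreover have "norm (q j) \<le> norm (\<Sum>i\<in>UNIV. (c j i x - a j i x) *\<^sub>R burgers S i j)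
          + norm ((p * h (?t j) * (1 - \<psi> x)) *\<^sub>R d j x) + norm ((p * (Hs' k (?t j) - h (?t j))) *\<^sub>R w j x)"
        unfolding q_def by (rule order_trans[OF norm_triangle_ineq add_right_mono[OF norm_triangle_ineq4]])
      ultimately show ?thesis using 1 2 3 4 by linarith
    qed
    have "norm (?\<beta> x - \<gamma> x + grad_mat v x) \<le> (\<Sum>j\<in>?J. (\<Sum>i\<in>UNIV. \<bar>c j i x - T e (c j i x)\<bar>) + (1 - \<psi> x) * norm (d j x)
          + \<bar>Hs' k (?t j) - h (?t j)\<bar> * norm (w j x) + \<eta> * norm (grad_mat (w j) x))"
      unfolding dec by (rule order_trans[OF norm_sum sum_mono[OF summand]])
    also have "\<dots> = g1 e x + g2 n x + g3 k x + g4 x"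
      unfolding g1_def g2_def g3_def g4_def G_def \<psi>_def by (simp add: sum.distrib sum_distrib_left)
    finally show ?thesis .
  qed
  have "(\<integral>\<^sup>+x. ennreal ((g1 e x + g2 n x + g3 k x + g4 x)\<^sup>2) \<partial>?M) \<le> ennreal \<kappa>0"
    using e(2) n k g4 \<kappa>0 by (intro nn_integral_four_squares_le g1m g2m g3m g4m) (simp_all add: \<kappa>_def)
  then have elastic: "elastic_energy \<Omega> (\<lambda>x. u x + v x) \<gamma> \<le> E0 + ennreal \<epsilon>"
    by (intro perturb[where g = "\<lambda>x. g1 e x + g2 n x + g3 k x + g4 x"] vC err
        borel_measurable_add g1m g2m g3m g4m)
  have "energy S \<sigma> \<tau> \<Omega> (\<lambda>x. u x + v x) \<gamma> \<le> (E0 + ennreal \<epsilon>) + F0"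
    unfolding \<gamma>(2) by (intro add_mono elastic P(1))
  also have "\<dots> = energy_rel S \<sigma> \<tau> \<Omega> u ?\<beta> + ennreal \<epsilon>" unfolding Erel by (simp add: add_ac)
  finally show ?thesis using vC adm(2)[folded \<gamma>_def] \<gamma>(1) by blast
qed


section \<open>Slip patches and the main result\<close>

text \<open>The support of \<open>s\<close> in a patch keeps away from the part of the patch boundary that lies inside
  \<open>\<Omega>\<close>, so that the extension of \<open>s\<close> by zero is smooth there. Outside the patches \<open>\<beta>\<close> vanishes by
  continuity, because the patches have full measure.\<close>

lemma patchwise_slip_field:
  fixes s :: "real^3 \<Rightarrow> real^3" and \<beta> :: "real^3 \<Rightarrow> real^3^3"
  assumes S: "valid_slip_system S" and \<Omega>: "open \<Omega>"
    and patches: "\<And>j. j \<in> slips S \<Longrightarrow> open (\<Omega>p j) \<and> \<Omega>p j \<subseteq> \<Omega>" "disjoint_family_on \<Omega>p (slips S)"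
      "negligible (\<Omega> - (\<Union>j\<in>slips S. \<Omega>p j))"
    and smooth: "smooth_on \<Omega> \<beta>"
    and slip_field: "\<And>j x. j \<in> slips S \<Longrightarrow> x \<in> \<Omega>p j \<Longrightarrow>
        s x \<bullet> normal S j = 0 \<and> \<beta> x = s x \<otimes>\<^sub>v normal S j"
    and supports: "\<And>j. j \<in> slips S \<Longrightarrow>
        closure {x \<in> \<Omega>p j. s x \<noteq> 0} \<subseteq> \<Omega>p j \<union> (frontier \<Omega> \<inter> frontier (\<Omega>p j))"
  defines "r \<equiv> \<lambda>j x. if x \<in> \<Omega>p j then s x else 0"
  shows "single_plane S \<Omega> r" "\<And>j. j \<in> slips S \<Longrightarrow> smooth_on \<Omega> (r j)"
    "\<And>x. x \<in> \<Omega> \<Longrightarrow> \<beta> x = slip_field S r x"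
proof -
  have front: "x \<notin> frontier \<Omega>" if "x \<in> \<Omega>" for x
    using that \<Omega> by (simp add: frontier_def interior_open)
  have unique: "j = k" if "x \<in> \<Omega>p j" "x \<in> \<Omega>p k" "j \<in> slips S" "k \<in> slips S" for x j k
    using patches(2) that unfolding disjoint_family_on_def by blast
  show "single_plane S \<Omega> r"
    unfolding single_plane_def r_def using slip_field unique by (auto simp del: One_nat_def)
  show "smooth_on \<Omega> (r j)" if j: "j \<in> slips S" for j
    unfolding smooth_on_def
  proof
    fix k
    let ?C = "closure {x \<in> \<Omega>p j. s x \<noteq> 0}"
    have 1: "Ck_on k (\<Omega>p j) (r j)"
    proof (rule Ck_on_cong[where f = "\<lambda>x. \<beta> x *v normal S j"])
      show "open (\<Omega>p j)" using patches(1)[OF j] by blast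
      show "\<beta> x *v normal S j = r j x" if "x \<in> \<Omega>p j" for x
        using slip_field[OF j that] that slip_systemD(2)[OF S j] by (simp add: tensor_mult_vec r_def)
      have "bounded_linear (\<lambda>A::real^3^3. A *v normal S j)"
        unfolding linear_conv_bounded_linear[symmetric]
        by (rule linearI) (simp_all add: matrix_vector_mult_add_rdistrib scaleR_matrix_vector_assoc)
      moreover have "Ck_on k (\<Omega>p j) \<beta>"
        using Ck_on_subset[of k \<Omega> \<beta> "\<Omega>p j"] smooth patches(1)[OF j] by (simp add: smooth_on_def)
      ultimately show "Ck_on k (\<Omega>p j) (\<lambda>x. \<beta> x *v normal S j)"
        using patches(1)[OF j] by (intro Ck_on_linear_compose[where L = "\<lambda>A. A *v normal S j"]) auto
    qed
    have 2: "Ck_on k (\<Omega> - ?C) (r j)"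
    proof (rule Ck_on_cong[where f = "\<lambda>x. 0"])
      show "open (\<Omega> - ?C)" using \<Omega> by (intro open_Diff) auto
      show "0 = r j x" if "x \<in> \<Omega> - ?C" for x
      proof -
        have "x \<notin> {x \<in> \<Omega>p j. s x \<noteq> 0}"
          using that closure_subset[of "{x \<in> \<Omega>p j. s x \<noteq> 0}"] by blast
        then show ?thesis by (auto simp: r_def)
      qed
    qed (rule Ck_on_const)
    have "\<Omega> \<subseteq> \<Omega>p j \<union> (\<Omega> - ?C)" using supports[OF j] front by blast
    moreover have "Ck_on k (\<Omega>p j \<union> (\<Omega> - ?C)) (r j)"
      using patches(1)[OF j] \<Omega> by (intro Ck_on_Un 1 2) (auto intro: open_Diff)
    ultimately show "Ck_on k \<Omega> (r j)" using Ck_on_subset by blast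
  qed
  show "\<beta> x = slip_field S r x" if x: "x \<in> \<Omega>" for x
  proof (cases "\<exists>j\<in>slips S. x \<in> \<Omega>p j")
    case True
    then obtain j where j: "j \<in> slips S" "x \<in> \<Omega>p j" by blast
    have "slip_field S r x = r j x \<otimes>\<^sub>v normal S j"
      unfolding slip_field_def
    proof (rule sum_single)
      show "r k x \<otimes>\<^sub>v normal S k = 0" if "k \<in> slips S" "k \<noteq> j" for k
        using unique[OF _ j(2) that(1) j(1)] that(2) by (auto simp: r_def)
    qed (use j in auto)
    then show ?thesis using slip_field[OF j] j(2) by (simp add: r_def)
  next
    case False
    \<comment> \<open>near such a point \<open>\<beta>\<close> vanishes on all patches, hence almost everywhere\<close>
    let ?C = "\<Union>j\<in>slips S. closure {x \<in> \<Omega>p j. s x \<noteq> 0}"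
    have "x \<notin> ?C" using supports front[OF x] False by blast
    moreover have V: "open (\<Omega> - ?C)" using \<Omega> by (intro open_Diff closed_UN) auto
    moreover have "AE y in lebesgue. y \<notin> \<Omega> - (\<Union>j\<in>slips S. \<Omega>p j)"
      by (intro AE_not_in) (use patches(3) in \<open>simp add: negligible_iff_null_sets\<close>)
    then have ae: "AE y in lebesgue. y \<in> \<Omega> - ?C \<longrightarrow> y \<in> {y. (if y \<in> \<Omega> then \<beta> y else 0) = 0}"
    proof eventually_elim
      case (elim y)
      show ?case
      proof
        assume y: "y \<in> \<Omega> - ?C"
        then obtain j where j: "j \<in> slips S" "y \<in> \<Omega>p j" using elim by blast
        have "y \<notin> {x \<in> \<Omega>p j. s x \<noteq> 0}"
          using y j(1) closure_subset[of "{x \<in> \<Omega>p j. s x \<noteq> 0}"] by blast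
        then have "s y = 0" using j(2) by simp
        then show "y \<in> {y. (if y \<in> \<Omega> then \<beta> y else 0) = 0}" using slip_field[OF j] by simp
      qed
    qed
    have "\<beta> x = 0"
    proof (rule ccontr)
      assume nz: "\<beta> x \<noteq> 0"
      have "continuous_on \<Omega> \<beta>" using smooth Ck_on_continuous unfolding smooth_on_def by blast
      then have "continuous_on (\<Omega> - ?C) \<beta>" by (rule continuous_on_subset) blast
      then have W: "open ((\<Omega> - ?C) \<inter> \<beta> -` (- {0}))"
        using continuous_on_open_vimage[OF V, THEN iffD1, rule_format, of \<beta> "- {0}"]
        by (simp add: Int_commute open_Compl del: One_nat_def)
      have "x \<in> (\<Omega> - ?C) \<inter> \<beta> -` (- {0})" using x nz \<open>x \<notin> ?C\<close> by blast
      moreover have "AE y in lebesgue. y \<in> (\<Omega> - ?C) \<inter> \<beta> -` (- {0}) \<longrightarrow> y \<in> {}"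
        using ae by eventually_elim auto
      ultimately show False
        using mem_closed_if_AE_lebesgue_open[OF W closed_empty] by blast
    qed
    moreover have "slip_field S r x = 0" using False by (auto simp: slip_field_def r_def intro!: sum.neutral)
    ultimately show ?thesis by simp
  qed
qed

theorem proposition2p4:
  fixes S :: slip_system and \<sigma> \<tau> :: real
    and \<Omega> :: "(real^3) set" and \<Omega>p :: "nat \<Rightarrow> (real^3) set"
    and u s :: "real^3 \<Rightarrow> real^3" and \<beta> :: "real^3 \<Rightarrow> real^3^3"
  assumes slip: "valid_slip_system S"
    and params: "\<sigma> \<ge> 0" "\<tau> \<ge> 0"
    and domain: "lipschitz_domain \<Omega>"
    and patches: "\<And>j. j \<in> {1..num_slips S} \<Longrightarrow> open (\<Omega>p j) \<and> \<Omega>p j \<subseteq> \<Omega>"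
      "disjoint_family_on \<Omega>p {1..num_slips S}"
      "negligible (\<Omega> - (\<Union>j\<in>{1..num_slips S}. \<Omega>p j))"
    and u: "u \<in> H1 \<Omega>"
    and smooth: "smooth_on \<Omega> \<beta>"
    and slip_field: "\<And>j x. j \<in> {1..num_slips S} \<Longrightarrow> x \<in> \<Omega>p j \<Longrightarrow>
        s x \<bullet> normal S j = 0 \<and> \<beta> x = s x \<otimes>\<^sub>v normal S j"
    and supports: "\<And>j. j \<in> {1..num_slips S} \<Longrightarrow>
        lipschitz_boundary (closure {x \<in> \<Omega>p j. s x \<noteq> 0}) \<and>
        compact (closure {x \<in> \<Omega>p j. s x \<noteq> 0}) \<and>
        closure {x \<in> \<Omega>p j. s x \<noteq> 0} \<subseteq> \<Omega>p j \<union> (frontier \<Omega> \<inter> frontier (\<Omega>p j))"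
  shows "(\<exists>(un :: nat \<Rightarrow> real^3 \<Rightarrow> real^3) (\<beta>n :: nat \<Rightarrow> real^3 \<Rightarrow> real^3^3).
            (\<forall>n. un n \<in> H1 \<Omega> \<and> same_boundary_values \<Omega> (un n) u \<and>
                 \<beta>n n \<in> Linf \<Omega> \<and> SSC S \<Omega> (\<beta>n n)) \<and>
            (\<lambda>n. energy S \<sigma> \<tau> \<Omega> (un n) (\<beta>n n)) \<longlonglongrightarrow> energy_rel S \<sigma> \<tau> \<Omega> u \<beta>)
       \<and> (\<forall>j\<in>{1..num_slips S}. \<forall>v\<in>H1 (\<Omega>p j). \<forall>s1 s2 :: real^3 \<Rightarrow> real^3. \<forall>\<theta>\<in>{0..1}.
            s1 \<in> borel_measurable (lebesgue_on (\<Omega>p j)) \<and> (\<forall>x\<in>\<Omega>p j. s1 x \<bullet> normal S j = 0) \<and>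
            s2 \<in> borel_measurable (lebesgue_on (\<Omega>p j)) \<and> (\<forall>x\<in>\<Omega>p j. s2 x \<bullet> normal S j = 0) \<longrightarrow>
            energy_rel S \<sigma> \<tau> (\<Omega>p j) v
              (\<lambda>x. ((1 - \<theta>) *\<^sub>R s1 x + \<theta> *\<^sub>R s2 x) \<otimes>\<^sub>v normal S j)
            \<le> ennreal (1 - \<theta>) * energy_rel S \<sigma> \<tau> (\<Omega>p j) v (\<lambda>x. s1 x \<otimes>\<^sub>v normal S j)
              + ennreal \<theta> * energy_rel S \<sigma> \<tau> (\<Omega>p j) v (\<lambda>x. s2 x \<otimes>\<^sub>v normal S j))"
proof (intro conjI ballI allI impI)
  have \<Omega>: "open \<Omega>" "\<Omega> \<noteq> {}" using domain by (auto simp: lipschitz_domain_def)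
  have ne: "slips S \<noteq> {}"
  proof
    assume "slips S = {}"
    then have "negligible \<Omega>" using patches(3) by simp
    then show False using open_not_negligible \<Omega> by blast
  qed
  define r where "r = (\<lambda>j x. if x \<in> \<Omega>p j then s x else 0)"
  have supports': "closure {x \<in> \<Omega>p j. s x \<noteq> 0} \<subseteq> \<Omega>p j \<union> (frontier \<Omega> \<inter> frontier (\<Omega>p j))"
    if "j \<in> slips S" for j using supports[OF that] by blast
  note extend = patchwise_slip_field[OF slip \<Omega>(1) patches smooth slip_field supports']
  have r: "single_plane S \<Omega> r" "\<And>j. j \<in> slips S \<Longrightarrow> smooth_on \<Omega> (r j)"
    "\<And>x. x \<in> \<Omega> \<Longrightarrow> \<beta> x = slip_field S r x"
    unfolding r_def by (rule extend(1) extend(2) extend(3); assumption)+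
  define E where "E = energy_rel S \<sigma> \<tau> \<Omega> u \<beta>"
  have E: "E = energy_rel S \<sigma> \<tau> \<Omega> u (slip_field S r)"
    unfolding E_def by (rule energy_rel_cong[OF r(3)])
  define ok where "ok w \<gamma> \<longleftrightarrow> w \<in> H1 \<Omega> \<and> same_boundary_values \<Omega> w u \<and> \<gamma> \<in> Linf \<Omega> \<and> SSC S \<Omega> \<gamma>" for w \<gamma>
  have okI: "ok (\<lambda>x. u x + v x) \<gamma>" if "v \<in> Cinfc \<Omega>" "\<gamma> \<in> Linf \<Omega>" "SSC S \<Omega> \<gamma>" for v \<gamma>
    using that H1_add_Cinfc(1)[OF \<Omega>(1) u that(1), of 1] Cinfc_H10[OF \<Omega>(1) that(1)]
    by (simp add: ok_def same_boundary_values_def)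
  have attain: "\<exists>w. ok w \<gamma> \<and> energy S \<sigma> \<tau> \<Omega> w \<gamma> = e"
    if v: "v \<in> Cinfc \<Omega>" and \<gamma>: "\<gamma> \<in> Linf \<Omega>" "SSC S \<Omega> \<gamma>"
      and e: "energy S \<sigma> \<tau> \<Omega> (\<lambda>x. u x + v x) \<gamma> \<le> e" "e < \<infinity>" for v \<gamma> e
  proof -
    have H: "(\<lambda>x. u x + v x) \<in> H1 \<Omega>" using H1_add_Cinfc(1)[OF \<Omega>(1) u v, of 1] by simp
    have "\<gamma> \<in> borel_measurable (lebesgue_on \<Omega>)" using \<gamma>(1) by (simp add: Linf_def)
    from energy_attains_larger_values[OF \<Omega> H this \<gamma>(2) e]
    obtain \<phi> where \<phi>: "\<phi> \<in> Cinfc \<Omega>" "energy S \<sigma> \<tau> \<Omega> (\<lambda>x. u x + v x + \<phi> x) \<gamma> = e" by blast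
    have "(\<lambda>x. v x + \<phi> x) \<in> Cinfc \<Omega>"
      using Cinfc_sum[of "UNIV :: bool set" "\<lambda>b. if b then v else \<phi>" \<Omega>] v \<phi>(1)
      by (simp add: UNIV_bool add.commute)
    from okI[OF this \<gamma>] \<phi>(2) show ?thesis by (auto simp: add.assoc)
  qed
  have "\<exists>w \<gamma>. ok w \<gamma> \<and> (if E = \<infinity> then energy S \<sigma> \<tau> \<Omega> w \<gamma> \<ge> of_nat n
      else E \<le> energy S \<sigma> \<tau> \<Omega> w \<gamma> \<and> energy S \<sigma> \<tau> \<Omega> w \<gamma> \<le> E + ennreal (1 / real (Suc n)))" for n
  proof (cases "E = \<infinity>")
    case True
    \<comment> \<open>without plastic distortion the energy is finite and can be raised to any level\<close>
    have zero: "(\<lambda>x. 0) \<in> Cinfc \<Omega>" by (auto simp: Cinfc_def smooth_on_def Ck_on_const supp_def)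
    have z: "single_plane S \<Omega> (\<lambda>j x. 0)" by (simp add: single_plane_def)
    have f: "slip_field S (\<lambda>j x. 0) = (\<lambda>x. 0)" by (simp add: slip_field_def fun_eq_iff)
    have zc: "\<exists>i c. 0 = c *\<^sub>R burgers S i j" for j by (intro exI[of _ "1::2"] exI[of _ 0]) simp
    have ssc: "SSC S \<Omega> (\<lambda>x. 0)"
      and en: "energy S \<sigma> \<tau> \<Omega> u (\<lambda>x. 0) = elastic_energy \<Omega> u (\<lambda>x. 0)"
      using energy_slip_field[OF slip ne z zc] unfolding f by simp_all
    have "(\<lambda>x. sym_part (wgrad \<Omega> u x)) \<in> L2 \<Omega>"
      by (rule L2_linear[OF wgrad_L2[OF u] bounded_linear_sym_part])
    then have fin: "elastic_energy \<Omega> u (\<lambda>x. 0) < \<infinity>" by (simp add: L2_def elastic_energy_def)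
    have Li: "(\<lambda>x. 0) \<in> Linf \<Omega>" by (auto simp: Linf_def)
    have "max (elastic_energy \<Omega> u (\<lambda>x. 0)) (of_nat n) < \<infinity>" using fin by (simp add: max_def of_nat_less_top)
    from attain[OF zero Li ssc _ this] en
    obtain w where "ok w (\<lambda>x. 0)" "energy S \<sigma> \<tau> \<Omega> w (\<lambda>x. 0) = max (elastic_energy \<Omega> u (\<lambda>x. 0)) (of_nat n)"
      by auto
    then show ?thesis using True by (intro exI[of _ w] exI[of _ "\<lambda>x. 0"]) auto
  next
    case False
    then have fin: "E < \<infinity>" by (simp add: less_top)
    have pos: "1 / real (Suc n) > 0" by simp
    obtain v \<gamma> where v: "v \<in> Cinfc \<Omega>" "\<gamma> \<in> Linf \<Omega>" "SSC S \<Omega> \<gamma>"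
      and le: "energy S \<sigma> \<tau> \<Omega> (\<lambda>x. u x + v x) \<gamma> \<le> E + ennreal (1 / real (Suc n))"
      using laminate_approximation[OF slip ne \<Omega>(1) u r(1,2) fin[unfolded E] pos] unfolding E by blast
    show ?thesis
    proof (cases "energy S \<sigma> \<tau> \<Omega> (\<lambda>x. u x + v x) \<gamma> \<le> E")
      case True
      from attain[OF v True fin] obtain w where "ok w \<gamma>" "energy S \<sigma> \<tau> \<Omega> w \<gamma> = E" by blast
      then show ?thesis using False by (intro exI[of _ w] exI[of _ \<gamma>]) simp
    next
      case ge: False
      then show ?thesis using False le okI[OF v] by (intro exI[of _ "\<lambda>x. u x + v x"] exI[of _ \<gamma>]) auto
    qed
  qed
  then obtain un \<beta>n where un: "\<And>n. ok (un n) (\<beta>n n)"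
    "\<And>n. if E = \<infinity> then energy S \<sigma> \<tau> \<Omega> (un n) (\<beta>n n) \<ge> of_nat n
      else E \<le> energy S \<sigma> \<tau> \<Omega> (un n) (\<beta>n n) \<and> energy S \<sigma> \<tau> \<Omega> (un n) (\<beta>n n) \<le> E + ennreal (1 / real (Suc n))"
    by metis
  have "(\<lambda>n. energy S \<sigma> \<tau> \<Omega> (un n) (\<beta>n n)) \<longlonglongrightarrow> E"
  proof (cases "E = \<infinity>")
    case True
    have lim: "(\<lambda>n. of_nat n :: ennreal) \<longlonglongrightarrow> \<infinity>" using of_nat_tendsto_top_ennreal by simp
    have lo: "\<forall>n. of_nat n \<le> energy S \<sigma> \<tau> \<Omega> (un n) (\<beta>n n)" using un(2) True by metis
    have hi: "\<forall>n. energy S \<sigma> \<tau> \<Omega> (un n) (\<beta>n n) \<le> \<infinity>" by simp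
    show ?thesis
      unfolding True
      by (rule tendsto_sandwich[OF always_eventually[OF lo] always_eventually[OF hi] lim tendsto_const])
  next
    case False
    have "(\<lambda>n. ennreal (1 / real (Suc n))) \<longlonglongrightarrow> ennreal 0"
      using LIMSEQ_inverse_real_of_nat by (intro tendsto_ennrealI) (simp add: inverse_eq_divide)
    from tendsto_add[OF tendsto_const this, of E]
    have lim: "(\<lambda>n. E + ennreal (1 / real (Suc n))) \<longlonglongrightarrow> E" by simp
    have lo: "\<forall>n. E \<le> energy S \<sigma> \<tau> \<Omega> (un n) (\<beta>n n)" using un(2) False by metis
    have hi: "\<forall>n. energy S \<sigma> \<tau> \<Omega> (un n) (\<beta>n n) \<le> E + ennreal (1 / real (Suc n))"
      using un(2) False by metis
    show ?thesis
      by (rule tendsto_sandwich[OF always_eventually[OF lo] always_eventually[OF hi] tendsto_const lim])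
  qed
  then show "\<exists>(un :: nat \<Rightarrow> real^3 \<Rightarrow> real^3) (\<beta>n :: nat \<Rightarrow> real^3 \<Rightarrow> real^3^3).
            (\<forall>n. un n \<in> H1 \<Omega> \<and> same_boundary_values \<Omega> (un n) u \<and>
                 \<beta>n n \<in> Linf \<Omega> \<and> SSC S \<Omega> (\<beta>n n)) \<and>
            (\<lambda>n. energy S \<sigma> \<tau> \<Omega> (un n) (\<beta>n n)) \<longlonglongrightarrow> energy_rel S \<sigma> \<tau> \<Omega> u \<beta>"
    using un(1) unfolding ok_def E_def by blast
next
  fix j v and s1 s2 :: "real^3 \<Rightarrow> real^3" and \<theta> :: real
  assume "j \<in> {1..num_slips S}" "v \<in> H1 (\<Omega>p j)" "\<theta> \<in> {0..1}"
    "s1 \<in> borel_measurable (lebesgue_on (\<Omega>p j)) \<and> (\<forall>x\<in>\<Omega>p j. s1 x \<bullet> normal S j = 0) \<and>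
     s2 \<in> borel_measurable (lebesgue_on (\<Omega>p j)) \<and> (\<forall>x\<in>\<Omega>p j. s2 x \<bullet> normal S j = 0)"
  then show "energy_rel S \<sigma> \<tau> (\<Omega>p j) v
              (\<lambda>x. ((1 - \<theta>) *\<^sub>R s1 x + \<theta> *\<^sub>R s2 x) \<otimes>\<^sub>v normal S j)
            \<le> ennreal (1 - \<theta>) * energy_rel S \<sigma> \<tau> (\<Omega>p j) v (\<lambda>x. s1 x \<otimes>\<^sub>v normal S j)
              + ennreal \<theta> * energy_rel S \<sigma> \<tau> (\<Omega>p j) v (\<lambda>x. s2 x \<otimes>\<^sub>v normal S j)"
    using patches(1)[of j] by (intro energy_rel_convex[OF slip]) auto
qed

end
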